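(* Let $\Gamma=LG$ or $\Gamma=\overline{\mathrm{Diff}_+(S^1)}$, let $(\mathcal A,U,\Omega)$ be a conformal net, $\tilde\pi_0$ a unitary representation of $\tilde\Gamma$ and $\rho$ a DHR representation of $\mathcal A$ on $\mathcal H_\rho$, all satisfying the standing assumptions listed in the context. Let $\pi_0$ be the local multiplier representation of $\Gamma$ defined by $\tilde\pi_0$, with $\mathbb T$-valued local cocycle $c$, and let $\pi_\rho:\mathcal U\to \mathrm U(\mathcal H_\rho)$ be the map $$\pi_\rho(\gamma)=\pi_{\rho,I_1}(\gamma_1)\,\pi_{\rho,I_2}(\gamma_2)\,\pi_{\rho,I_3}(\gamma_3)\,c(\gamma_1,\gamma_2)^{-1}c(\gamma_1\gamma_2,\gamma_3)^{-1},\qquad \gamma_j=\Xi_j(\gamma),$$ defined in the context. Then there is a sufficiently small neighbourhood $\mathcal V\subset\mathcal U$ of the unit element $e\in\Gamma$ such that: 1. the restriction of $\pi_\rho$ to $\mathcal V$ does not depend on the decomposition: for every $\gamma\in\mathcal V$ and every factorization $\gamma=\gamma_1\gamma_2\gamma_3$ with $\gamma_j\in\mathcal V$ and $\gamma_j$ supported in $I_j$ ($j=1,2,3$), one has $\pi_\rho(\gamma)=\pi_{\rho,I_1}(\gamma_1)\pi_{\rho,I_2}(\gamma_2)\pi_{\rho,I_3}(\gamma_3)c(\gamma_1,\gamma_2)^{-1}c(\gamma_1\gamma_2,\gamma_3)^{-1}$; 2. $\pi_\rho$ is a local multiplier representation of $\Gamma$ with the same cocycle $c$ as $\pi_0$: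 it is strongly continuous on $\mathcal V$ and for all $\gamma,\gamma'\in\mathcal V$ (for which $\gamma\gamma'\in\mathcal U$) $$\pi_\rho(\gamma)\pi_\rho(\gamma')=c(\gamma,\gamma')\,\pi_\rho(\gamma\gamma').$$
   Context: **Conformal nets.** $\mathcal I$ is the set of non-empty open non-dense intervals of $S^1$; $I'$ is the interior of $S^1\setminus I$. A conformal net $(\mathcal A,U,\Omega)$ consists of von Neumann algebras $\mathcal A(I)$, $I\in\mathcal I$, on a separable complex Hilbert space $\mathcal H_0$, a unit vector $\Omega\in\mathcal H_0$, and a strongly continuous projective unitary representation $U$ of $\mathrm{Diff}_+(S^1)$ (orientation-preserving diffeomorphisms) on $\mathcal H_0$ which restricts to a true strongly continuous unitary representation of $\mathrm{PSL}(2,\mathbb R)$ (Möbius transformations), such that: (isotony) $I_1\subset I_2\Rightarrow\mathcal A(I_1)\subset\mathcal A(I_2)$; (locality) $I_1\cap I_2=\emptyset\Rightarrow\mathcal A(I_1)\subset\mathcal A(I_2)'$; (covariance) $U(\gamma)\mathcal A(I)U(\gamma)^{-1}=\mathcal A(\gamma I)$ for all $\gamma\in\mathrm{Diff}_+(S^1)$, and $U(\gamma)xU(\gamma)^{-1}=x$ for $x\in\mathcal A(I)$, $\gamma\in\mathrm{Diff}_+(S^1)$ with support in $I'$; (positive energy) the generator of rotations is $\ge 0$; (vacuum) $\Omega$ is, up to a phase, the unique $\mathrm{PSL}(2,\mathbb R)$-invariant unit vector and $(\bigvee_{I}\mathcal A(I))\Omega$ is dense in $\mathcal H_0$. Each $\mathcal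 A(I)$ is then a type III factor and Haag duality $\mathcal A(I)'=\mathcal A(I')$ holds. **DHR representations.** A DHR representation $\rho=\{\rho_I\}_{I\in\mathcal I}$ of $\mathcal A$ is a family of normal unital representations $\rho_I:\mathcal A(I)\to\mathcal B(\mathcal H_\rho)$ on a fixed (non-zero, separable) Hilbert space with $\rho_{I_2}|_{\mathcal A(I_1)}=\rho_{I_1}$ whenever $I_1\subset I_2$. Each $\rho_I$ is spatial: $\rho_I=\mathrm{Ad}\,V_{\rho,I}$ on $\mathcal A(I)$ for some unitary $V_{\rho,I}:\mathcal H_0\to\mathcal H_\rho$. **Groups.** $G$ is a compact, connected, simple, simply connected Lie group with Lie algebra $\mathfrak g$; $LG=C^\infty(S^1,G)$ with pointwise product and the topology of uniform convergence of all derivatives. $\overline{\mathrm{Diff}_+(S^1)}=\{\gamma\in C^\infty(\mathbb R,\mathbb R):\gamma(t+2\pi)=\gamma(t)+2\pi,\ \gamma'>0\}$ is the universal cover of $\mathrm{Diff}_+(S^1)$ (with $S^1=\mathbb R/2\pi\mathbb Z$), with composition and the topology of uniform convergence of all derivatives. The support of a loop $\gamma$ is the closure of $\{x\in S^1:\gamma(x)\ne e_G\}$; the support of a diffeomorphism is the closure of $\{x:\gamma(x)\neq x\}$. For a proper interval $I$, $\Gamma_I$ is the subgroup of elements supported in $I$ (for $\overline{\mathrm{Diff}_+(S^1)}$: lifts $\gamma$ that fix pointwise the preimage in $\mathbb R$ of a neighbourhood of $S^1\setminus I$). **Central extensions** $1\to H\xrightarrow{\phi}\tilde\Gamma\xrightarrow{\psi}\Gamma\to1$.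 - $\Gamma=LG$, $H=\mathbb T$: $\tilde\Gamma=\tilde LG$ is the basic central extension. Let $\langle\cdot,\cdot\rangle$ be the invariant form on $\mathfrak g$ normalized so that $\langle h_\alpha,h_\alpha\rangle=2$ for long roots, $\omega(\xi,\eta)=\frac1{2\pi}\int_0^{2\pi}\langle\xi(t),\eta'(t)\rangle dt$ on $L\mathfrak g=C^\infty(S^1,\mathfrak g)$, extended to a left-invariant 2-form on $LG$, and $C(\ell)=\exp(i\int_\sigma\omega)$ for a piecewise smooth loop $\ell$ in $LG$ bounding a surface $\sigma$. Then $\tilde LG$ is the set of triples $(\gamma,p,u)$ ($\gamma\in LG$, $p$ a piecewise smooth path from $e$ to $\gamma$, $u\in\mathbb T$) modulo $(\gamma,p,u)\sim(\gamma,p',u')$ iff $u=C(p'*p^{-1})u'$, with product $(\gamma_1,p_1,u_1)(\gamma_2,p_2,u_2)=(\gamma_1\gamma_2,p_1*(\gamma_1p_2),u_1u_2)$. It is simply connected and $\mathrm{Diff}_+(S^1)$ acts on it by the lift of $\lambda\mapsto\lambda\circ\gamma^{-1}$. - $\Gamma=\overline{\mathrm{Diff}_+(S^1)}$, $H=\mathbb R$: $\tilde\Gamma=\mathsf{Vir}=\mathbb R\times\overline{\mathrm{Diff}_+(S^1)}$ with $(a_1,\gamma_1)(a_2,\gamma_2)=(a_1+a_2+\mathbf B(\gamma_1,\gamma_2),\gamma_1\circ\gamma_2)$, $\mathbf B(\gamma_1,\gamma_2)=-\frac1{48\pi}\int_0^{2\pi}\log((\gamma_1\circ\gamma_2)'(t))\,\frac{\gamma_2''(t)}{\gamma_2'(t)}dt$.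 $\tilde\Gamma_I=\psi^{-1}(\Gamma_I)$. **Standing assumptions.** $\tilde\pi_0$ is a strongly continuous unitary representation of $\tilde\Gamma$ on $\mathcal H_0$ with $\tilde\pi_0(\tilde\Gamma_I)\subset\mathcal A(I)$ for all $I\in\mathcal I$ and $\tilde\pi_0(\phi(H))\subset\mathbb T\mathbf 1$. If $\Gamma=\overline{\mathrm{Diff}_+(S^1)}$, $\tilde\pi_0$ is the lift $\tilde U$ of $U$ to a true unitary representation of $\mathsf{Vir}$ (with $\mathbb R$ acting by scalars). If $\Gamma=LG$, $U([\gamma])\tilde\pi_0(\lambda)U([\gamma])^*=\tilde\pi_0(\lambda\circ\gamma^{-1})$ for $\gamma\in\overline{\mathrm{Diff}_+(S^1)}$ with image $[\gamma]\in\mathrm{Diff}_+(S^1)$ and $\lambda\in\tilde LG$. $\rho$ is an arbitrary DHR representation of $\mathcal A$. **Cover and fragmentation.** $I_j=(a_j,b_j)$, $j=1,2,3$, are proper open intervals covering $S^1$, each point lying in at most two of them, in cyclic (anticlockwise) order with angular coordinates $0<a_1<b_3<a_2<b_1<a_3<b_2<2\pi$ ($I_3$ contains the angle $0$). On a neighbourhood of $e\in\Gamma$ there are fixed continuous maps $\Xi_j$ into $\Gamma$ with $\Xi_j(e)=e$, $\Xi_j(\gamma)\in\Gamma_{I_j}$, $\gamma=\Xi_1(\gamma)\Xi_2(\gamma)\Xi_3(\gamma)$, and such that $\mathrm{supp}\,\gamma\subset I_1$ implies $\mathrm{supp}\,\Xi_2(\gamma)\subset I_1\cap I_2$ and $\mathrm{supp}\,\Xi_3(\gamma)\subset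 I_1\cap I_3$ (and, for diffeomorphisms, $\mathrm{supp}\,\gamma\cap(a_2,b_1)=\emptyset$ implies $\Xi_1(\gamma)(\theta)=\theta$ on $(a_2,b_1)$). **Local multiplier representations.** Let $s:\mathcal W\to\tilde\Gamma$ be a continuous local section of $\psi$ ($\psi\circ s=\mathrm{id}$, $s(e)=e$) on a neighbourhood $\mathcal W$ of $e$. Put $\pi_0=\tilde\pi_0\circ s$, and let $c(\gamma,\gamma')\in\mathbb T$ be defined by $\pi_0(\gamma)\pi_0(\gamma')=c(\gamma,\gamma')\pi_0(\gamma\gamma')$ (for $\gamma,\gamma',\gamma\gamma'\in\mathcal W$). For a proper interval $I$, $\pi_{\rho,I}(\gamma)=\rho_I(\pi_0(\gamma))$ for $\gamma\in\Gamma_I\cap\mathcal W$. $\mathcal U$ is a neighbourhood of $e$ on which the $\Xi_j$ are defined, chosen small enough that all elements appearing in the formula for $\pi_\rho$ on $\mathcal U$ lie in $\mathcal W$. A local multiplier representation of $\Gamma$ with local cocycle $c$ is a strongly continuous unitary-valued map $\pi$ on a neighbourhood of $e$ with $\pi(\gamma_1)\pi(\gamma_2)=c(\gamma_1,\gamma_2)\pi(\gamma_1\gamma_2)$. *)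

theory Defs
  imports "HOL-Analysis.Analysis" "HOL-Algebra.Group"
begin

section \<open>Complex Hilbert spaces and operator algebras\<close>

text \<open>The inner product is conjugate-linear in its first argument. Norm, metric and completeness
  come from the real inner product space structure, whose inner product is the real part.
  Separability is expressed by the sort \<open>second_countable_topology\<close>.\<close>

class chilbert = real_inner + complete_space +
  fixes scaleC :: "complex \<Rightarrow> 'a \<Rightarrow> 'a" (infixr "*\<^sub>C" 75)
    and cinner :: "'a \<Rightarrow> 'a \<Rightarrow> complex"
  assumes scaleC_add_right: "z *\<^sub>C (x + y) = z *\<^sub>C x + z *\<^sub>C y"
    and scaleC_add_left: "(z + w) *\<^sub>C x = z *\<^sub>C x + w *\<^sub>C x"
    and scaleC_scaleC: "z *\<^sub>C w *\<^sub>C x = (z * w) *\<^sub>C x"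
    and scaleR_scaleC: "r *\<^sub>R x = complex_of_real r *\<^sub>C x"
    and cinner_commute: "cinner x y = cnj (cinner y x)"
    and cinner_add_left: "cinner (x + y) x' = cinner x x' + cinner y x'"
    and cinner_scaleC_left: "cinner (z *\<^sub>C x) y = cnj z * cinner x y"
    and inner_cinner: "inner x y = Re (cinner x y)"

text \<open>Bounded operators are those elements of the (real) operator space \<open>'a \<Rightarrow>\<^sub>L 'b\<close> that are
  complex linear.\<close>

definition clinear_ops :: "('a::chilbert \<Rightarrow>\<^sub>L 'b::chilbert) set" where
  "clinear_ops = {T. \<forall>z x. blinfun_apply T (z *\<^sub>C x) = z *\<^sub>C blinfun_apply T x}"

definition op_scaleC :: "complex \<Rightarrow> ('a::chilbert \<Rightarrow>\<^sub>L 'b::chilbert) \<Rightarrow> ('a \<Rightarrow>\<^sub>L 'b)" where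
  "op_scaleC z T = Blinfun (\<lambda>x. z *\<^sub>C blinfun_apply T x)"

definition adj_op :: "('a::chilbert \<Rightarrow>\<^sub>L 'b::chilbert) \<Rightarrow> ('b \<Rightarrow>\<^sub>L 'a)" where
  "adj_op T = (THE S. \<forall>x y. cinner (blinfun_apply T x) y = cinner x (blinfun_apply S y))"

definition unitary_op :: "('a::chilbert \<Rightarrow>\<^sub>L 'b::chilbert) \<Rightarrow> bool" where
  "unitary_op T \<longleftrightarrow> T \<in> clinear_ops \<and> surj (blinfun_apply T) \<and>
     (\<forall>x y. cinner (blinfun_apply T x) (blinfun_apply T y) = cinner x y)"

definition commutant :: "('a::chilbert \<Rightarrow>\<^sub>L 'a) set \<Rightarrow> ('a \<Rightarrow>\<^sub>L 'a) set" where
  "commutant M = {T \<in> clinear_ops. \<forall>S\<in>M. T o\<^sub>L S = S o\<^sub>L T}"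

definition von_neumann_algebra :: "('a::chilbert \<Rightarrow>\<^sub>L 'a) set \<Rightarrow> bool" where
  "von_neumann_algebra M \<longleftrightarrow>
     M \<subseteq> clinear_ops \<and> (\<forall>T\<in>M. adj_op T \<in> M) \<and> commutant (commutant M) = M"

definition square_summable :: "(nat \<Rightarrow> 'a::chilbert) \<Rightarrow> bool" where
  "square_summable x \<longleftrightarrow> summable (\<lambda>n. (norm (x n))\<^sup>2)"

definition ultraweak_topology :: "('a::chilbert \<Rightarrow>\<^sub>L 'b::chilbert) topology" where
  "ultraweak_topology = topology_generated_by
     {{T. (\<Sum>n. cinner (x n) (blinfun_apply T (y n))) \<in> V} | x y V.
        square_summable x \<and> square_summable y \<and> open V}"

text \<open>Normality means ultraweak continuity.\<close>

definition normal_representation ::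
  "('a::chilbert \<Rightarrow>\<^sub>L 'a) set \<Rightarrow> (('a \<Rightarrow>\<^sub>L 'a) \<Rightarrow> ('b::chilbert \<Rightarrow>\<^sub>L 'b)) \<Rightarrow> bool" where
  "normal_representation M \<rho> \<longleftrightarrow>
     \<rho> ` M \<subseteq> clinear_ops \<and> \<rho> id_blinfun = id_blinfun \<and>
     (\<forall>S\<in>M. \<forall>T\<in>M. \<rho> (S + T) = \<rho> S + \<rho> T \<and> \<rho> (S o\<^sub>L T) = \<rho> S o\<^sub>L \<rho> T) \<and>
     (\<forall>z. \<forall>T\<in>M. \<rho> (op_scaleC z T) = op_scaleC z (\<rho> T)) \<and>
     (\<forall>T\<in>M. \<rho> (adj_op T) = adj_op (\<rho> T)) \<and>
     continuous_map (subtopology ultraweak_topology M) ultraweak_topology \<rho>"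

section \<open>Smooth maps and topologies given by uniform estimates\<close>

fun Ck_on :: "nat \<Rightarrow> ('a::euclidean_space \<Rightarrow> 'b::real_normed_vector) \<Rightarrow> 'a set \<Rightarrow> bool" where
  "Ck_on 0 f S = continuous_on S f"
| "Ck_on (Suc k) f S =
     (f differentiable_on S \<and> (\<forall>v\<in>Basis. Ck_on k (\<lambda>x. frechet_derivative f (at x) v) S))"

text \<open>To be used for open sets only.\<close>

definition smooth_on :: "'a::euclidean_space set \<Rightarrow> ('a \<Rightarrow> 'b::real_normed_vector) \<Rightarrow> bool" where
  "smooth_on S f \<longleftrightarrow> (\<forall>k. Ck_on k f S)"

definition nderiv :: "nat \<Rightarrow> (real \<Rightarrow> 'a::real_normed_vector) \<Rightarrow> real \<Rightarrow> 'a" where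
  "nderiv k f = ((\<lambda>g t. vector_derivative g (at t)) ^^ k) f"

text \<open>The topology on \<open>C\<close> in which the sets \<open>{y. near k \<epsilon> x y}\<close> form a neighbourhood base at \<open>x\<close>.
  In the applications, \<open>near k \<epsilon>\<close> bounds derivatives up to order \<open>k\<close> by \<open>\<epsilon>\<close>.\<close>

definition near_topology :: "'a set \<Rightarrow> (nat \<Rightarrow> real \<Rightarrow> 'a \<Rightarrow> 'a \<Rightarrow> bool) \<Rightarrow> 'a topology" where
  "near_topology C near = topology (\<lambda>S. S \<subseteq> C \<and>
     (\<forall>x\<in>S. \<exists>k. \<exists>\<epsilon>>0. \<forall>y\<in>C. near k \<epsilon> x y \<longrightarrow> y \<in> S))"

lemma openin_near_topology:
  assumes mono: "\<And>k k' \<epsilon> \<epsilon>' x y. near k' \<epsilon>' x y \<Longrightarrow> k \<le> k' \<Longrightarrow> \<epsilon>' \<le> \<epsilon> \<Longrightarrow> near k \<epsilon> x y"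
  shows "openin (near_topology C near) S \<longleftrightarrow>
    S \<subseteq> C \<and> (\<forall>x\<in>S. \<exists>k. \<exists>\<epsilon>>0. \<forall>y\<in>C. near k \<epsilon> x y \<longrightarrow> y \<in> S)"
proof -
  let ?P = "\<lambda>S. S \<subseteq> C \<and> (\<forall>x\<in>S. \<exists>k. \<exists>\<epsilon>>0. \<forall>y\<in>C. near k \<epsilon> x y \<longrightarrow> y \<in> S)"
  have int: "?P (S \<inter> T)" if S: "?P S" and T: "?P T" for S T
  proof -
    have "\<exists>k. \<exists>\<epsilon>>0. \<forall>y\<in>C. near k \<epsilon> x y \<longrightarrow> y \<in> S \<inter> T" if x: "x \<in> S \<inter> T" for x
    proof -
      from S x obtain k \<epsilon> where 1: "\<epsilon> > 0" "\<forall>y\<in>C. near k \<epsilon> x y \<longrightarrow> y \<in> S" by auto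
      from T x obtain l \<delta> where 2: "\<delta> > 0" "\<forall>y\<in>C. near l \<delta> x y \<longrightarrow> y \<in> T" by auto
      have "y \<in> S \<inter> T" if "y \<in> C" "near (max k l) (min \<epsilon> \<delta>) x y" for y
        using that(1) 1(2) 2(2) mono[OF that(2), of k \<epsilon>] mono[OF that(2), of l \<delta>] by auto
      moreover have "min \<epsilon> \<delta> > 0" using 1(1) 2(1) by simp
      ultimately show ?thesis by blast
    qed
    then show ?thesis using S by blast
  qed
  have un: "?P (\<Union>\<K>)" if K: "\<forall>S\<in>\<K>. ?P S" for \<K>
  proof -
    have "\<exists>k. \<exists>\<epsilon>>0. \<forall>y\<in>C. near k \<epsilon> x y \<longrightarrow> y \<in> \<Union>\<K>" if "x \<in> \<Union>\<K>" for x
    proof -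
      from that obtain S where "S \<in> \<K>" "x \<in> S" by blast
      then show ?thesis using K by (meson UnionI)
    qed
    then show ?thesis using K by blast
  qed
  have "istopology ?P" unfolding istopology_def using int un by blast
  then show ?thesis unfolding near_topology_def by (simp add: topology_inverse')
qed

section \<open>The circle and its diffeomorphisms\<close>

text \<open>\<open>S\<^sup>1 = \<real>/2\<pi>\<int>\<close> is identified with the unit circle by \<open>cis\<close>. Functions on the circle are
  treated as functions on the real line with the appropriate periodicity, while intervals and
  supports are subsets of the unit circle.\<close>

abbreviation circle :: "complex set" where "circle \<equiv> sphere 0 1"

definition circle_intervals :: "complex set set" where
  "circle_intervals = {I. I \<noteq> {} \<and> openin (top_of_set circle) I \<and> connected I \<and>
     \<not> circle \<subseteq> closure I}"

definition complement_interval :: "complex set \<Rightarrow> complex set" where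
  "complement_interval I = circle - closure I"

definition circle_arc :: "real \<Rightarrow> real \<Rightarrow> complex set" where
  "circle_arc x y = cis ` {x<..<y}"

record 'a top_group = "'a monoid" + topo :: "'a topology"

record 'a supp_group = "'a top_group" + supp :: "'a \<Rightarrow> complex set"

definition nhd_of_one :: "('a, 'm) top_group_scheme \<Rightarrow> 'a set \<Rightarrow> bool" where
  "nhd_of_one \<Gamma> V \<longleftrightarrow> V \<subseteq> carrier \<Gamma> \<and> (\<exists>S. openin (topo \<Gamma>) S \<and> \<one>\<^bsub>\<Gamma>\<^esub> \<in> S \<and> S \<subseteq> V)"

definition localized :: "('a, 'm) supp_group_scheme \<Rightarrow> complex set \<Rightarrow> 'a set" where
  "localized \<Gamma> I = {\<gamma> \<in> carrier \<Gamma>. supp \<Gamma> \<gamma> \<subseteq> I}"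

text \<open>The universal cover of the group of orientation-preserving diffeomorphisms. The support
  records where the lift itself differs from the identity (so that it is everything for a nontrivial
  translation by a multiple of \<open>2\<pi>\<close>). For open \<open>I\<close>, the support of \<open>\<gamma>\<close> is contained in \<open>I\<close> iff
  \<open>\<gamma>\<close> fixes pointwise the preimage of a neighbourhood of the complement of \<open>I\<close>.\<close>

definition Diff_cover :: "(real \<Rightarrow> real) supp_group" where
  "Diff_cover =
     (let C = {\<gamma>. smooth_on UNIV \<gamma> \<and> (\<forall>t. \<gamma> (t + 2 * pi) = \<gamma> t + 2 * pi) \<and> (\<forall>t. deriv \<gamma> t > 0)}
      in \<lparr>carrier = C, mult = (\<circ>), one = id,
          topo = near_topology C
            (\<lambda>k \<epsilon> \<gamma> \<eta>. \<forall>j\<le>k. \<forall>t. \<bar>nderiv j \<eta> t - nderiv j \<gamma> t\<bar> < \<epsilon>),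
          supp = (\<lambda>\<gamma>. closure (cis ` {t. \<gamma> t \<noteq> t}))\<rparr>)"

text \<open>An element of \<open>Diff\<^sub>+(S\<^sup>1)\<close> is the class of its lifts.\<close>

definition diffeo_class :: "(real \<Rightarrow> real) \<Rightarrow> (real \<Rightarrow> real) set" where
  "diffeo_class \<gamma> = {\<lambda>t. \<gamma> t + 2 * pi * of_int n | n :: int. True}"

definition circle_supp :: "(real \<Rightarrow> real) \<Rightarrow> complex set" where
  "circle_supp \<gamma> = closure (cis ` {t. cis (\<gamma> t) \<noteq> cis t})"

definition circle_image :: "(real \<Rightarrow> real) \<Rightarrow> complex set \<Rightarrow> complex set" where
  "circle_image \<gamma> I = {cis (\<gamma> t) | t. cis t \<in> I}"

definition Moebius_lifts :: "(real \<Rightarrow> real) set" where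
  "Moebius_lifts = {\<gamma> \<in> carrier Diff_cover. \<exists>a b :: complex. (cmod a)\<^sup>2 - (cmod b)\<^sup>2 = 1 \<and>
     (\<forall>t. cis (\<gamma> t) = (a * cis t + b) / (cnj b * cis t + cnj a))}"

section \<open>Conformal nets and DHR representations\<close>

text \<open>A projective representation is given by a choice of unitary representatives. Continuity into
  the projective unitary group, with the quotient of the strong topology: the open subsets of the
  quotient are the images of strongly open sets.\<close>

definition projective_rep_Diff :: "((real \<Rightarrow> real) set \<Rightarrow> ('h::chilbert \<Rightarrow>\<^sub>L 'h)) \<Rightarrow> bool" where
  "projective_rep_Diff U \<longleftrightarrow>
     (\<forall>\<gamma>\<in>carrier Diff_cover. unitary_op (U (diffeo_class \<gamma>))) \<and>
     (\<forall>\<gamma>\<in>carrier Diff_cover. \<forall>\<eta>\<in>carrier Diff_cover. \<exists>z. cmod z = 1 \<and>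
        U (diffeo_class (\<gamma> \<circ> \<eta>)) = op_scaleC z (U (diffeo_class \<gamma>) o\<^sub>L U (diffeo_class \<eta>))) \<and>
     (\<forall>S. openin strong_operator_topology S \<longrightarrow>
        openin (topo Diff_cover)
          {\<gamma> \<in> carrier Diff_cover. \<exists>z. cmod z = 1 \<and> op_scaleC z (U (diffeo_class \<gamma>)) \<in> S})"

definition true_rep_Moebius :: "((real \<Rightarrow> real) set \<Rightarrow> ('h::chilbert \<Rightarrow>\<^sub>L 'h)) \<Rightarrow> bool" where
  "true_rep_Moebius U \<longleftrightarrow>
     (\<forall>\<gamma>\<in>Moebius_lifts. \<forall>\<eta>\<in>Moebius_lifts.
        U (diffeo_class (\<gamma> \<circ> \<eta>)) = U (diffeo_class \<gamma>) o\<^sub>L U (diffeo_class \<eta>)) \<and>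
     continuous_map (subtopology (topo Diff_cover) Moebius_lifts) strong_operator_topology
       (\<lambda>\<gamma>. U (diffeo_class \<gamma>))"

text \<open>The generator \<open>L\<close> of \<open>t \<mapsto> V t = exp (i t L)\<close> has as domain the vectors \<open>x\<close> for which
  \<open>t \<mapsto> V t x\<close> is differentiable at \<open>0\<close>, and then \<open>L x = -i (d/dt) (V t x)\<close>.\<close>

definition positive_generator :: "(real \<Rightarrow> ('h::chilbert \<Rightarrow>\<^sub>L 'h)) \<Rightarrow> bool" where
  "positive_generator V \<longleftrightarrow>
     (\<forall>x y. ((\<lambda>t. blinfun_apply (V t) x) has_vector_derivative y) (at 0) \<longrightarrow>
        cinner x (- \<i> *\<^sub>C y) \<in> \<real> \<and> Re (cinner x (- \<i> *\<^sub>C y)) \<ge> 0)"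

definition Moebius_invariant :: "((real \<Rightarrow> real) set \<Rightarrow> ('h::chilbert \<Rightarrow>\<^sub>L 'h)) \<Rightarrow> 'h \<Rightarrow> bool" where
  "Moebius_invariant U x \<longleftrightarrow> (\<forall>\<gamma>\<in>Moebius_lifts. blinfun_apply (U (diffeo_class \<gamma>)) x = x)"

definition conformal_net ::
  "(complex set \<Rightarrow> ('h::{chilbert,second_countable_topology} \<Rightarrow>\<^sub>L 'h) set) \<Rightarrow>
   ((real \<Rightarrow> real) set \<Rightarrow> ('h \<Rightarrow>\<^sub>L 'h)) \<Rightarrow> 'h \<Rightarrow> bool" where
  "conformal_net \<A> U \<Omega> \<longleftrightarrow>
     (\<forall>I\<in>circle_intervals. von_neumann_algebra (\<A> I)) \<and>
     projective_rep_Diff U \<and> true_rep_Moebius U \<and>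
     (\<forall>I\<in>circle_intervals. \<forall>J\<in>circle_intervals. I \<subseteq> J \<longrightarrow> \<A> I \<subseteq> \<A> J) \<and>
     (\<forall>I\<in>circle_intervals. \<forall>J\<in>circle_intervals. I \<inter> J = {} \<longrightarrow> \<A> I \<subseteq> commutant (\<A> J)) \<and>
     (\<forall>\<gamma>\<in>carrier Diff_cover. \<forall>I\<in>circle_intervals.
        (\<lambda>T. U (diffeo_class \<gamma>) o\<^sub>L T o\<^sub>L adj_op (U (diffeo_class \<gamma>))) ` \<A> I
          = \<A> (circle_image \<gamma> I)) \<and>
     (\<forall>\<gamma>\<in>carrier Diff_cover. \<forall>I\<in>circle_intervals.
        circle_supp \<gamma> \<subseteq> complement_interval I \<longrightarrow>
        (\<forall>T\<in>\<A> I. U (diffeo_class \<gamma>) o\<^sub>L T o\<^sub>L adj_op (U (diffeo_class \<gamma>)) = T)) \<and>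
     positive_generator (\<lambda>\<theta>. U (diffeo_class (\<lambda>t. t + \<theta>))) \<and>
     norm \<Omega> = 1 \<and> Moebius_invariant U \<Omega> \<and>
     (\<forall>x. norm x = 1 \<and> Moebius_invariant U x \<longrightarrow> (\<exists>z. cmod z = 1 \<and> x = z *\<^sub>C \<Omega>)) \<and>
     closure ((\<lambda>T. blinfun_apply T \<Omega>) `
       commutant (commutant (\<Union>I\<in>circle_intervals. \<A> I))) = UNIV"

definition DHR_representation ::
  "(complex set \<Rightarrow> ('h::chilbert \<Rightarrow>\<^sub>L 'h) set) \<Rightarrow>
   (complex set \<Rightarrow> ('h \<Rightarrow>\<^sub>L 'h) \<Rightarrow> ('k::{chilbert,second_countable_topology} \<Rightarrow>\<^sub>L 'k)) \<Rightarrow> bool" where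
  "DHR_representation \<A> \<rho> \<longleftrightarrow>
     (\<exists>x :: 'k. x \<noteq> 0) \<and>
     (\<forall>I\<in>circle_intervals. normal_representation (\<A> I) (\<rho> I)) \<and>
     (\<forall>I\<in>circle_intervals. \<forall>J\<in>circle_intervals. I \<subseteq> J \<longrightarrow> (\<forall>T\<in>\<A> I. \<rho> J T = \<rho> I T))"

section \<open>Compact simple Lie groups\<close>

text \<open>The charts form an atlas, not necessarily maximal.\<close>

record ('a, 'e) lie_grp = "'a top_group" + charts :: "('a set \<times> ('a \<Rightarrow> 'e)) set"

definition smooth_into ::
  "('a, 'e::euclidean_space, 'm) lie_grp_scheme \<Rightarrow> 'p::euclidean_space set \<Rightarrow> ('p \<Rightarrow> 'a) \<Rightarrow> bool" where
  "smooth_into G S f \<longleftrightarrow> f ` S \<subseteq> carrier G \<and>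
     (\<forall>(D, \<phi>)\<in>charts G. open {x\<in>S. f x \<in> D} \<and> smooth_on {x\<in>S. f x \<in> D} (\<phi> \<circ> f))"

definition lie_group :: "('a, 'e::euclidean_space, 'm) lie_grp_scheme \<Rightarrow> bool" where
  "lie_group G \<longleftrightarrow> group G \<and>
     topspace (topo G) = carrier G \<and> Hausdorff_space (topo G) \<and> second_countable (topo G) \<and>
     (\<Union>(D, \<phi>)\<in>charts G. D) = carrier G \<and>
     (\<forall>(D, \<phi>)\<in>charts G. openin (topo G) D \<and> open (\<phi> ` D) \<and>
        homeomorphic_map (subtopology (topo G) D) (top_of_set (\<phi> ` D)) \<phi> \<and>
        smooth_into G (\<phi> ` D) (inv_into D \<phi>) \<and>
        smooth_into G (\<phi> ` D) (\<lambda>x. inv\<^bsub>G\<^esub> (inv_into D \<phi> x))) \<and>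
     (\<forall>(D, \<phi>)\<in>charts G. \<forall>(E, \<psi>)\<in>charts G.
        smooth_into G (\<phi> ` D \<times> \<psi> ` E) (\<lambda>(x, y). inv_into D \<phi> x \<otimes>\<^bsub>G\<^esub> inv_into E \<psi> y))"

text \<open>The Lie algebra, i.e. the tangent space at the unit element, is identified with the model
  space \<open>'e\<close> by means of the differential of one fixed chart at the unit element.\<close>

definition chart_at_one :: "('a, 'e::euclidean_space, 'm) lie_grp_scheme \<Rightarrow> 'a set \<times> ('a \<Rightarrow> 'e)" where
  "chart_at_one G = (SOME c. c \<in> charts G \<and> \<one>\<^bsub>G\<^esub> \<in> fst c)"

definition log1 :: "('a, 'e::euclidean_space, 'm) lie_grp_scheme \<Rightarrow> 'a \<Rightarrow> 'e" where
  "log1 G g = snd (chart_at_one G) g - snd (chart_at_one G) \<one>\<^bsub>G\<^esub>"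

definition exp1 :: "('a, 'e::euclidean_space, 'm) lie_grp_scheme \<Rightarrow> 'e \<Rightarrow> 'a" where
  "exp1 G x = inv_into (fst (chart_at_one G)) (snd (chart_at_one G))
     (snd (chart_at_one G) \<one>\<^bsub>G\<^esub> + x)"

text \<open>\<open>log1\<close> and \<open>exp1\<close> are the centred chart and its inverse. They agree with logarithm and
  exponential map of the group to first order only, which is all that is used in \<open>Ad\<close> and
  \<open>lie_bracket\<close> (namely \<open>[x, y] = (d/ds) Ad (g s) y\<close> for a curve \<open>g\<close> with velocity \<open>x\<close>).\<close>

definition Ad :: "('a, 'e::euclidean_space, 'm) lie_grp_scheme \<Rightarrow> 'a \<Rightarrow> 'e \<Rightarrow> 'e" where
  "Ad G g y = vector_derivative (\<lambda>t. log1 G (g \<otimes>\<^bsub>G\<^esub> exp1 G (t *\<^sub>R y) \<otimes>\<^bsub>G\<^esub> inv\<^bsub>G\<^esub> g)) (at 0)"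

definition lie_bracket :: "('a, 'e::euclidean_space, 'm) lie_grp_scheme \<Rightarrow> 'e \<Rightarrow> 'e \<Rightarrow> 'e" where
  "lie_bracket G x y = vector_derivative (\<lambda>s. Ad G (exp1 G (s *\<^sub>R x)) y) (at 0)"

text \<open>The left logarithmic derivative \<open>g(t)\<^sup>-\<^sup>1 g'(t)\<close> of a curve.\<close>

definition left_log_deriv ::
  "('a, 'e::euclidean_space, 'm) lie_grp_scheme \<Rightarrow> (real \<Rightarrow> 'a) \<Rightarrow> real \<Rightarrow> 'e" where
  "left_log_deriv G g t = vector_derivative (\<lambda>h. log1 G (inv\<^bsub>G\<^esub> (g t) \<otimes>\<^bsub>G\<^esub> g (t + h))) (at 0)"

definition simple_lie_algebra :: "('a, 'e::euclidean_space, 'm) lie_grp_scheme \<Rightarrow> bool" where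
  "simple_lie_algebra G \<longleftrightarrow> (\<exists>x y. lie_bracket G x y \<noteq> 0) \<and>
     (\<forall>J. subspace J \<and> (\<forall>x. \<forall>y\<in>J. lie_bracket G x y \<in> J) \<longrightarrow> J = {0} \<or> J = UNIV)"

definition simply_connected_top :: "'a topology \<Rightarrow> bool" where
  "simply_connected_top X \<longleftrightarrow> path_connected_space X \<and>
     (\<forall>f. continuous_map (top_of_set circle) X f \<longrightarrow>
        (\<exists>c\<in>topspace X. homotopic_with (\<lambda>_. True) (top_of_set circle) X f (\<lambda>_. c)))"

definition compact_simple_sc_group :: "('a, 'e::euclidean_space, 'm) lie_grp_scheme \<Rightarrow> bool" where
  "compact_simple_sc_group G \<longleftrightarrow> lie_group G \<and> compact_space (topo G) \<and> connected_space (topo G) \<and>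
     simple_lie_algebra G \<and> simply_connected_top (topo G)"

definition maximal_abelian :: "('a, 'e::euclidean_space, 'm) lie_grp_scheme \<Rightarrow> 'e set \<Rightarrow> bool" where
  "maximal_abelian G \<tt> \<longleftrightarrow>
     subspace \<tt> \<and> (\<forall>x\<in>\<tt>. \<forall>y\<in>\<tt>. lie_bracket G x y = 0) \<and>
     (\<forall>x. (\<forall>y\<in>\<tt>. lie_bracket G x y = 0) \<longrightarrow> x \<in> \<tt>)"

text \<open>A root \<open>\<alpha>\<close> (real-valued on \<open>\<tt>\<close>) is represented by the vector \<open>a \<in> \<tt>\<close> with
  \<open>\<alpha> h = B a h\<close>; a root vector is \<open>x + iy\<close> in the complexification, with
  \<open>[h, x + iy] = i (\<alpha> h) (x + iy)\<close>. The coroot of \<open>\<alpha>\<close> is \<open>2a / B a a\<close>.\<close>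

definition is_root ::
  "('a, 'e::euclidean_space, 'm) lie_grp_scheme \<Rightarrow> ('e \<Rightarrow> 'e \<Rightarrow> real) \<Rightarrow> 'e set \<Rightarrow> 'e \<Rightarrow> bool" where
  "is_root G B \<tt> a \<longleftrightarrow> a \<in> \<tt> \<and> a \<noteq> 0 \<and>
     (\<exists>x y. (x, y) \<noteq> (0, 0) \<and> (\<forall>h\<in>\<tt>. lie_bracket G h x = - (B a h *\<^sub>R y) \<and>
        lie_bracket G h y = B a h *\<^sub>R x))"

definition is_long_root ::
  "('a, 'e::euclidean_space, 'm) lie_grp_scheme \<Rightarrow> ('e \<Rightarrow> 'e \<Rightarrow> real) \<Rightarrow> 'e set \<Rightarrow> 'e \<Rightarrow> bool" where
  "is_long_root G B \<tt> a \<longleftrightarrow> is_root G B \<tt> a \<and> (\<forall>a'. is_root G B \<tt> a' \<longrightarrow> B a' a' \<le> B a a)"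

definition coroot :: "('e::euclidean_space \<Rightarrow> 'e \<Rightarrow> real) \<Rightarrow> 'e \<Rightarrow> 'e" where
  "coroot B a = (2 / B a a) *\<^sub>R a"

text \<open>Positive definiteness is forced by the normalization; it is listed to make the
  identification of roots with vectors legitimate.\<close>

definition basic_form ::
  "('a, 'e::euclidean_space, 'm) lie_grp_scheme \<Rightarrow> ('e \<Rightarrow> 'e \<Rightarrow> real) \<Rightarrow> bool" where
  "basic_form G B \<longleftrightarrow> bilinear B \<and> (\<forall>x y. B x y = B y x) \<and> (\<forall>x. x \<noteq> 0 \<longrightarrow> B x x > 0) \<and>
     (\<forall>g\<in>carrier G. \<forall>x y. B (Ad G g x) (Ad G g y) = B x y) \<and>
     (\<forall>\<tt> a. maximal_abelian G \<tt> \<and> is_long_root G B \<tt> a \<longrightarrow> B (coroot B a) (coroot B a) = 2)"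

section \<open>The loop group and its basic central extension\<close>

text \<open>Loops are close to \<open>\<gamma>\<close> if, after left translation by \<open>\<gamma>\<^sup>-\<^sup>1\<close>, they are close to the
  constant loop \<open>e\<close> in a chart at \<open>e\<close>, together with all derivatives.\<close>

definition loop_near ::
  "('a, 'e::euclidean_space, 'm) lie_grp_scheme \<Rightarrow> nat \<Rightarrow> real \<Rightarrow> (real \<Rightarrow> 'a) \<Rightarrow> (real \<Rightarrow> 'a) \<Rightarrow> bool"
  where
  "loop_near G k \<epsilon> \<gamma> \<eta> \<longleftrightarrow>
     (\<forall>t. inv\<^bsub>G\<^esub> (\<gamma> t) \<otimes>\<^bsub>G\<^esub> \<eta> t \<in> fst (chart_at_one G)) \<and>
     (\<forall>j\<le>k. \<forall>t. norm (nderiv j (\<lambda>t. log1 G (inv\<^bsub>G\<^esub> (\<gamma> t) \<otimes>\<^bsub>G\<^esub> \<eta> t)) t) < \<epsilon>)"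

definition loop_group ::
  "('a, 'e::euclidean_space, 'm) lie_grp_scheme \<Rightarrow> (real \<Rightarrow> 'a) supp_group" where
  "loop_group G =
     (let C = {\<gamma>. smooth_into G UNIV \<gamma> \<and> (\<forall>t. \<gamma> (t + 2 * pi) = \<gamma> t)}
      in \<lparr>carrier = C, mult = (\<lambda>\<gamma> \<eta> t. \<gamma> t \<otimes>\<^bsub>G\<^esub> \<eta> t), one = (\<lambda>t. \<one>\<^bsub>G\<^esub>),
          topo = near_topology C (loop_near G),
          supp = (\<lambda>\<gamma>. closure (cis ` {t. \<gamma> t \<noteq> \<one>\<^bsub>G\<^esub>}))\<rparr>)"

definition omega ::
  "('e::euclidean_space \<Rightarrow> 'e \<Rightarrow> real) \<Rightarrow> (real \<Rightarrow> 'e) \<Rightarrow> (real \<Rightarrow> 'e) \<Rightarrow> real" where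
  "omega B \<xi> \<eta> = 1 / (2 * pi) * integral {0..2 * pi} (\<lambda>t. B (\<xi> t) (vector_derivative \<eta> (at t)))"

definition subdivision :: "nat \<Rightarrow> (nat \<Rightarrow> real) \<Rightarrow> bool" where
  "subdivision n \<tau> \<longleftrightarrow> \<tau> 0 = 0 \<and> \<tau> n = 1 \<and> (\<forall>i<n. \<tau> i < \<tau> (Suc i))"

text \<open>Paths \<open>s \<mapsto> p s\<close> and surfaces \<open>(r, s) \<mapsto> \<sigma> r s\<close> in the loop group, with parameters in \<open>[0, 1]\<close>.
  Smoothness on a closed cell means existence of a smooth extension to a neighbourhood, and smoothness
  as a loop-group valued map is joint smoothness with the loop parameter \<open>t\<close>.\<close>

definition pw_smooth_path ::
  "('a, 'e::euclidean_space, 'm) lie_grp_scheme \<Rightarrow> (real \<Rightarrow> real \<Rightarrow> 'a) \<Rightarrow> bool" where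
  "pw_smooth_path G p \<longleftrightarrow> (\<forall>s\<in>{0..1}. p s \<in> carrier (loop_group G)) \<and>
     (\<exists>n \<tau>. subdivision n \<tau> \<and> (\<forall>i<n. \<exists>f. \<exists>\<delta>>0.
        smooth_into G ({\<tau> i - \<delta><..<\<tau> (Suc i) + \<delta>} \<times> UNIV) f \<and>
        (\<forall>s\<in>{\<tau> i..\<tau> (Suc i)}. \<forall>t. f (s, t) = p s t)))"

definition pw_smooth_surface ::
  "('a, 'e::euclidean_space, 'm) lie_grp_scheme \<Rightarrow> (real \<Rightarrow> real \<Rightarrow> real \<Rightarrow> 'a) \<Rightarrow> bool" where
  "pw_smooth_surface G \<sigma> \<longleftrightarrow> (\<forall>r\<in>{0..1}. \<forall>s\<in>{0..1}. \<sigma> r s \<in> carrier (loop_group G)) \<and>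
     (\<exists>m \<upsilon> n \<tau>. subdivision m \<upsilon> \<and> subdivision n \<tau> \<and> (\<forall>i<m. \<forall>j<n. \<exists>f. \<exists>\<delta>>0.
        smooth_into G ({\<upsilon> i - \<delta><..<\<upsilon> (Suc i) + \<delta>} \<times> {\<tau> j - \<delta><..<\<tau> (Suc j) + \<delta>} \<times> UNIV) f \<and>
        (\<forall>r\<in>{\<upsilon> i..\<upsilon> (Suc i)}. \<forall>s\<in>{\<tau> j..\<tau> (Suc j)}. \<forall>t. f (r, s, t) = \<sigma> r s t)))"

text \<open>A disc in polar coordinates: \<open>r\<close> is the radius and \<open>2\<pi>s\<close> the angle.\<close>

definition bounds ::
  "('a, 'e::euclidean_space, 'm) lie_grp_scheme \<Rightarrow> (real \<Rightarrow> real \<Rightarrow> 'a) \<Rightarrow>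
   (real \<Rightarrow> real \<Rightarrow> real \<Rightarrow> 'a) \<Rightarrow> bool" where
  "bounds G l \<sigma> \<longleftrightarrow> pw_smooth_surface G \<sigma> \<and>
     (\<forall>s\<in>{0..1}. \<sigma> 1 s = l s \<and> \<sigma> 0 s = \<sigma> 0 0) \<and> (\<forall>r\<in>{0..1}. \<sigma> r 0 = \<sigma> r 1)"

text \<open>The integral over the surface of the left-invariant 2-form determined by \<open>omega B\<close>.\<close>

definition surface_integral ::
  "('a, 'e::euclidean_space, 'm) lie_grp_scheme \<Rightarrow> ('e \<Rightarrow> 'e \<Rightarrow> real) \<Rightarrow>
   (real \<Rightarrow> real \<Rightarrow> real \<Rightarrow> 'a) \<Rightarrow> real" where
  "surface_integral G B \<sigma> = integral (cbox (0, 0) (1, 1)) (\<lambda>(r, s).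
     omega B (\<lambda>t. left_log_deriv G (\<lambda>r'. \<sigma> r' s t) r) (\<lambda>t. left_log_deriv G (\<lambda>s'. \<sigma> r s' t) s))"

definition holonomy ::
  "('a, 'e::euclidean_space, 'm) lie_grp_scheme \<Rightarrow> ('e \<Rightarrow> 'e \<Rightarrow> real) \<Rightarrow>
   (real \<Rightarrow> real \<Rightarrow> 'a) \<Rightarrow> complex" where
  "holonomy G B l = (THE z. \<exists>\<sigma>. bounds G l \<sigma> \<and> z = cis (surface_integral G B \<sigma>))"

definition concat_path :: "(real \<Rightarrow> 'x) \<Rightarrow> (real \<Rightarrow> 'x) \<Rightarrow> real \<Rightarrow> 'x" where
  "concat_path p q s = (if s \<le> 1/2 then p (2 * s) else q (2 * s - 1))"

type_synonym 'a path_triple = "(real \<Rightarrow> 'a) \<times> (real \<Rightarrow> real \<Rightarrow> 'a) \<times> complex"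

definition path_triples :: "('a, 'e::euclidean_space, 'm) lie_grp_scheme \<Rightarrow> 'a path_triple set" where
  "path_triples G = {(\<gamma>, p, u). \<gamma> \<in> carrier (loop_group G) \<and> pw_smooth_path G p \<and>
     p 0 = (\<lambda>t. \<one>\<^bsub>G\<^esub>) \<and> p 1 = \<gamma> \<and> cmod u = 1}"

definition triple_rel ::
  "('a, 'e::euclidean_space, 'm) lie_grp_scheme \<Rightarrow> ('e \<Rightarrow> 'e \<Rightarrow> real) \<Rightarrow>
   ('a path_triple \<times> 'a path_triple) set" where
  "triple_rel G B = {((\<gamma>, p, u), (\<gamma>', p', u')).
     (\<gamma>, p, u) \<in> path_triples G \<and> (\<gamma>', p', u') \<in> path_triples G \<and> \<gamma> = \<gamma>' \<and>
     u = holonomy G B (concat_path p' (\<lambda>s. p (1 - s))) * u'}"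

definition triple_class ::
  "('a, 'e::euclidean_space, 'm) lie_grp_scheme \<Rightarrow> ('e \<Rightarrow> 'e \<Rightarrow> real) \<Rightarrow>
   'a path_triple \<Rightarrow> 'a path_triple set" where
  "triple_class G B x = triple_rel G B `` {x}"

definition triple_mult ::
  "('a, 'e::euclidean_space, 'm) lie_grp_scheme \<Rightarrow> 'a path_triple \<Rightarrow> 'a path_triple \<Rightarrow> 'a path_triple"
  where
  "triple_mult G = (\<lambda>(\<gamma>\<^sub>1, p\<^sub>1, u\<^sub>1) (\<gamma>\<^sub>2, p\<^sub>2, u\<^sub>2).
     (\<gamma>\<^sub>1 \<otimes>\<^bsub>loop_group G\<^esub> \<gamma>\<^sub>2,
      concat_path p\<^sub>1 (\<lambda>s. \<gamma>\<^sub>1 \<otimes>\<^bsub>loop_group G\<^esub> p\<^sub>2 s),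
      u\<^sub>1 * u\<^sub>2))"

definition class_mult ::
  "('a, 'e::euclidean_space, 'm) lie_grp_scheme \<Rightarrow> ('e \<Rightarrow> 'e \<Rightarrow> real) \<Rightarrow>
   'a path_triple set \<Rightarrow> 'a path_triple set \<Rightarrow> 'a path_triple set" where
  "class_mult G B X Y = (\<Union>x\<in>X. \<Union>y\<in>Y. triple_class G B (triple_mult G x y))"

text \<open>The topology of the central extension is the group topology for which
  \<open>(\<gamma>, u) \<mapsto> [(\<gamma>, straight_path \<gamma>, u)]\<close> is a homeomorphism near the unit element, the path being
  the one which is straight in the chart at \<open>e\<close>.\<close>

definition straight_path ::
  "('a, 'e::euclidean_space, 'm) lie_grp_scheme \<Rightarrow> (real \<Rightarrow> 'a) \<Rightarrow> real \<Rightarrow> real \<Rightarrow> 'a" where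
  "straight_path G \<gamma> s t = exp1 G (s *\<^sub>R log1 G (\<gamma> t))"

definition loop_group_ext ::
  "('a, 'e::euclidean_space, 'm) lie_grp_scheme \<Rightarrow> ('e \<Rightarrow> 'e \<Rightarrow> real) \<Rightarrow>
   'a path_triple set top_group" where
  "loop_group_ext G B =
     (let C = path_triples G // triple_rel G B
      in \<lparr>carrier = C, mult = class_mult G B,
          one = triple_class G B (\<lambda>t. \<one>\<^bsub>G\<^esub>, \<lambda>s t. \<one>\<^bsub>G\<^esub>, 1),
          topo = near_topology C (\<lambda>k \<epsilon> X Y. \<exists>\<gamma>\<in>carrier (loop_group G). \<exists>u.
            loop_near G k \<epsilon> (\<lambda>t. \<one>\<^bsub>G\<^esub>) \<gamma> \<and> cmod u = 1 \<and> cmod (u - 1) < \<epsilon> \<and>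
            Y = class_mult G B X (triple_class G B (\<gamma>, straight_path G \<gamma>, u)))\<rparr>)"

definition loop_proj :: "'a path_triple set \<Rightarrow> (real \<Rightarrow> 'a)" where
  "loop_proj X = the_elem (fst ` X)"

definition loop_centre ::
  "('a, 'e::euclidean_space, 'm) lie_grp_scheme \<Rightarrow> ('e \<Rightarrow> 'e \<Rightarrow> real) \<Rightarrow> 'a path_triple set set" where
  "loop_centre G B = {triple_class G B (\<lambda>t. \<one>\<^bsub>G\<^esub>, \<lambda>s t. \<one>\<^bsub>G\<^esub>, u) | u. cmod u = 1}"

text \<open>The lift to the central extension of the action \<open>\<lambda> \<mapsto> \<lambda> \<circ> \<gamma>\<^sup>-\<^sup>1\<close> of a diffeomorphism.\<close>

definition diffeo_act :: "(real \<Rightarrow> real) \<Rightarrow> 'a path_triple set \<Rightarrow> 'a path_triple set" where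
  "diffeo_act \<gamma> X =
     (\<lambda>(l, p, u). (l \<circ> the_inv \<gamma>, \<lambda>s. p s \<circ> the_inv \<gamma>, u)) ` X"

section \<open>The Virasoro group\<close>

definition Bott_cocycle :: "(real \<Rightarrow> real) \<Rightarrow> (real \<Rightarrow> real) \<Rightarrow> real" where
  "Bott_cocycle \<gamma>\<^sub>1 \<gamma>\<^sub>2 = - 1 / (48 * pi) *
     integral {0..2 * pi} (\<lambda>t. ln (deriv (\<gamma>\<^sub>1 \<circ> \<gamma>\<^sub>2) t) * (deriv (deriv \<gamma>\<^sub>2) t / deriv \<gamma>\<^sub>2 t))"

definition Vir :: "(real \<times> (real \<Rightarrow> real)) top_group" where
  "Vir = \<lparr>carrier = UNIV \<times> carrier Diff_cover,
     mult = (\<lambda>(a\<^sub>1, \<gamma>\<^sub>1) (a\<^sub>2, \<gamma>\<^sub>2). (a\<^sub>1 + a\<^sub>2 + Bott_cocycle \<gamma>\<^sub>1 \<gamma>\<^sub>2, \<gamma>\<^sub>1 \<circ> \<gamma>\<^sub>2)),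
     one = (0, id),
     topo = prod_topology euclideanreal (topo Diff_cover)\<rparr>"

definition Vir_centre :: "(real \<times> (real \<Rightarrow> real)) set" where
  "Vir_centre = UNIV \<times> {id}"

section \<open>Representations of the central extensions and local multiplier representations\<close>

text \<open>Throughout, \<open>E\<close> is a central extension of \<open>\<Gamma>\<close> with projection \<open>\<psi>\<close>, and \<open>Z\<close> is the image in
  \<open>E\<close> of the central subgroup.\<close>

definition localized_vacuum_rep ::
  "(complex set \<Rightarrow> ('h::chilbert \<Rightarrow>\<^sub>L 'h) set) \<Rightarrow> ('x, 'm) supp_group_scheme \<Rightarrow>
   ('y, 'n) top_group_scheme \<Rightarrow> ('y \<Rightarrow> 'x) \<Rightarrow> 'y set \<Rightarrow> ('y \<Rightarrow> ('h \<Rightarrow>\<^sub>L 'h)) \<Rightarrow> bool" where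
  "localized_vacuum_rep \<A> \<Gamma> E \<psi> Z \<pi>t \<longleftrightarrow>
     (\<forall>x\<in>carrier E. unitary_op (\<pi>t x)) \<and>
     (\<forall>x\<in>carrier E. \<forall>y\<in>carrier E. \<pi>t (x \<otimes>\<^bsub>E\<^esub> y) = \<pi>t x o\<^sub>L \<pi>t y) \<and>
     continuous_map (topo E) strong_operator_topology \<pi>t \<and>
     (\<forall>I\<in>circle_intervals. \<forall>x\<in>carrier E. \<psi> x \<in> localized \<Gamma> I \<longrightarrow> \<pi>t x \<in> \<A> I) \<and>
     (\<forall>z\<in>Z. \<exists>u. cmod u = 1 \<and> \<pi>t z = op_scaleC u id_blinfun)"

text \<open>The compatibility with the projective representation of the diffeomorphism group, in the two
  cases.\<close>

definition loop_covariant ::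
  "((real \<Rightarrow> real) set \<Rightarrow> ('h::chilbert \<Rightarrow>\<^sub>L 'h)) \<Rightarrow> ('a path_triple set, 'n) top_group_scheme \<Rightarrow>
   ('a path_triple set \<Rightarrow> ('h \<Rightarrow>\<^sub>L 'h)) \<Rightarrow> bool" where
  "loop_covariant U E \<pi>t \<longleftrightarrow> (\<forall>\<gamma>\<in>carrier Diff_cover. \<forall>X\<in>carrier E.
     U (diffeo_class \<gamma>) o\<^sub>L \<pi>t X o\<^sub>L adj_op (U (diffeo_class \<gamma>)) = \<pi>t (diffeo_act \<gamma> X))"

definition Vir_lift_of ::
  "((real \<Rightarrow> real) set \<Rightarrow> ('h::chilbert \<Rightarrow>\<^sub>L 'h)) \<Rightarrow> (real \<times> (real \<Rightarrow> real) \<Rightarrow> ('h \<Rightarrow>\<^sub>L 'h)) \<Rightarrow> bool"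
  where
  "Vir_lift_of U \<pi>t \<longleftrightarrow> (\<forall>(r, \<gamma>)\<in>carrier Vir. \<exists>z. cmod z = 1 \<and>
     \<pi>t (r, \<gamma>) = op_scaleC z (U (diffeo_class \<gamma>)))"

definition cover_angles :: "(nat \<Rightarrow> real) \<Rightarrow> (nat \<Rightarrow> real) \<Rightarrow> bool" where
  "cover_angles a b \<longleftrightarrow> 0 < a 1 \<and> a 1 < b 3 \<and> b 3 < a 2 \<and> a 2 < b 1 \<and> b 1 < a 3 \<and> a 3 < b 2 \<and>
     b 2 < 2 * pi"

text \<open>The third interval passes through the angle \<open>0\<close>.\<close>

definition cover_arc :: "(nat \<Rightarrow> real) \<Rightarrow> (nat \<Rightarrow> real) \<Rightarrow> nat \<Rightarrow> complex set" where
  "cover_arc a b j = (if j = 3 then circle_arc (a 3) (b 3 + 2 * pi) else circle_arc (a j) (b j))"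

definition fragmentation ::
  "('x, 'm) supp_group_scheme \<Rightarrow> (nat \<Rightarrow> complex set) \<Rightarrow> 'x set \<Rightarrow> (nat \<Rightarrow> 'x \<Rightarrow> 'x) \<Rightarrow> bool" where
  "fragmentation \<Gamma> I N \<Xi> \<longleftrightarrow> nhd_of_one \<Gamma> N \<and>
     (\<forall>j\<in>{1,2,3}. continuous_map (subtopology (topo \<Gamma>) N) (topo \<Gamma>) (\<Xi> j) \<and>
        \<Xi> j \<one>\<^bsub>\<Gamma>\<^esub> = \<one>\<^bsub>\<Gamma>\<^esub> \<and> (\<forall>\<gamma>\<in>N. \<Xi> j \<gamma> \<in> localized \<Gamma> (I j))) \<and>
     (\<forall>\<gamma>\<in>N. \<gamma> = \<Xi> 1 \<gamma> \<otimes>\<^bsub>\<Gamma>\<^esub> \<Xi> 2 \<gamma> \<otimes>\<^bsub>\<Gamma>\<^esub> \<Xi> 3 \<gamma>) \<and>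
     (\<forall>\<gamma>\<in>N. supp \<Gamma> \<gamma> \<subseteq> I 1 \<longrightarrow>
        supp \<Gamma> (\<Xi> 2 \<gamma>) \<subseteq> I 1 \<inter> I 2 \<and> supp \<Gamma> (\<Xi> 3 \<gamma>) \<subseteq> I 1 \<inter> I 3)"

definition diffeo_fragmentation ::
  "(nat \<Rightarrow> real) \<Rightarrow> (nat \<Rightarrow> real) \<Rightarrow> (real \<Rightarrow> real) set \<Rightarrow>
   (nat \<Rightarrow> (real \<Rightarrow> real) \<Rightarrow> (real \<Rightarrow> real)) \<Rightarrow> bool" where
  "diffeo_fragmentation a b N \<Xi> \<longleftrightarrow> fragmentation Diff_cover (cover_arc a b) N \<Xi> \<and>
     (\<forall>\<gamma>\<in>N. supp Diff_cover \<gamma> \<inter> circle_arc (a 2) (b 1) = {} \<longrightarrow>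
        (\<forall>\<theta>\<in>{a 2<..<b 1}. \<Xi> 1 \<gamma> \<theta> = \<theta>))"

definition local_section ::
  "('x, 'm) top_group_scheme \<Rightarrow> ('y, 'n) top_group_scheme \<Rightarrow> ('y \<Rightarrow> 'x) \<Rightarrow> 'x set \<Rightarrow> ('x \<Rightarrow> 'y) \<Rightarrow> bool"
  where
  "local_section \<Gamma> E \<psi> W s \<longleftrightarrow> nhd_of_one \<Gamma> W \<and>
     continuous_map (subtopology (topo \<Gamma>) W) (topo E) s \<and>
     s \<one>\<^bsub>\<Gamma>\<^esub> = \<one>\<^bsub>E\<^esub> \<and> (\<forall>\<gamma>\<in>W. s \<gamma> \<in> carrier E \<and> \<psi> (s \<gamma>) = \<gamma>)"

definition local_cocycle ::
  "('x, 'm) top_group_scheme \<Rightarrow> 'x set \<Rightarrow> ('x \<Rightarrow> ('h::chilbert \<Rightarrow>\<^sub>L 'h)) \<Rightarrow> ('x \<Rightarrow> 'x \<Rightarrow> complex) \<Rightarrow> bool"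
  where
  "local_cocycle \<Gamma> W \<pi> c \<longleftrightarrow> (\<forall>\<gamma>\<in>W. \<forall>\<eta>\<in>W. \<gamma> \<otimes>\<^bsub>\<Gamma>\<^esub> \<eta> \<in> W \<longrightarrow>
     cmod (c \<gamma> \<eta>) = 1 \<and> \<pi> \<gamma> o\<^sub>L \<pi> \<eta> = op_scaleC (c \<gamma> \<eta>) (\<pi> (\<gamma> \<otimes>\<^bsub>\<Gamma>\<^esub> \<eta>)))"

text \<open>\<open>U0\<close> is so small that all elements occurring in the definition of \<open>\<pi>\<^sub>\<rho>\<close> on \<open>U0\<close> are in \<open>W\<close>.\<close>

definition small_domain ::
  "('x, 'm) top_group_scheme \<Rightarrow> 'x set \<Rightarrow> (nat \<Rightarrow> 'x \<Rightarrow> 'x) \<Rightarrow> 'x set \<Rightarrow> 'x set \<Rightarrow> bool" where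
  "small_domain \<Gamma> N \<Xi> W U0 \<longleftrightarrow> nhd_of_one \<Gamma> U0 \<and> U0 \<subseteq> N \<and> U0 \<subseteq> W \<and>
     (\<forall>\<gamma>\<in>U0. \<Xi> 1 \<gamma> \<in> W \<and> \<Xi> 2 \<gamma> \<in> W \<and> \<Xi> 3 \<gamma> \<in> W \<and> \<Xi> 1 \<gamma> \<otimes>\<^bsub>\<Gamma>\<^esub> \<Xi> 2 \<gamma> \<in> W)"

definition frag_product ::
  "('x, 'm) top_group_scheme \<Rightarrow> (nat \<Rightarrow> complex set) \<Rightarrow>
   (complex set \<Rightarrow> ('h::chilbert \<Rightarrow>\<^sub>L 'h) \<Rightarrow> ('k::chilbert \<Rightarrow>\<^sub>L 'k)) \<Rightarrow>
   ('x \<Rightarrow> ('h \<Rightarrow>\<^sub>L 'h)) \<Rightarrow> ('x \<Rightarrow> 'x \<Rightarrow> complex) \<Rightarrow> 'x \<Rightarrow> 'x \<Rightarrow> 'x \<Rightarrow> ('k \<Rightarrow>\<^sub>L 'k)" where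
  "frag_product \<Gamma> I \<rho> \<pi> c \<gamma>\<^sub>1 \<gamma>\<^sub>2 \<gamma>\<^sub>3 =
     op_scaleC (inverse (c \<gamma>\<^sub>1 \<gamma>\<^sub>2) * inverse (c (\<gamma>\<^sub>1 \<otimes>\<^bsub>\<Gamma>\<^esub> \<gamma>\<^sub>2) \<gamma>\<^sub>3))
       (\<rho> (I 1) (\<pi> \<gamma>\<^sub>1) o\<^sub>L \<rho> (I 2) (\<pi> \<gamma>\<^sub>2) o\<^sub>L \<rho> (I 3) (\<pi> \<gamma>\<^sub>3))"

definition pi_rho ::
  "('x, 'm) top_group_scheme \<Rightarrow> (nat \<Rightarrow> complex set) \<Rightarrow>
   (complex set \<Rightarrow> ('h::chilbert \<Rightarrow>\<^sub>L 'h) \<Rightarrow> ('k::chilbert \<Rightarrow>\<^sub>L 'k)) \<Rightarrow>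
   ('x \<Rightarrow> ('h \<Rightarrow>\<^sub>L 'h)) \<Rightarrow> ('x \<Rightarrow> 'x \<Rightarrow> complex) \<Rightarrow> (nat \<Rightarrow> 'x \<Rightarrow> 'x) \<Rightarrow> 'x \<Rightarrow> ('k \<Rightarrow>\<^sub>L 'k)" where
  "pi_rho \<Gamma> I \<rho> \<pi> c \<Xi> \<gamma> = frag_product \<Gamma> I \<rho> \<pi> c (\<Xi> 1 \<gamma>) (\<Xi> 2 \<gamma>) (\<Xi> 3 \<gamma>)"

definition decomposition_independent ::
  "('x, 'm) supp_group_scheme \<Rightarrow> (nat \<Rightarrow> complex set) \<Rightarrow>
   (complex set \<Rightarrow> ('h::chilbert \<Rightarrow>\<^sub>L 'h) \<Rightarrow> ('k::chilbert \<Rightarrow>\<^sub>L 'k)) \<Rightarrow>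
   ('x \<Rightarrow> ('h \<Rightarrow>\<^sub>L 'h)) \<Rightarrow> ('x \<Rightarrow> 'x \<Rightarrow> complex) \<Rightarrow> (nat \<Rightarrow> 'x \<Rightarrow> 'x) \<Rightarrow> 'x set \<Rightarrow> bool" where
  "decomposition_independent \<Gamma> I \<rho> \<pi> c \<Xi> V \<longleftrightarrow>
     (\<forall>\<gamma>\<in>V. \<forall>\<gamma>\<^sub>1\<in>V \<inter> localized \<Gamma> (I 1). \<forall>\<gamma>\<^sub>2\<in>V \<inter> localized \<Gamma> (I 2).
      \<forall>\<gamma>\<^sub>3\<in>V \<inter> localized \<Gamma> (I 3).
        \<gamma> = \<gamma>\<^sub>1 \<otimes>\<^bsub>\<Gamma>\<^esub> \<gamma>\<^sub>2 \<otimes>\<^bsub>\<Gamma>\<^esub> \<gamma>\<^sub>3 \<longrightarrow>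
        pi_rho \<Gamma> I \<rho> \<pi> c \<Xi> \<gamma> = frag_product \<Gamma> I \<rho> \<pi> c \<gamma>\<^sub>1 \<gamma>\<^sub>2 \<gamma>\<^sub>3)"

definition local_multiplier_rep ::
  "('x, 'm) top_group_scheme \<Rightarrow> ('x \<Rightarrow> 'x \<Rightarrow> complex) \<Rightarrow> 'x set \<Rightarrow> 'x set \<Rightarrow>
   ('x \<Rightarrow> ('k::chilbert \<Rightarrow>\<^sub>L 'k)) \<Rightarrow> bool" where
  "local_multiplier_rep \<Gamma> c V U0 \<pi> \<longleftrightarrow>
     (\<forall>\<gamma>\<in>V. unitary_op (\<pi> \<gamma>)) \<and>
     continuous_map (subtopology (topo \<Gamma>) V) strong_operator_topology \<pi> \<and>
     (\<forall>\<gamma>\<in>V. \<forall>\<eta>\<in>V. \<gamma> \<otimes>\<^bsub>\<Gamma>\<^esub> \<eta> \<in> U0 \<longrightarrow>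
        \<pi> \<gamma> o\<^sub>L \<pi> \<eta> = op_scaleC (c \<gamma> \<eta>) (\<pi> (\<gamma> \<otimes>\<^bsub>\<Gamma>\<^esub> \<eta>)))"

end

theory Submission
  imports Defs
begin

text \<open>A pair \<open>(\<pi>\<^sub>0(\<gamma>), \<rho>\<^sub>I(\<pi>\<^sub>0(\<gamma>)))\<close>, taken up to a common phase, depends multiplicatively on
  \<open>\<gamma> \<in> \<Gamma>\<^sub>I\<close>, so the cocycle disappears and both claims become statements about local homomorphisms
  \<open>P\<^sub>I\<close> on the subgroups \<open>\<Gamma>\<^sub>I\<close>; the first components recover the phases at the end. The central extension
  enters only through \<open>\<pi>\<^sub>0\<close> and its local cocycle.

  The unions \<open>I\<^sub>i \<union> I\<^sub>j\<close> are again proper intervals, and \<open>P\<^sub>J\<close> and \<open>P\<^sub>K\<close> agree on small elements supported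
  in \<open>J \<inter> K\<close> even when \<open>J \<inter> K\<close> has two components, because such an element splits. If
  \<open>g\<^sub>1 g\<^sub>2 g\<^sub>3 = h\<^sub>1 h\<^sub>2 h\<^sub>3\<close>, then \<open>h\<^sub>1\<^sup>-\<^sup>1 g\<^sub>1 g\<^sub>2 = h\<^sub>2 h\<^sub>3 g\<^sub>3\<^sup>-\<^sup>1\<close> is supported in
  \<open>(I\<^sub>1 \<union> I\<^sub>2) \<inter> (I\<^sub>2 \<union> I\<^sub>3) = I\<^sub>2 \<union> (I\<^sub>1 \<inter> I\<^sub>3)\<close>, which gives independence of the decomposition. For the product
  of two triples, letters are reordered two intervals at a time: a word with letters in
  \<open>I\<^sub>i\<close> and \<open>I\<^sub>j\<close> is evaluated in \<open>I\<^sub>i \<union> I\<^sub>j\<close> and fragmented again.\<close>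

section \<open>Operators on complex Hilbert spaces\<close>

text \<open>The obstacle is that the circle is not an interval: the three factors have no common
  local algebra, so identities between words can only be checked inside unions of two of the
  intervals. Moreover \<open>P J\<close> is multiplicative only while products stay in
  \<open>W\<close>. The argument therefore runs along a decreasing chain of neighbourhoods
  \<open>C n\<close>, whose index counts how many products, inverses, splittings or fragmentations
  an element can still undergo; the constant 20 is such a count.

  Using pairs matters. The second component alone, modulo phases, would yield only a projective
  representation, whereas the phase common to both components is pinned down by the known vacuum
  component.

  Continuity needs its own argument. Normality is ultraweak continuity, but for unitary families
  ultraweak and strong continuity coincide, so each \<open>\<rho> (I j)\<close> preserves strong
  continuity. The scalars built from \<open>c\<close> are continuous because they are matrix
  coefficients, at the vacuum vector, of strongly continuous families.\<close>

lemma cinner_zero_left [simp]: "cinner 0 (x::'a::chilbert) = 0"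
  using cinner_add_left[of 0 0 x] by simp

lemma cinner_add_right: "cinner (x::'a::chilbert) (y + z) = cinner x y + cinner x z"
  by (metis cinner_add_left cinner_commute complex_cnj_add)

lemma cinner_scaleC_right: "cinner (x::'a::chilbert) (z *\<^sub>C y) = z * cinner x y"
  by (metis cinner_commute cinner_scaleC_left complex_cnj_cnj complex_cnj_mult)

lemma cinner_zero_right [simp]: "cinner (x::'a::chilbert) 0 = 0"
  using cinner_add_right[of x 0 0] by simp

lemma scaleC_one [simp]: "1 *\<^sub>C (x::'a::chilbert) = x"
  using scaleR_scaleC[of 1 x] by simp

lemma scaleC_scaleR: "z *\<^sub>C (r *\<^sub>R (x::'a::chilbert)) = r *\<^sub>R (z *\<^sub>C x)"
  by (simp add: scaleR_scaleC scaleC_scaleC mult.commute)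

lemma cinner_self: "cinner (x::'a::chilbert) x = complex_of_real ((norm x)\<^sup>2)"
proof -
  have "Im (cinner x x) = 0" using arg_cong[OF cinner_commute[of x x], of Im] by simp
  moreover have "Re (cinner x x) = (norm x)\<^sup>2" by (simp add: inner_cinner[symmetric] power2_norm_eq_inner)
  ultimately show ?thesis by (simp add: complex_eq_iff)
qed

lemma norm_scaleC: "norm (z *\<^sub>C (x::'a::chilbert)) = cmod z * norm x"
proof -
  have "complex_of_real ((norm (z *\<^sub>C x))\<^sup>2) = cnj z * (z * complex_of_real ((norm x)\<^sup>2))"
    unfolding cinner_self[symmetric] cinner_scaleC_left cinner_scaleC_right by (rule mult.left_commute)
  also have "\<dots> = complex_of_real ((cmod z * norm x)\<^sup>2)"
    unfolding power_mult_distrib of_real_mult complex_norm_square[of z] by (simp only: ac_simps)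
  finally have "(norm (z *\<^sub>C x))\<^sup>2 = (cmod z * norm x)\<^sup>2" using of_real_eq_iff by blast
  then show ?thesis by (simp add: power2_eq_iff_nonneg)
qed

text \<open>Rotating \<open>x\<close> by the phase of the inner product makes it real and
  non-negative, so the Cauchy-Schwarz inequality of the real structure applies.\<close>

lemma cmod_cinner_le: "cmod (cinner (x::'a::chilbert) y) \<le> norm x * norm y"
proof (cases "cinner x y = 0")
  case False
  define z where "z = cinner x y / cmod (cinner x y)"
  have z: "cmod z = 1" using False by (simp add: z_def norm_divide)
  have "cinner (z *\<^sub>C x) y = (cinner x y * cnj (cinner x y)) / cmod (cinner x y)"
    unfolding z_def cinner_scaleC_left by simp
  also have "\<dots> = complex_of_real (cmod (cinner x y))"
    unfolding complex_norm_square[symmetric] by (simp add: power2_eq_square)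
  finally have "cinner (z *\<^sub>C x) y = complex_of_real (cmod (cinner x y))" .
  then have "cmod (cinner x y) = inner (z *\<^sub>C x) y" by (simp add: inner_cinner)
  also have "\<dots> \<le> norm (z *\<^sub>C x) * norm y" by (rule norm_cauchy_schwarz)
  finally show ?thesis by (simp add: norm_scaleC z)
qed simp

lemma bounded_linear_scaleC: "bounded_linear (\<lambda>x::'a::chilbert. z *\<^sub>C x)"
  by (rule bounded_linear_intro[where K="cmod z"])
    (simp_all add: scaleC_add_right scaleC_scaleR norm_scaleC mult.commute)

lemma bounded_linear_cinner_right: "bounded_linear (\<lambda>y::'a::chilbert. cinner x y)"
  by (rule bounded_linear_intro[where K="norm x"])
    (simp_all add: cinner_add_right scaleR_scaleC cinner_scaleC_right scaleR_conv_of_real,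
      metis cmod_cinner_le mult.commute)

lemma cinner_diff_right: "cinner (x::'a::chilbert) (y - z) = cinner x y - cinner x z"
  by (rule linear_diff[OF bounded_linear.linear[OF bounded_linear_cinner_right]])

lemma cinner_extensionality: "y = z" if "\<And>x::'a::chilbert. cinner x y = cinner x z"
  using cinner_self[of "y - z"] that[of "y - z"] by (simp add: cinner_diff_right)

lemma op_scaleC_apply [simp]: "(op_scaleC z T) x = z *\<^sub>C T x"
  unfolding op_scaleC_def
  by (subst bounded_linear_Blinfun_apply) (auto intro: bounded_linear_compose[OF bounded_linear_scaleC blinfun.bounded_linear_right])

lemma op_scaleC_scaleC [simp]: "op_scaleC z (op_scaleC w T) = op_scaleC (z * w) T"
  by (rule blinfun_eqI) (simp add: scaleC_scaleC)

lemma op_scaleC_one [simp]: "op_scaleC 1 T = T"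
  by (rule blinfun_eqI) simp

lemma op_scaleC_comp_left: "op_scaleC z S o\<^sub>L T = op_scaleC z (S o\<^sub>L T)"
  by (rule blinfun_eqI) simp

lemma op_scaleC_comp_right: "S \<in> clinear_ops \<Longrightarrow> S o\<^sub>L op_scaleC z T = op_scaleC z (S o\<^sub>L T)"
  by (rule blinfun_eqI) (simp add: clinear_ops_def)

lemma unitary_op_norm: "unitary_op T \<Longrightarrow> norm (T x) = norm x"
proof -
  assume "unitary_op T"
  then have "complex_of_real ((norm (T x))\<^sup>2) = complex_of_real ((norm x)\<^sup>2)"
    unfolding unitary_op_def cinner_self[symmetric] by blast
  then have "(norm (T x))\<^sup>2 = (norm x)\<^sup>2" using of_real_eq_iff by blast
  then show ?thesis by (simp add: power2_eq_iff_nonneg)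
qed

lemma unitary_op_clinear: "unitary_op T \<Longrightarrow> T \<in> clinear_ops"
  by (simp add: unitary_op_def)

lemma unitary_op_cinner: "unitary_op T \<Longrightarrow> cinner (T x) (T y) = cinner x y"
  by (simp add: unitary_op_def)

lemma unitary_op_comp: "unitary_op S \<Longrightarrow> unitary_op T \<Longrightarrow> unitary_op (S o\<^sub>L T)"
  unfolding unitary_op_def clinear_ops_def
  by (auto simp: comp_surj[unfolded comp_def])

lemma unitary_op_scaleC: "cmod z = 1 \<Longrightarrow> unitary_op (T :: 'a::chilbert \<Rightarrow>\<^sub>L 'b::chilbert) \<Longrightarrow> unitary_op (op_scaleC z T)"
proof -
  assume z: "cmod z = 1" and T: "unitary_op (T :: 'a \<Rightarrow>\<^sub>L 'b)"
  have zz: "cnj z * z = 1" "z * cnj z = 1" using z complex_norm_square[of z] by (simp_all add: mult.commute)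
  have "\<exists>x. y = z *\<^sub>C T x" for y
  proof -
    obtain x where "cnj z *\<^sub>C y = T x" using T unfolding unitary_op_def surj_def by blast
    then have "y = z *\<^sub>C T x" by (metis scaleC_one scaleC_scaleC zz(2))
    then show ?thesis by blast
  qed
  moreover have "cinner (z *\<^sub>C u) (z *\<^sub>C v) = cinner u v" for u v :: 'b
    unfolding cinner_scaleC_left cinner_scaleC_right mult.assoc[symmetric] zz by simp
  moreover have "z *\<^sub>C w *\<^sub>C u = w *\<^sub>C z *\<^sub>C u" for w and u :: 'b
    unfolding scaleC_scaleC by (simp add: mult.commute)
  ultimately show ?thesis using T unfolding unitary_op_def clinear_ops_def surj_def by simp
qed

section \<open>Riesz representation, adjoints and unitarity\<close>

lemma riesz_real:
  fixes f :: "'a::{real_inner,complete_space} \<Rightarrow> real"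
  assumes "bounded_linear f"
  shows "\<exists>z. \<forall>x. f x = inner z x"
proof -
  interpret f: bounded_linear f by fact
  \<comment> \<open>A minimizer of this quadratic functional has vanishing first variation, which
    says exactly that it represents \<open>f\<close>.\<close>
  define q where "q x = inner x x - 2 * f x" for x
  obtain K where K: "\<And>x. norm (f x) \<le> norm x * K" using f.bounded by blast
  have "q x \<ge> - K\<^sup>2" for x
  proof -
    have "f x \<le> norm x * K" using K[of x] by simp
    moreover have "0 \<le> (norm x - K)\<^sup>2" by simp
    ultimately show ?thesis unfolding q_def
      by (simp add: power2_norm_eq_inner[symmetric] power2_diff)
  qed
  then have bdd: "bdd_below (range q)" by (rule bdd_belowI2)
  define m where "m = Inf (range q)"
  have m_le: "m \<le> q x" for x unfolding m_def by (rule cInf_lower[OF _ bdd]) simp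
  have "\<exists>x. q x < m + 1 / (real n + 1)" for n
    using cInf_lessD[of "range q" "m + 1 / (real n + 1)"] unfolding m_def by fastforce
  then obtain x where x: "\<And>n. q (x n) < m + 1 / (real n + 1)" by metis
  \<comment> \<open>Parallelogram law, in which the linear part of \<open>q\<close> cancels. It
    makes every minimizing sequence Cauchy.\<close>
  have par: "(norm (u - v))\<^sup>2 \<le> 2 * (q u - m) + 2 * (q v - m)" for u v
  proof -
    have "(norm (u - v))\<^sup>2 = 2 * q u + 2 * q v - 4 * q ((1/2) *\<^sub>R (u + v))"
      unfolding q_def power2_norm_eq_inner
      by (simp add: f.add f.scaleR inner_diff_left inner_diff_right inner_add_left inner_add_right inner_commute algebra_simps)
    also have "\<dots> \<le> 2 * q u + 2 * q v - 4 * m" using m_le by simp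
    finally show ?thesis by simp
  qed
  have "Cauchy x"
  proof (rule metric_CauchyI)
    fix e :: real assume e: "0 < e"
    obtain M where M: "1 / (real M + 1) < e\<^sup>2 / 4"
      using reals_Archimedean[of "e\<^sup>2 / 4"] e by (auto simp: inverse_eq_divide add.commute)
    have "dist (x i) (x j) < e" if "M \<le> i" "M \<le> j" for i j
    proof -
      have "q (x i) - m < e\<^sup>2 / 4" "q (x j) - m < e\<^sup>2 / 4"
        using x[of i] x[of j] that M
        by (smt (verit, best) frac_le of_nat_0_le_iff of_nat_mono)+
      moreover have "a < s / 4 \<Longrightarrow> b < s / 4 \<Longrightarrow> c \<le> 2 * a + 2 * b \<Longrightarrow> c < s" for a b c s :: real by linarith
      ultimately have "(norm (x i - x j))\<^sup>2 < e\<^sup>2" using par[of "x i" "x j"] by blast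
      then show ?thesis using e by (simp add: dist_norm power2_less_imp_less)
    qed
    then show "\<exists>M. \<forall>i\<ge>M. \<forall>j\<ge>M. dist (x i) (x j) < e" by blast
  qed
  then obtain z where z: "x \<longlonglongrightarrow> z" using Cauchy_convergent convergent_def by blast
  have "(\<lambda>n. q (x n)) \<longlonglongrightarrow> q z" unfolding q_def by (intro tendsto_intros z f.tendsto)
  moreover have "(\<lambda>n. m + 1 / (real n + 1)) \<longlonglongrightarrow> m + 0"
    by (intro tendsto_intros) (use LIMSEQ_inverse_real_of_nat in \<open>simp add: inverse_eq_divide add.commute\<close>)
  ultimately have "q z \<le> m + 0" by (rule LIMSEQ_le) (use x less_imp_le in blast)
  then have zmin: "q z \<le> q y" for y using m_le[of y] by simp
  have "f y = inner z y" for y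
  proof (cases "y = 0")
    case False
    define d where "d = f y - inner z y"
    \<comment> \<open>The minimum of the quadratic polynomial \<open>q (z + t *\<^sub>R y)\<close>
      in \<open>t\<close>. There \<open>q\<close> drops by \<open>d\<^sup>2 / inner y y\<close>, so
      minimality of \<open>z\<close> forces \<open>d = 0\<close>.\<close>
    define t where "t = d / inner y y"
    have yy: "inner y y > 0" using False by simp
    have "q (z + t *\<^sub>R y) = q z + t\<^sup>2 * inner y y - 2 * t * d"
      unfolding q_def d_def
      by (simp add: f.add f.scaleR inner_add_left inner_add_right inner_commute power2_eq_square algebra_simps)
    also have "\<dots> = q z - d\<^sup>2 / inner y y" using yy unfolding t_def
      by (simp add: power2_eq_square field_simps)
    finally have "d\<^sup>2 / inner y y \<le> 0" using zmin[of "z + t *\<^sub>R y"] by simp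
    then have "d = 0" using yy by (simp add: divide_le_0_iff)
    then show ?thesis by (simp add: d_def)
  qed (simp add: f.zero)
  then show ?thesis by blast
qed

text \<open>The Riesz vector matches real parts only. Replacing \<open>x\<close> by
  \<open>\<i> *\<^sub>C x\<close> and using complex linearity of \<open>T\<close> matches the
  imaginary parts as well.\<close>

lemma adj_op_exists:
  assumes T: "(T :: 'a::chilbert \<Rightarrow>\<^sub>L 'b::chilbert) \<in> clinear_ops"
  shows "\<exists>S. \<forall>x y. cinner (blinfun_apply T x) y = cinner x (blinfun_apply S y)"
proof -
  have "\<exists>z. \<forall>x. cinner (T x) y = cinner x z" for y
  proof -
    have "bounded_linear (\<lambda>x. inner (T x) y)"
      by (rule bounded_linear_compose[OF bounded_linear_inner_left blinfun.bounded_linear_right])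
    then obtain z where z: "\<And>x. inner (blinfun_apply T x) y = inner z x" using riesz_real by blast
    have re: "Re (cinner (T x) y) = Re (cinner x z)" for x
      using z[of x] inner_commute[of z x] by (simp add: inner_cinner)
    have "cinner (T x) y = cinner x z" for x
    proof (rule complex_eqI[OF re])
      have "T (\<i> *\<^sub>C x) = \<i> *\<^sub>C T x" using T by (simp add: clinear_ops_def)
      then show "Im (cinner (T x) y) = Im (cinner x z)"
        using re[of "\<i> *\<^sub>C x"] by (simp add: cinner_scaleC_left)
    qed
    then show ?thesis by blast
  qed
  then obtain S where S: "\<And>x y. cinner (T x) y = cinner x (S y)" by metis
  have "bounded_linear S"
  proof (rule bounded_linear_intro[where K="norm T"])
    show "S (x + y) = S x + S y" for x y
      by (rule cinner_extensionality) (simp add: S[symmetric] cinner_add_right)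
    show "S (r *\<^sub>R x) = r *\<^sub>R S x" for r x
      by (rule cinner_extensionality) (simp add: S[symmetric] cinner_scaleC_right scaleR_scaleC)
    show "norm (S x) \<le> norm x * norm T" for x
    proof -
      have "(norm (S x))\<^sup>2 = cmod (cinner (T (S x)) x)" by (simp add: S cinner_self norm_power)
      also have "\<dots> \<le> norm (T (S x)) * norm x" by (rule cmod_cinner_le)
      also have "\<dots> \<le> norm T * norm (S x) * norm x" by (intro mult_right_mono norm_blinfun) simp
      finally have "norm (S x) * norm (S x) \<le> norm (S x) * (norm x * norm T)"
        by (simp add: power2_eq_square algebra_simps)
      then show ?thesis by (cases "norm (S x) = 0") auto
    qed
  qed
  then show ?thesis using S by (metis bounded_linear_Blinfun_apply)
qed

text \<open>The definite description in \<open>adj_op\<close> is proper: a solution exists by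
  \<open>adj_op_exists\<close>, and it is unique because a vector is determined by its inner
  products.\<close>

lemma adj_op_apply:
  assumes T: "(T :: 'a::chilbert \<Rightarrow>\<^sub>L 'b::chilbert) \<in> clinear_ops"
  shows "cinner (T x) y = cinner x ((adj_op T) y)"
proof -
  obtain S where S: "\<forall>x y. cinner (blinfun_apply T x) y = cinner x (blinfun_apply S y)"
    using adj_op_exists[OF T] by blast
  have "adj_op T = S" unfolding adj_op_def
  proof (rule the_equality[where P="\<lambda>S. \<forall>x y. cinner (blinfun_apply T x) y = cinner x (blinfun_apply S y)", OF S])
    show "S' = S" if "\<forall>x y. cinner (blinfun_apply T x) y = cinner x (blinfun_apply S' y)" for S'
      by (rule blinfun_eqI, rule cinner_extensionality) (use that S in simp)
  qed
  then show ?thesis using S by simp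
qed

text \<open>This trades isometry and surjectivity for algebraic identities, which a unital
  representation respecting adjoints transports.\<close>

lemma unitary_op_iff_adj:
  assumes "(T :: 'a::chilbert \<Rightarrow>\<^sub>L 'b::chilbert) \<in> clinear_ops"
  shows "unitary_op T \<longleftrightarrow> adj_op T o\<^sub>L T = id_blinfun \<and> T o\<^sub>L adj_op T = id_blinfun"
proof
  assume T: "unitary_op T"
  have 1: "(adj_op T) (T x) = x" for x
    by (rule cinner_extensionality) (simp add: adj_op_apply[OF assms, symmetric] unitary_op_cinner[OF T])
  have 2: "T ((adj_op T) y) = y" for y
  proof -
    obtain x where "y = T x" using T unfolding unitary_op_def surj_def by blast
    then show ?thesis by (simp add: 1)
  qed
  show "adj_op T o\<^sub>L T = id_blinfun \<and> T o\<^sub>L adj_op T = id_blinfun"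
    by (auto intro!: blinfun_eqI simp: 1 2)
next
  assume A: "adj_op T o\<^sub>L T = id_blinfun \<and> T o\<^sub>L adj_op T = id_blinfun"
  have 1: "(adj_op T) (T x) = x" for x
    using A by (metis blinfun_apply_blinfun_compose blinfun_apply_id_blinfun id_apply)
  have 2: "T ((adj_op T) x) = x" for x
    using A by (metis blinfun_apply_blinfun_compose blinfun_apply_id_blinfun id_apply)
  show "unitary_op T" unfolding unitary_op_def
    using assms 1 2 adj_op_apply[OF assms] by (metis surjI)
qed

lemma normal_representation_unitary:
  assumes M: "von_neumann_algebra M" and \<rho>: "normal_representation M \<rho>"
    and T: "T \<in> M" "unitary_op T"
  shows "unitary_op (\<rho> T)"
proof -
  have adjM: "adj_op T \<in> M" using M T by (auto simp: von_neumann_algebra_def)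
  have cl: "\<rho> T \<in> clinear_ops" and one: "\<rho> id_blinfun = id_blinfun"
    and mult: "\<And>S T. S \<in> M \<Longrightarrow> T \<in> M \<Longrightarrow> \<rho> (S o\<^sub>L T) = \<rho> S o\<^sub>L \<rho> T"
    and adj: "\<rho> (adj_op T) = adj_op (\<rho> T)"
    using \<rho> T by (auto simp: normal_representation_def)
  show ?thesis
    using T(2) unitary_op_iff_adj[OF unitary_op_clinear[OF T(2)]] mult[OF T(1) adjM] mult[OF adjM T(1)]
    by (simp add: unitary_op_iff_adj[OF cl] one adj)
qed

section \<open>Strong and ultraweak continuity of unitary families\<close>

lemma continuous_map_euclidean_iff_tendsto:
  "continuous_map X euclidean f \<longleftrightarrow> (\<forall>x\<in>topspace X. (f \<longlongrightarrow> f x) (atin X x))"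
  by (simp add: continuous_map_atin limitin_canonical_iff)

text \<open>Continuity into a generated topology can be tested on the generating sets once these are
  known to cover the whole space; the zero sequences with \<open>V = UNIV\<close> provide
  that.\<close>

lemma continuous_map_ultraweak_iff:
  fixes f :: "'t \<Rightarrow> ('a::chilbert \<Rightarrow>\<^sub>L 'b::chilbert)"
  shows "continuous_map X ultraweak_topology f \<longleftrightarrow>
    (\<forall>x y. square_summable x \<and> square_summable y \<longrightarrow>
      continuous_map X euclidean (\<lambda>t. \<Sum>n. cinner (x n) ((f t) (y n))))"
    (is "?l \<longleftrightarrow> ?r")
proof -
  define B where "B x y V = {T :: 'a \<Rightarrow>\<^sub>L 'b. (\<Sum>n. cinner (x n) (T (y n))) \<in> V}" for x y V
  define \<B> where "\<B> = {B x y V | x y V. square_summable x \<and> square_summable y \<and> open V}"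
  have top: "ultraweak_topology = topology_generated_by \<B>"
    unfolding ultraweak_topology_def \<B>_def B_def ..
  have pre: "f -` B x y V \<inter> topspace X = {t \<in> topspace X. (\<Sum>n. cinner (x n) ((f t) (y n))) \<in> V}"
    for x y V unfolding B_def by blast
  have "square_summable (\<lambda>n. 0 :: 'b)" "square_summable (\<lambda>n. 0 :: 'a)"
    unfolding square_summable_def by simp_all
  then have "B (\<lambda>n. 0) (\<lambda>n. 0) UNIV \<in> \<B>"
    unfolding \<B>_def mem_Collect_eq using open_UNIV by blast
  moreover have "B (\<lambda>n. 0) (\<lambda>n. 0) UNIV = UNIV" unfolding B_def by blast
  ultimately have "\<Union>\<B> = UNIV" by blast
  then have "?l \<longleftrightarrow> (\<forall>U\<in>\<B>. openin X (f -` U \<inter> topspace X))"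
    unfolding top continuous_on_generated_topo_iff by auto
  also have "\<dots> \<longleftrightarrow> (\<forall>x y V. square_summable x \<and> square_summable y \<and> open V \<longrightarrow>
      openin X (f -` B x y V \<inter> topspace X))"
    unfolding \<B>_def by blast
  also have "\<dots> \<longleftrightarrow> ?r"
    unfolding continuous_map_def pre open_openin[symmetric] Pi_iff by (simp only: topspace_euclidean UNIV_I) blast
  finally show ?thesis .
qed

lemma continuous_map_strong_iff_tendsto:
  fixes f :: "'t \<Rightarrow> ('a::real_normed_vector \<Rightarrow>\<^sub>L 'b::real_normed_vector)"
  shows "continuous_map X strong_operator_topology f \<longleftrightarrow>
    (\<forall>y. \<forall>t\<in>topspace X. ((\<lambda>s. f s y) \<longlongrightarrow> f t y) (atin X t))"
  unfolding continuous_on_strong_operator_topo_iff_coordinatewise continuous_map_euclidean_iff_tendsto ..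

text \<open>Unitaries are isometric, so the terms of the defining series are dominated independently
  of \<open>t\<close>. By the Weierstrass test the series converges uniformly, and its finite
  partial sums are continuous by strong continuity.\<close>

lemma unitary_strong_imp_ultraweak:
  fixes f :: "'t \<Rightarrow> ('a::chilbert \<Rightarrow>\<^sub>L 'b::chilbert)"
  assumes f: "continuous_map X strong_operator_topology f"
    and u: "\<And>t. t \<in> topspace X \<Longrightarrow> unitary_op (f t)"
  shows "continuous_map X ultraweak_topology f"
  unfolding continuous_map_ultraweak_iff
proof (intro allI impI)
  fix x :: "nat \<Rightarrow> 'b" and y :: "nat \<Rightarrow> 'a"
  assume "square_summable x \<and> square_summable y"
  then have x: "square_summable x" and y: "square_summable y" by auto
    have S: "summable (\<lambda>n. (norm (x n))\<^sup>2 + (norm (y n))\<^sup>2)"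
      using x y by (auto simp: square_summable_def intro: summable_add)
    have bd: "norm (cinner (x n) ((f t) (y n))) \<le> (norm (x n))\<^sup>2 + (norm (y n))\<^sup>2"
      if "t \<in> topspace X" for n t
    proof -
      have "norm (cinner (x n) ((f t) (y n))) \<le> norm (x n) * norm (y n)"
        using cmod_cinner_le[of "x n" "(f t) (y n)"] unitary_op_norm[OF u[OF that]] by simp
      also have "\<dots> \<le> (norm (x n))\<^sup>2 + (norm (y n))\<^sup>2"
        using sum_squares_bound[of "norm (x n)" "norm (y n)"]
          mult_nonneg_nonneg[OF norm_ge_zero[of "x n"] norm_ge_zero[of "y n"]] by linarith
      finally show ?thesis .
    qed
    have unif: "uniform_limit (topspace X) (\<lambda>N t. \<Sum>n<N. cinner (x n) ((f t) (y n)))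
        (\<lambda>t. \<Sum>n. cinner (x n) ((f t) (y n))) sequentially"
      by (rule Weierstrass_m_test[OF _ S]) (use bd in auto)
    have part: "continuous_map X euclidean (\<lambda>t. \<Sum>n<N. cinner (x n) ((f t) (y n)))" for N
      unfolding continuous_map_euclidean_iff_tendsto
    proof
      fix t assume "t \<in> topspace X"
      then have "((\<lambda>t. (f t) z) \<longlongrightarrow> (f t) z) (atin X t)" for z
        using f unfolding continuous_map_strong_iff_tendsto by blast
      then show "((\<lambda>t. \<Sum>n<N. cinner (x n) ((f t) (y n))) \<longlongrightarrow>
          (\<Sum>n<N. cinner (x n) ((f t) (y n)))) (atin X t)"
        by (intro tendsto_sum bounded_linear.tendsto[OF bounded_linear_cinner_right])
    qed
    have "continuous_map X (Met_TC.mtopology) (\<lambda>t. \<Sum>n. cinner (x n) ((f t) (y n)))"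
    proof (rule Met_TC.continuous_map_uniform_limit[where F=sequentially])
      show "\<forall>\<^sub>F N in sequentially. continuous_map X Met_TC.mtopology
          (\<lambda>t. \<Sum>n<N. cinner (x n) ((f t) (y n)))"
        using part by simp
    qed (use unif in \<open>auto simp: uniform_limit_iff\<close>)
    then show "continuous_map X euclidean (\<lambda>t. \<Sum>n. cinner (x n) ((f t) (y n)))" by simp
qed

text \<open>Weak convergence with preserved norms is norm convergence: the squared distance of
  \<open>f s y\<close> and \<open>f t y\<close> equals
  \<open>2 * (norm y)\<^sup>2 - 2 * inner (f t y) (f s y)\<close>.\<close>

lemma unitary_ultraweak_imp_strong:
  fixes f :: "'t \<Rightarrow> ('a::chilbert \<Rightarrow>\<^sub>L 'b::chilbert)"
  assumes f: "continuous_map X ultraweak_topology f"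
    and u: "\<And>t. t \<in> topspace X \<Longrightarrow> unitary_op (f t)"
  shows "continuous_map X strong_operator_topology f"
  unfolding continuous_map_strong_iff_tendsto
proof (intro allI ballI)
  fix y t assume t: "t \<in> topspace X"
  have weak: "continuous_map X euclidean (\<lambda>t. cinner x ((f t) y))" for x
  proof -
    \<comment> \<open>Sequences concentrated at index 0 turn the series into a single matrix
      coefficient.\<close>
    define x' where "x' n = (if n = (0::nat) then x else 0)" for n
    define y' where "y' n = (if n = (0::nat) then y else 0)" for n
    have "square_summable x'" "square_summable y'"
      unfolding square_summable_def x'_def y'_def
      by (rule summable_finite[of "{0}"]; simp)+
    moreover have "(\<Sum>n. cinner (x' n) (T (y' n))) = cinner x (T y)"
      for T :: "'a \<Rightarrow>\<^sub>L 'b"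
      by (subst suminf_finite[of "{0}"]) (auto simp: x'_def y'_def)
    moreover have "square_summable x' \<and> square_summable y' \<longrightarrow>
        continuous_map X euclidean (\<lambda>t. \<Sum>n. cinner (x' n) ((f t) (y' n)))"
      using f unfolding continuous_map_ultraweak_iff by (elim allE)
    ultimately show ?thesis by simp
  qed
  have "((\<lambda>s. cinner ((f t) y) ((f s) y)) \<longlongrightarrow>
      cinner ((f t) y) ((f t) y)) (atin X t)"
    using weak t unfolding continuous_map_euclidean_iff_tendsto by blast
  then have "((\<lambda>s. inner ((f t) y) ((f s) y)) \<longlongrightarrow>
      inner ((f t) y) ((f t) y)) (atin X t)"
    unfolding inner_cinner by (rule tendsto_Re)
  then have "((\<lambda>s. 2 * (norm y)\<^sup>2 - 2 * inner ((f t) y) ((f s) y)) \<longlongrightarrow>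
      2 * (norm y)\<^sup>2 - 2 * inner ((f t) y) ((f t) y)) (atin X t)"
    by (intro tendsto_diff tendsto_mult tendsto_const)
  moreover have "inner ((f t) y) ((f t) y) = (norm y)\<^sup>2"
    by (simp add: power2_norm_eq_inner[symmetric] unitary_op_norm[OF u[OF t]])
  ultimately have lim: "((\<lambda>s. 2 * (norm y)\<^sup>2 - 2 * inner ((f t) y) ((f s) y)) \<longlongrightarrow> 0) (atin X t)"
    by simp
  have "\<forall>\<^sub>F s in atin X t. 2 * (norm y)\<^sup>2 - 2 * inner ((f t) y) ((f s) y)
      = (norm ((f s) y - (f t) y))\<^sup>2"
    unfolding eventually_atin
  proof (intro disjI2 exI[of _ "topspace X"] conjI ballI)
    fix s assume "s \<in> topspace X - {t}"
    then have "inner ((f s) y) ((f s) y) = (norm y)\<^sup>2"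
      "inner ((f t) y) ((f t) y) = (norm y)\<^sup>2"
      using t by (simp_all add: power2_norm_eq_inner[symmetric] unitary_op_norm[OF u])
    then show "2 * (norm y)\<^sup>2 - 2 * inner ((f t) y) ((f s) y)
      = (norm ((f s) y - (f t) y))\<^sup>2"
      unfolding power2_norm_eq_inner[of "_ - _"] by (simp add: inner_diff_left inner_diff_right inner_commute)
  qed (use t in auto)
  then have "((\<lambda>s. (norm ((f s) y - (f t) y))\<^sup>2) \<longlongrightarrow> 0) (atin X t)"
    using lim tendsto_cong by fast
  then have "((\<lambda>s. norm ((f s) y - (f t) y)) \<longlongrightarrow> 0) (atin X t)"
    by simp
  then show "((\<lambda>t. (f t) y) \<longlongrightarrow> (f t) y) (atin X t)"
    by (simp add: tendsto_norm_zero_iff LIM_zero_iff)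
qed

lemma normal_representation_strong_continuity:
  assumes M: "von_neumann_algebra M" and \<rho>: "normal_representation M \<rho>"
    and f: "continuous_map X strong_operator_topology f"
    and u: "\<And>t. t \<in> topspace X \<Longrightarrow> f t \<in> M \<and> unitary_op (f t)"
  shows "continuous_map X strong_operator_topology (\<lambda>t. \<rho> (f t))"
proof (rule unitary_ultraweak_imp_strong)
  have "continuous_map X (subtopology ultraweak_topology M) f"
    using unitary_strong_imp_ultraweak[OF f] u by (auto simp: continuous_map_in_subtopology)
  moreover have "continuous_map (subtopology ultraweak_topology M) ultraweak_topology \<rho>"
    using \<rho> by (simp add: normal_representation_def)
  ultimately show "continuous_map X ultraweak_topology (\<lambda>t. \<rho> (f t))"
    using continuous_map_compose unfolding o_def by blast
  show "unitary_op (\<rho> (f t))" if "t \<in> topspace X" for t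
    using normal_representation_unitary[OF M \<rho>] u[OF that] by blast
qed

text \<open>Composition is not jointly strongly continuous in general. Here the left factor is
  isometric, so \<open>f s (g s y - g t y)\<close> tends to 0, and \<open>f s (g t y)\<close> is
  handled by strong continuity of \<open>f\<close>.\<close>

lemma continuous_map_strong_comp:
  fixes f :: "'t \<Rightarrow> ('b::chilbert \<Rightarrow>\<^sub>L 'c::chilbert)" and g :: "'t \<Rightarrow> ('a::chilbert \<Rightarrow>\<^sub>L 'b)"
  assumes f: "continuous_map X strong_operator_topology f"
    and g: "continuous_map X strong_operator_topology g"
    and u: "\<And>t. t \<in> topspace X \<Longrightarrow> unitary_op (f t)"
  shows "continuous_map X strong_operator_topology (\<lambda>t. f t o\<^sub>L g t)"
  unfolding continuous_map_strong_iff_tendsto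
proof (intro allI ballI)
  fix y t assume t: "t \<in> topspace X"
  have fz: "((\<lambda>s. (f s) z) \<longlongrightarrow> (f t) z) (atin X t)" for z
    using f t unfolding continuous_map_strong_iff_tendsto by blast
  have "((\<lambda>s. (g s) y) \<longlongrightarrow> (g t) y) (atin X t)"
    using g t unfolding continuous_map_strong_iff_tendsto by blast
  then have "((\<lambda>s. norm ((g s) y - (g t) y)) \<longlongrightarrow> 0) (atin X t)"
    by (simp add: tendsto_norm_zero_iff LIM_zero_iff)
  moreover have "\<forall>\<^sub>F s in atin X t. norm ((g s) y - (g t) y)
     = norm ((f s) ((g s) y - (g t) y))"
    unfolding eventually_atin
    by (intro disjI2 exI[of _ "topspace X"] conjI ballI) (use t unitary_op_norm[OF u] in auto)
  ultimately have "((\<lambda>s. norm ((f s) ((g s) y - (g t) y))) \<longlongrightarrow> 0) (atin X t)"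
    using tendsto_cong by fast
  then have "((\<lambda>s. (f s) ((g s) y - (g t) y)) \<longlongrightarrow> 0) (atin X t)"
    by (simp add: tendsto_norm_zero_iff)
  from tendsto_add[OF this fz[of "(g t) y"]]
  show "((\<lambda>t. (f t o\<^sub>L g t) y) \<longlongrightarrow> (f t o\<^sub>L g t) y) (atin X t)"
    by (simp add: blinfun.diff_right)
qed

lemma continuous_map_strong_scaleC:
  fixes f :: "'t \<Rightarrow> ('a::chilbert \<Rightarrow>\<^sub>L 'b::chilbert)"
  assumes f: "continuous_map X strong_operator_topology f" and z: "continuous_map X euclidean z"
  shows "continuous_map X strong_operator_topology (\<lambda>t. op_scaleC (z t) (f t))"
  unfolding continuous_map_strong_iff_tendsto
proof (intro allI ballI)
  fix y t assume t: "t \<in> topspace X"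
  have f': "((\<lambda>s. (f s) y) \<longlongrightarrow> (f t) y) (atin X t)"
    using f t unfolding continuous_map_strong_iff_tendsto by blast
  have z': "(z \<longlongrightarrow> z t) (atin X t)" using z t unfolding continuous_map_euclidean_iff_tendsto by blast
  have "bounded_bilinear (\<lambda>z (x::'b). z *\<^sub>C x)"
    by standard (auto simp: scaleC_add_left scaleC_add_right scaleC_scaleR norm_scaleC scaleR_scaleC[where 'a='b] scaleC_scaleC scaleR_conv_of_real mult.commute intro: exI[of _ 1])
  from bounded_bilinear.tendsto[OF this z' f']
  show "((\<lambda>t. (op_scaleC (z t) (f t)) y) \<longlongrightarrow> (op_scaleC (z t) (f t)) y) (atin X t)"
    by simp
qed

section \<open>Local homomorphisms on localized subgroups\<close>

lemma nhd_of_one_Int: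
  assumes "nhd_of_one \<Gamma> V" "nhd_of_one \<Gamma> V'"
  shows "nhd_of_one \<Gamma> (V \<inter> V')"
proof -
  obtain S S' where "openin (topo \<Gamma>) S" "\<one>\<^bsub>\<Gamma>\<^esub> \<in> S" "S \<subseteq> V" "openin (topo \<Gamma>) S'" "\<one>\<^bsub>\<Gamma>\<^esub> \<in> S'" "S' \<subseteq> V'"
    using assms unfolding nhd_of_one_def by blast
  then have "openin (topo \<Gamma>) (S \<inter> S') \<and> \<one>\<^bsub>\<Gamma>\<^esub> \<in> S \<inter> S' \<and> S \<inter> S' \<subseteq> V \<inter> V'" by blast
  then show ?thesis using assms unfolding nhd_of_one_def by blast
qed

lemma nhd_of_one_preimage:
  assumes N: "nhd_of_one \<Gamma> N" and f: "continuous_map (subtopology (topo \<Gamma>) N) (topo \<Gamma>) f"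
    and f1: "f \<one>\<^bsub>\<Gamma>\<^esub> = \<one>\<^bsub>\<Gamma>\<^esub>" and V: "nhd_of_one \<Gamma> V"
  shows "nhd_of_one \<Gamma> {x \<in> N. f x \<in> V}"
proof -
  obtain S where S: "openin (topo \<Gamma>) S" "\<one>\<^bsub>\<Gamma>\<^esub> \<in> S" "S \<subseteq> V" using V unfolding nhd_of_one_def by blast
  obtain R where R: "openin (topo \<Gamma>) R" "\<one>\<^bsub>\<Gamma>\<^esub> \<in> R" "R \<subseteq> N" "N \<subseteq> carrier \<Gamma>"
    using N unfolding nhd_of_one_def by blast
  \<comment> \<open>\<open>N\<close> itself need not be open, so the preimage is only relatively
    open; intersecting with an open set \<open>R\<close> inside \<open>N\<close> repairs
    this.\<close>
  have "openin (subtopology (topo \<Gamma>) N) {x \<in> topspace (subtopology (topo \<Gamma>) N). f x \<in> S}"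
    using f S(1) by (rule openin_continuous_map_preimage)
  then obtain T where T: "openin (topo \<Gamma>) T" "{x \<in> topspace (subtopology (topo \<Gamma>) N). f x \<in> S} = T \<inter> N"
    unfolding openin_subtopology by blast
  have "\<one>\<^bsub>\<Gamma>\<^esub> \<in> topspace (topo \<Gamma>)" using R openin_subset by blast
  then have "\<one>\<^bsub>\<Gamma>\<^esub> \<in> T \<inter> R" using T(2) R S f1 by auto
  moreover have "T \<inter> R \<subseteq> {x \<in> N. f x \<in> V}" using T(2) R(3) S(3) by blast
  moreover have "openin (topo \<Gamma>) (T \<inter> R)" using T R by blast
  ultimately show ?thesis using R(4) unfolding nhd_of_one_def by blast
qed

lemma fragmentationD:
  assumes "fragmentation \<Gamma> I N \<Xi>"
  shows "nhd_of_one \<Gamma> N" "\<forall>j\<in>{1,2,3}. continuous_map (subtopology (topo \<Gamma>) N) (topo \<Gamma>) (\<Xi> j)"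
    "\<forall>j\<in>{1,2,3}. \<Xi> j \<one>\<^bsub>\<Gamma>\<^esub> = \<one>\<^bsub>\<Gamma>\<^esub>" "\<forall>j\<in>{1,2,3}. \<forall>x\<in>N. \<Xi> j x \<in> localized \<Gamma> (I j)"
    "\<forall>x\<in>N. x = \<Xi> 1 x \<otimes>\<^bsub>\<Gamma>\<^esub> \<Xi> 2 x \<otimes>\<^bsub>\<Gamma>\<^esub> \<Xi> 3 x"
proof -
  note f = assms[unfolded fragmentation_def]
  show "nhd_of_one \<Gamma> N" by (rule f[THEN conjunct1])
  show "\<forall>j\<in>{1,2,3}. continuous_map (subtopology (topo \<Gamma>) N) (topo \<Gamma>) (\<Xi> j)"
    "\<forall>j\<in>{1,2,3}. \<Xi> j \<one>\<^bsub>\<Gamma>\<^esub> = \<one>\<^bsub>\<Gamma>\<^esub>" "\<forall>j\<in>{1,2,3}. \<forall>x\<in>N. \<Xi> j x \<in> localized \<Gamma> (I j)"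
    using f[THEN conjunct2, THEN conjunct1] by - (rule ballI, drule (1) bspec, (elim conjE)?, assumption)+
  show "\<forall>x\<in>N. x = \<Xi> 1 x \<otimes>\<^bsub>\<Gamma>\<^esub> \<Xi> 2 x \<otimes>\<^bsub>\<Gamma>\<^esub> \<Xi> 3 x"
    by (rule f[THEN conjunct2, THEN conjunct2, THEN conjunct1])
qed

text \<open>The common interface of loops and diffeomorphisms. In \<open>nhd_split\<close> the
  neighbourhood is chosen before \<open>A\<close> and \<open>B\<close>, so one choice serves all
  pairs of disjoint open sets.\<close>

locale localizable_group = group \<Gamma> for \<Gamma> :: "('x, 'm) supp_group_scheme" (structure) +
  assumes nhd_mult: "nhd_of_one \<Gamma> V \<Longrightarrow> \<exists>V'. nhd_of_one \<Gamma> V' \<and> (\<forall>x\<in>V'. \<forall>y\<in>V'. x \<otimes> y \<in> V)"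
    and nhd_inv: "nhd_of_one \<Gamma> V \<Longrightarrow> \<exists>V'. nhd_of_one \<Gamma> V' \<and> (\<forall>x\<in>V'. inv x \<in> V)"
    and supp_mult: "x \<in> carrier \<Gamma> \<Longrightarrow> y \<in> carrier \<Gamma> \<Longrightarrow> supp \<Gamma> (x \<otimes> y) \<subseteq> supp \<Gamma> x \<union> supp \<Gamma> y"
    and supp_inv: "x \<in> carrier \<Gamma> \<Longrightarrow> supp \<Gamma> (inv x) \<subseteq> supp \<Gamma> x"
    and nhd_split: "nhd_of_one \<Gamma> V \<Longrightarrow> \<exists>V'. nhd_of_one \<Gamma> V' \<and>
      (\<forall>A B x. openin (top_of_set circle) A \<and> openin (top_of_set circle) B \<and> A \<inter> B = {} \<and>
        x \<in> V' \<and> supp \<Gamma> x \<subseteq> A \<union> B \<longrightarrow>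
        (\<exists>y\<in>V \<inter> localized \<Gamma> A. \<exists>z\<in>V \<inter> localized \<Gamma> B. x = y \<otimes> z))"
begin

abbreviation Loc :: "complex set \<Rightarrow> 'x set" where "Loc \<equiv> localized \<Gamma>"

lemma localized_carrier: "x \<in> Loc J \<Longrightarrow> x \<in> carrier \<Gamma>"
  by (simp add: localized_def)

lemma localized_mult: "x \<in> Loc J \<Longrightarrow> y \<in> Loc J \<Longrightarrow> x \<otimes> y \<in> Loc J"
  using supp_mult[of x y] by (auto simp: localized_def)

lemma localized_inv: "x \<in> Loc J \<Longrightarrow> inv x \<in> Loc J"
  using supp_inv[of x] by (auto simp: localized_def)

lemma localized_mono: "x \<in> Loc J \<Longrightarrow> J \<subseteq> K \<Longrightarrow> x \<in> Loc K"
  by (auto simp: localized_def)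

lemma localized_Int: "x \<in> Loc J \<Longrightarrow> x \<in> Loc K \<Longrightarrow> x \<in> Loc (J \<inter> K)"
  by (simp add: localized_def)

end

text \<open>The combinatorics of the three arcs, freed of angles: any two of them lie in a common
  proper interval, and the empty triple intersection makes the two overlaps of each arc
  disjoint.\<close>

definition interval_cover :: "(nat \<Rightarrow> complex set) \<Rightarrow> bool" where
  "interval_cover I \<longleftrightarrow> (\<forall>j\<in>{1,2,3}. I j \<in> circle_intervals) \<and>
     (\<forall>i\<in>{1,2,3}. \<forall>j\<in>{1,2,3}. i \<noteq> j \<longrightarrow> I i \<inter> I j \<in> circle_intervals \<and> I i \<union> I j \<in> circle_intervals) \<and>
     I 1 \<inter> I 2 \<inter> I 3 = {}"

text \<open>The target carries just an associative operation, since its elements will be sets of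
  pairs of operators, among which nothing can be cancelled. All inverses are therefore formed in
  \<open>\<Gamma>\<close>.\<close>

locale local_precosheaf_hom = localizable_group \<Gamma> for \<Gamma> :: "('x, 'm) supp_group_scheme" (structure) +
  fixes mul :: "'q \<Rightarrow> 'q \<Rightarrow> 'q" (infixl "\<star>" 70)
    and P :: "complex set \<Rightarrow> 'x \<Rightarrow> 'q" and W N :: "'x set" and I :: "nat \<Rightarrow> complex set"
    and \<Xi> :: "nat \<Rightarrow> 'x \<Rightarrow> 'x"
  assumes mul_assoc: "a \<star> b \<star> c = a \<star> (b \<star> c)"
    and cover: "interval_cover I"
    and frag: "fragmentation \<Gamma> I N \<Xi>"
    and W: "nhd_of_one \<Gamma> W"
    and P_mult: "\<lbrakk>J \<in> circle_intervals; x \<in> W \<inter> Loc J; y \<in> W \<inter> Loc J; x \<otimes> y \<in> W\<rbrakk>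
      \<Longrightarrow> P J (x \<otimes> y) = P J x \<star> P J y"
    and P_mono: "\<lbrakk>J \<in> circle_intervals; K \<in> circle_intervals; J \<subseteq> K; x \<in> W \<inter> Loc J\<rbrakk>
      \<Longrightarrow> P K x = P J x"
begin

definition triple :: "'x \<Rightarrow> 'x \<Rightarrow> 'x \<Rightarrow> 'q" where
  "triple x y z = P (I 1) x \<star> P (I 2) y \<star> P (I 3) z"

definition frag_val :: "'x \<Rightarrow> 'q" where
  "frag_val x = triple (\<Xi> 1 x) (\<Xi> 2 x) (\<Xi> 3 x)"

text \<open>One unit of room: after any single product, inversion, splitting or fragmentation,
  elements of \<open>V'\<close> are still in \<open>V\<close>.\<close>

definition shrinks :: "'x set \<Rightarrow> 'x set \<Rightarrow> bool" where
  "shrinks V V' \<longleftrightarrow> nhd_of_one \<Gamma> V' \<and> V' \<subseteq> V \<and> V' \<subseteq> N \<and> (\<forall>x\<in>V'. \<forall>y\<in>V'. x \<otimes> y \<in> V) \<and> (\<forall>x\<in>V'. inv x \<in> V) \<and>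
     (\<forall>A B x. openin (top_of_set circle) A \<and> openin (top_of_set circle) B \<and> A \<inter> B = {} \<and>
        x \<in> V' \<and> supp \<Gamma> x \<subseteq> A \<union> B \<longrightarrow>
        (\<exists>y\<in>V \<inter> Loc A. \<exists>z\<in>V \<inter> Loc B. x = y \<otimes> z)) \<and>
     (\<forall>x\<in>V'. \<Xi> 1 x \<in> V \<and> \<Xi> 2 x \<in> V \<and> \<Xi> 3 x \<in> V)"

lemma shrinksD:
  assumes "shrinks V V'"
  shows "nhd_of_one \<Gamma> V'" "V' \<subseteq> V" "V' \<subseteq> N" "x \<in> V' \<Longrightarrow> y \<in> V' \<Longrightarrow> x \<otimes> y \<in> V" "x \<in> V' \<Longrightarrow> inv x \<in> V"
    "x \<in> V' \<Longrightarrow> \<Xi> 1 x \<in> V" "x \<in> V' \<Longrightarrow> \<Xi> 2 x \<in> V" "x \<in> V' \<Longrightarrow> \<Xi> 3 x \<in> V"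
  using assms unfolding shrinks_def by simp_all

lemma shrinks_exists:
  assumes V: "nhd_of_one \<Gamma> V"
  shows "\<exists>V'. shrinks V V'"
proof -
  obtain V1 where V1: "nhd_of_one \<Gamma> V1" "\<forall>x\<in>V1. \<forall>y\<in>V1. x \<otimes> y \<in> V" using nhd_mult[OF V] by blast
  obtain V2 where V2: "nhd_of_one \<Gamma> V2" "\<forall>x\<in>V2. inv x \<in> V" using nhd_inv[OF V] by blast
  obtain V3 where V3: "nhd_of_one \<Gamma> V3" and V3': "\<forall>A B x. openin (top_of_set circle) A \<and> openin (top_of_set circle) B \<and> A \<inter> B = {} \<and>
        x \<in> V3 \<and> supp \<Gamma> x \<subseteq> A \<union> B \<longrightarrow>
        (\<exists>y\<in>V \<inter> Loc A. \<exists>z\<in>V \<inter> Loc B. x = y \<otimes> z)" using nhd_split[OF V] by blast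
  have N: "nhd_of_one \<Gamma> N" by (rule fragmentationD(1)[OF frag])
  have pre: "nhd_of_one \<Gamma> {x \<in> N. \<Xi> j x \<in> V}" if "j \<in> {1,2,3}" for j
    using fragmentationD(2,3)[OF frag] that by (intro nhd_of_one_preimage V N) auto
  let ?V = "V \<inter> N \<inter> V1 \<inter> V2 \<inter> V3 \<inter> {x \<in> N. \<Xi> 1 x \<in> V} \<inter> {x \<in> N. \<Xi> 2 x \<in> V} \<inter> {x \<in> N. \<Xi> 3 x \<in> V}"
  have "nhd_of_one \<Gamma> ?V"
    by (intro nhd_of_one_Int V N V1 V2 V3 pre) simp_all
  then have "shrinks V ?V"
    unfolding shrinks_def using V1(2) V2(2) V3' by (intro conjI) (blast | meson)+
  then show ?thesis by blast
qed

lemma chain_exists: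
  assumes V: "nhd_of_one \<Gamma> V"
  shows "\<exists>C. C 0 = V \<and> (\<forall>n. shrinks (C n) (C (Suc n)))"
proof -
  have "\<exists>C. \<forall>n. (nhd_of_one \<Gamma> (C n) \<and> (n = 0 \<longrightarrow> C n = V)) \<and> shrinks (C n) (C (Suc n))"
  proof (rule dependent_nat_choice)
    show "\<exists>x. nhd_of_one \<Gamma> x \<and> (0 = 0 \<longrightarrow> x = V)" using V by blast
    show "\<exists>y. (nhd_of_one \<Gamma> y \<and> (Suc n = 0 \<longrightarrow> y = V)) \<and> shrinks x y"
      if "nhd_of_one \<Gamma> x \<and> (n = 0 \<longrightarrow> x = V)" for x n
      using shrinks_exists[of x] that shrinksD(1) by blast
  qed
  then show ?thesis by blast
qed

end

text \<open>An element of \<open>C n\<close> admits \<open>n\<close> successive operations before it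
  can leave \<open>C 0\<close>, inside which \<open>P\<close> is defined. The numerals in the proofs
  below keep this account.\<close>

locale local_precosheaf_chain = local_precosheaf_hom +
  fixes C :: "nat \<Rightarrow> 'a set"
  assumes C0: "C 0 \<subseteq> W" and C: "shrinks (C n) (C (Suc n))"
begin

lemma C_nhd: "nhd_of_one \<Gamma> (C (Suc n))"
  by (rule shrinksD(1)[OF C])

lemma C_antimono: "m \<le> n \<Longrightarrow> C n \<subseteq> C m"
  by (rule lift_Suc_antimono_le[of C]) (rule shrinksD(2)[OF C])

lemma C_down: "x \<in> C n \<Longrightarrow> m \<le> n \<Longrightarrow> x \<in> C m"
  using C_antimono by blast

lemma C_W: "x \<in> C n \<Longrightarrow> x \<in> W"
  using C_antimono[of 0 n] C0 by blast

lemma C_carrier: "x \<in> C n \<Longrightarrow> x \<in> carrier \<Gamma>"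
  using C_W W unfolding nhd_of_one_def by blast

lemma C_mult: "x \<in> C (Suc n) \<Longrightarrow> y \<in> C (Suc n) \<Longrightarrow> x \<otimes> y \<in> C n"
  by (rule shrinksD(4)[OF C])

lemma C_inv: "x \<in> C (Suc n) \<Longrightarrow> inv x \<in> C n"
  by (rule shrinksD(5)[OF C])

abbreviation CL :: "nat \<Rightarrow> nat \<Rightarrow> 'a set" where "CL n j \<equiv> C n \<inter> Loc (I j)"

lemma C_\<Xi>:
  assumes "x \<in> C (Suc n)"
  shows "\<Xi> 1 x \<in> CL n 1" "\<Xi> 2 x \<in> CL n 2"
    "\<Xi> 3 x \<in> CL n 3" "\<Xi> 1 x \<otimes> \<Xi> 2 x \<otimes> \<Xi> 3 x = x"
proof -
  have N: "x \<in> N" and C': "\<Xi> 1 x \<in> C n" "\<Xi> 2 x \<in> C n" "\<Xi> 3 x \<in> C n"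
    using shrinksD[OF C[of n]] assms by blast+
  have l: "\<Xi> j x \<in> Loc (I j)" if "j \<in> {1,2,3}" for j
    by (rule bspec[OF bspec[OF fragmentationD(4)[OF frag] that] N])
  show "\<Xi> 1 x \<in> CL n 1" "\<Xi> 2 x \<in> CL n 2"
    "\<Xi> 3 x \<in> CL n 3"
    using C' l[of 1] l[of 2] l[of 3] by simp_all
  show "\<Xi> 1 x \<otimes> \<Xi> 2 x \<otimes> \<Xi> 3 x = x"
    by (rule bspec[OF fragmentationD(5)[OF frag] N, symmetric])
qed

section \<open>Comparison of evaluations in different intervals\<close>

lemma interval_open: "J \<in> circle_intervals \<Longrightarrow> openin (top_of_set circle) J"
  by (simp add: circle_intervals_def)

lemma I_interval: "j \<in> {1,2,3} \<Longrightarrow> I j \<in> circle_intervals"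
  and I_Int: "i \<in> {1,2,3} \<Longrightarrow> j \<in> {1,2,3} \<Longrightarrow> i \<noteq> j \<Longrightarrow> I i \<inter> I j \<in> circle_intervals"
  and I_Un: "i \<in> {1,2,3} \<Longrightarrow> j \<in> {1,2,3} \<Longrightarrow> i \<noteq> j \<Longrightarrow> I i \<union> I j \<in> circle_intervals"
  and I_empty: "I 1 \<inter> I 2 \<inter> I 3 = {}"
  using cover unfolding interval_cover_def by blast+

lemma C_P_mult:
  assumes "J \<in> circle_intervals" "x \<in> C (Suc n)" "y \<in> C (Suc n)" "x \<in> Loc J" "y \<in> Loc J"
  shows "P J (x \<otimes> y) = P J x \<star> P J y"
  using assms C_mult[of x n y] C_W by (intro P_mult) blast+

text \<open>Two proper intervals may meet in two components; splitting \<open>x\<close> accordingly makes up for the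
  lack of a common subinterval.\<close>

lemma P_consistent:
  assumes A: "A \<in> circle_intervals" and B: "B \<in> circle_intervals" and AB: "A \<inter> B = {}"
    and J: "J \<in> circle_intervals" and K: "K \<in> circle_intervals"
    and sub: "A \<union> B \<subseteq> J \<inter> K" and x: "x \<in> C (Suc 0)" "x \<in> Loc (A \<union> B)"
  shows "P J x = P K x"
proof -
  have "openin (top_of_set circle) A \<and> openin (top_of_set circle) B \<and> A \<inter> B = {} \<and>
        x \<in> C (Suc 0) \<and> supp \<Gamma> x \<subseteq> A \<union> B"
    using A B AB x interval_open unfolding localized_def by blast
  then obtain y z where y: "y \<in> C 0 \<inter> Loc A" and z: "z \<in> C 0 \<inter> Loc B" and xyz: "x = y \<otimes> z"
    using C[of 0] unfolding shrinks_def by blast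
  have "P L x = P A y \<star> P B z" if L: "L \<in> circle_intervals" "A \<union> B \<subseteq> L" for L
  proof -
    have "P L x = P L y \<star> P L z" unfolding xyz
      using y z L x C_W xyz localized_mono[of y A L] localized_mono[of z B L] by (intro P_mult) auto
    moreover have "P L y = P A y" using y L C_W by (intro P_mono A) auto
    moreover have "P L z = P B z" using z L C_W by (intro P_mono B) auto
    ultimately show ?thesis by simp
  qed
  then show ?thesis using J K sub by simp
qed

text \<open>The support lies in the union of \<open>I i \<inter> I j\<close> and
  \<open>I i \<inter> I k\<close>, which are disjoint because no point is in all three intervals; so
  \<open>P_consistent\<close> applies.\<close>

lemma P_consistent_I:
  assumes ijk: "i \<in> {1,2,3}" "j \<in> {1,2,3}" "k \<in> {1,2,3}" "i \<noteq> j" "i \<noteq> k" "j \<noteq> k" and x: "x \<in> C (Suc 0)" "x \<in> Loc (I i)" "x \<in> Loc (I j \<union> I k)"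
  shows "P (I i) x = P (I j \<union> I k) x"
proof -
  have e: "I i \<inter> I j \<inter> I k = {}"
    using I_empty ijk by auto
  show ?thesis
  proof (rule P_consistent[of "I i \<inter> I j" "I i \<inter> I k"])
    show "x \<in> Loc (I i \<inter> I j \<union> I i \<inter> I k)"
      using localized_Int[OF x(2,3)] by (simp add: Int_Un_distrib)
  qed (use ijk e x in \<open>auto intro!: I_Int I_Un I_interval\<close>)
qed

text \<open>The triples cannot be divided by each other in the target. Instead
  \<open>g1 = h1 \<otimes> x\<close> and \<open>h3 = y \<otimes> g3\<close> reduce the claim to one
  identity for \<open>x \<otimes> g2 = h2 \<otimes> y\<close>, evaluated in two unions, after which
  the outer letters are multiplied back. Level 4 pays for an inverse, for the products
  \<open>x\<close> and \<open>y\<close>, for \<open>x \<otimes> g2\<close>, and for one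
  splitting.\<close>

lemma triple_independent:
  assumes g: "g1 \<in> CL 4 1" "g2 \<in> CL 4 2" "g3 \<in> CL 4 3"
    and h: "h1 \<in> CL 4 1" "h2 \<in> CL 4 2" "h3 \<in> CL 4 3"
    and eq: "g1 \<otimes> g2 \<otimes> g3 = h1 \<otimes> h2 \<otimes> h3"
  shows "triple g1 g2 g3 = triple h1 h2 h3"
proof -
  have car: "g1 \<in> carrier \<Gamma>" "g2 \<in> carrier \<Gamma>" "g3 \<in> carrier \<Gamma>" "h1 \<in> carrier \<Gamma>" "h2 \<in> carrier \<Gamma>" "h3 \<in> carrier \<Gamma>"
    using g h localized_carrier by auto
  define x where "x = inv h1 \<otimes> g1"
  define y where "y = h3 \<otimes> inv g3"
  have C3: "inv h1 \<in> C 3" "inv g3 \<in> C 3" "g1 \<in> C 3" "h3 \<in> C 3"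
    using C_inv[of h1 3] C_inv[of g3 3] C_down[of _ 4 3] g h by (auto simp: numeral_eq_Suc)
  have x: "x \<in> C 2" "x \<in> Loc (I 1)" and y: "y \<in> C 2" "y \<in> Loc (I 3)"
    using C_mult[of _ 2] C3 g h localized_mult localized_inv unfolding x_def y_def
    by (auto simp: numeral_eq_Suc)
  have g2: "g2 \<in> C 2" and h2: "h2 \<in> C 2" using C_down[of _ 4 2] g h by auto
  have hx: "h1 \<otimes> x = g1" and yg: "y \<otimes> g3 = h3"
    using car by (simp_all add: x_def y_def m_assoc m_assoc[symmetric])
  have z: "x \<otimes> g2 = h2 \<otimes> y"
  proof -
    have "h1 \<otimes> (x \<otimes> g2) \<otimes> g3 = h1 \<otimes> (h2 \<otimes> y) \<otimes> g3"
      using eq car hx yg localized_carrier[OF x(2)] localized_carrier[OF y(2)] by (metis m_assoc m_closed)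
    then show ?thesis using car localized_carrier[OF x(2)] localized_carrier[OF y(2)] by simp
  qed
  have z12: "x \<otimes> g2 \<in> Loc (I 1 \<union> I 2)"
    using x g by (intro localized_mult) (auto elim: localized_mono)
  have z23: "x \<otimes> g2 \<in> Loc (I 2 \<union> I 3)"
    unfolding z using y h by (intro localized_mult) (auto elim: localized_mono)
  have zC: "x \<otimes> g2 \<in> C (Suc 0)" using C_mult[of x 1 g2] x g2 by (simp add: numeral_eq_Suc)
  have zz: "x \<otimes> g2 \<in> Loc (I 2 \<union> I 1 \<inter> I 3)"
    using localized_Int[OF z12 z23] by (rule localized_mono) blast
  have "P (I 1 \<union> I 2) (x \<otimes> g2) = P (I 2 \<union> I 3) (x \<otimes> g2)"
    by (rule P_consistent[of "I 2" "I 1 \<inter> I 3"])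
      (use I_empty zC zz in \<open>auto intro!: I_Int I_Un I_interval\<close>)
  moreover have "P (I 1 \<union> I 2) (x \<otimes> g2) = P (I 1) x \<star> P (I 2) g2"
  proof -
    have "P (I 1 \<union> I 2) (x \<otimes> g2) = P (I 1 \<union> I 2) x \<star> P (I 1 \<union> I 2) g2"
      using x g g2 I_Un[of 1 2] by (intro C_P_mult[of _ _ 1]) (auto simp: numeral_eq_Suc elim: localized_mono)
    moreover have "P (I 1 \<union> I 2) x = P (I 1) x" by (rule P_mono) (use x C_W I_Un[of 1 2] I_interval in auto)
    moreover have "P (I 1 \<union> I 2) g2 = P (I 2) g2" by (rule P_mono) (use g C_W I_Un[of 1 2] I_interval in auto)
    ultimately show ?thesis by simp
  qed
  moreover have "P (I 2 \<union> I 3) (h2 \<otimes> y) = P (I 2) h2 \<star> P (I 3) y"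
  proof -
    have "P (I 2 \<union> I 3) (h2 \<otimes> y) = P (I 2 \<union> I 3) h2 \<star> P (I 2 \<union> I 3) y"
      using y h h2 I_Un[of 2 3] by (intro C_P_mult[of _ _ 1]) (auto simp: numeral_eq_Suc elim: localized_mono)
    moreover have "P (I 2 \<union> I 3) y = P (I 3) y" by (rule P_mono) (use y C_W I_Un[of 2 3] I_interval in auto)
    moreover have "P (I 2 \<union> I 3) h2 = P (I 2) h2" by (rule P_mono) (use h C_W I_Un[of 2 3] I_interval in auto)
    ultimately show ?thesis by simp
  qed
  ultimately have mid: "P (I 1) x \<star> P (I 2) g2 = P (I 2) h2 \<star> P (I 3) y" using z by simp
  have h1x: "P (I 1) h1 \<star> P (I 1) x = P (I 1) g1"
    using C_P_mult[of "I 1" h1 1 x] x h C_down[of h1 4 2] I_interval[of 1] unfolding hx by (simp add: numeral_eq_Suc)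
  have yg3: "P (I 3) y \<star> P (I 3) g3 = P (I 3) h3"
    using C_P_mult[of "I 3" y 1 g3] y g C_down[of g3 4 2] I_interval[of 3] unfolding yg by (simp add: numeral_eq_Suc)
  show ?thesis unfolding triple_def h1x[symmetric] yg3[symmetric] using mid by (metis mul_assoc)
qed

text \<open>The remaining letter \<open>g l\<close> is a product of \<open>\<gamma>\<close> and the
  other two letters and their inverses, so it too is supported in \<open>I i \<union> I j\<close>.
  Its value may then be computed there by \<open>P_consistent_I\<close>, and the whole word is
  multiplied inside one interval.\<close>

lemma triple_Un:
  assumes g: "g1 \<in> CL 3 1" "g2 \<in> CL 3 2" "g3 \<in> CL 3 3"
    and \<gamma>: "g1 \<otimes> g2 \<otimes> g3 = \<gamma>" "\<gamma> \<in> Loc (I i \<union> I j)"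
    and ij: "i \<in> {1,2,3}" "j \<in> {1,2,3}" "i \<noteq> j"
  shows "triple g1 g2 g3 = P (I i \<union> I j) \<gamma>"
proof -
  let ?K = "I i \<union> I j"
  define g where "g n = (if n = 1 then g1 else if n = 2 then g2 else g3)" for n :: nat
  have gn: "g n \<in> C 3" "g n \<in> Loc (I n)" "g n \<in> carrier \<Gamma>" if "n \<in> {1,2,3}" for n
    using that g localized_carrier by (auto simp: g_def)
  have K: "?K \<in> circle_intervals" using I_Un ij by blast
  have "\<exists>l\<in>{1,2,3}. l \<noteq> i \<and> l \<noteq> j" using ij by auto
  then obtain l where l: "l \<in> {1,2,3}" "l \<noteq> i" "l \<noteq> j" by blast
  have n_cases: "n = l \<or> n = i \<or> n = j" if "n \<in> {1,2,3}" for n using that l ij by auto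
  have car: "g1 \<in> carrier \<Gamma>" "g2 \<in> carrier \<Gamma>" "g3 \<in> carrier \<Gamma>" "\<gamma> \<in> carrier \<Gamma>"
    using g \<gamma> localized_carrier by auto
  have loc: "g n \<in> Loc ?K" if "n \<in> {i, j}" for n
    using gn(2)[of n] that ij by (auto elim: localized_mono)
  have loc_l: "g l \<in> Loc ?K"
  proof -
    consider "l = 1" | "l = 2" | "l = 3" using l by blast
    then show ?thesis
    proof cases
      case 1
      then have "g2 \<in> Loc ?K" "g3 \<in> Loc ?K" using n_cases[of 2] n_cases[of 3] loc[of 2] loc[of 3] by (auto simp: g_def)
      moreover have "g1 = \<gamma> \<otimes> inv (g2 \<otimes> g3)" using car \<gamma>(1) by (metis inv_solve_right m_assoc m_closed)
      ultimately show ?thesis using 1 \<gamma>(2) by (simp add: g_def localized_mult localized_inv)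
    next
      case 2
      then have "g1 \<in> Loc ?K" "g3 \<in> Loc ?K" using n_cases[of 1] n_cases[of 3] loc[of 1] loc[of 3] by (auto simp: g_def)
      moreover have "g2 = inv g1 \<otimes> (\<gamma> \<otimes> inv g3)"
        using car \<gamma>(1) by (metis inv_closed inv_solve_left inv_solve_right m_closed)
      ultimately show ?thesis using 2 \<gamma>(2) by (simp add: g_def localized_mult localized_inv)
    next
      case 3
      then have "g1 \<in> Loc ?K" "g2 \<in> Loc ?K" using n_cases[of 1] n_cases[of 2] loc[of 1] loc[of 2] by (auto simp: g_def)
      moreover have "g3 = inv (g1 \<otimes> g2) \<otimes> \<gamma>" using car \<gamma>(1) by (metis inv_solve_left m_closed)
      ultimately show ?thesis using 3 \<gamma>(2) by (simp add: g_def localized_mult localized_inv)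
    qed
  qed
  have locK: "g n \<in> Loc ?K" if "n \<in> {1,2,3}" for n
    using loc loc_l n_cases[OF that] by blast
  have PK: "P (I n) (g n) = P ?K (g n)" if n: "n \<in> {1,2,3}" for n
  proof (cases "n = l")
    case True
    then show ?thesis
      using P_consistent_I[of l i j "g l"] l ij gn[of l] loc_l C_down[of "g l" 3 "Suc 0"] by auto
  next
    case False
    then have "n \<in> {i, j}" using n_cases[OF n] by blast
    then have "I n \<subseteq> ?K" by blast
    then show ?thesis using P_mono[of "I n" ?K "g n"] K I_interval[OF n] gn[OF n] C_W by auto
  qed
  have "triple g1 g2 g3 = P ?K g1 \<star> P ?K g2 \<star> P ?K g3"
    using PK[of 1] PK[of 2] PK[of 3] by (simp add: triple_def g_def)
  also have "P ?K g1 \<star> P ?K g2 = P ?K (g1 \<otimes> g2)"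
    using C_P_mult[of ?K g1 2 g2] g K locK[of 1] locK[of 2] by (simp add: g_def numeral_eq_Suc)
  also have "\<dots> \<star> P ?K g3 = P ?K (g1 \<otimes> g2 \<otimes> g3)"
  proof (rule C_P_mult[of ?K _ 1, symmetric])
    show "g1 \<otimes> g2 \<in> C (Suc 1)" using C_mult[of g1 2 g2] g by (simp add: numeral_eq_Suc)
    show "g3 \<in> C (Suc 1)" using C_down[of g3 3 2] g by (simp add: numeral_eq_Suc)
    show "g1 \<otimes> g2 \<in> Loc ?K" "g3 \<in> Loc ?K"
      using locK[of 1] locK[of 2] locK[of 3] by (auto simp: g_def intro: localized_mult)
  qed (rule K)
  finally show ?thesis using \<gamma> by simp
qed

text \<open>The reordering move: whatever order of letters produced \<open>\<gamma>\<close> inside a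
  union of two intervals, its value reappears as a triple in the order 1, 2, 3.\<close>

lemma P_Un_triple:
  assumes "\<gamma> \<in> C (Suc n)" "3 \<le> n" "\<gamma> \<in> Loc (I i \<union> I j)" "i \<in> {1,2,3}" "j \<in> {1,2,3}" "i \<noteq> j"
  shows "P (I i \<union> I j) \<gamma> = frag_val \<gamma>"
  unfolding frag_val_def
proof (rule triple_Un[OF _ _ _ C_\<Xi>(4)[OF assms(1)] assms(3-6), symmetric])
  show "\<Xi> 1 \<gamma> \<in> CL 3 1" "\<Xi> 2 \<gamma> \<in> CL 3 2"
    "\<Xi> 3 \<gamma> \<in> CL 3 3"
    using C_\<Xi>(1-3)[OF assms(1)] C_down[OF _ assms(2)] by simp_all
qed

lemma P_mult_Un:
  assumes "x \<in> C (Suc n)" "y \<in> C (Suc n)" "x \<in> Loc (I i)" "y \<in> Loc (I j)"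
    "i \<in> {1,2,3}" "j \<in> {1,2,3}" "i \<noteq> j"
  shows "P (I i) x \<star> P (I j) y = P (I i \<union> I j) (x \<otimes> y)" "x \<otimes> y \<in> Loc (I i \<union> I j)"
proof -
  have K: "I i \<union> I j \<in> circle_intervals" using I_Un assms by blast
  have xy: "x \<in> Loc (I i \<union> I j)" "y \<in> Loc (I i \<union> I j)"
    using assms by (auto elim: localized_mono)
  have "P (I i \<union> I j) x = P (I i) x" "P (I i \<union> I j) y = P (I j) y"
    using assms K I_interval C_W by (auto intro!: P_mono)
  then show "P (I i) x \<star> P (I j) y = P (I i \<union> I j) (x \<otimes> y)"
    using C_P_mult[OF K assms(1,2) xy] by simp
  show "x \<otimes> y \<in> Loc (I i \<union> I j)" using xy by (rule localized_mult)
qed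

lemma P_Un_mult:
  assumes "x \<in> C (Suc n)" "y \<in> C (Suc n)" "x \<in> Loc (I i \<union> I j)" "y \<in> Loc (I k)"
    "i \<in> {1,2,3}" "j \<in> {1,2,3}" "i \<noteq> j" "k \<in> {i, j}"
  shows "P (I i \<union> I j) x \<star> P (I k) y = P (I i \<union> I j) (x \<otimes> y)" "x \<otimes> y \<in> Loc (I i \<union> I j)"
proof -
  have K: "I i \<union> I j \<in> circle_intervals" using I_Un assms by blast
  have y: "y \<in> Loc (I i \<union> I j)"
    using assms by (auto elim: localized_mono)
  have "P (I i \<union> I j) y = P (I k) y"
    using assms K I_interval C_W by (auto intro!: P_mono)
  then show "P (I i \<union> I j) x \<star> P (I k) y = P (I i \<union> I j) (x \<otimes> y)"
    using C_P_mult[OF K assms(1,2,3) y] by simp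
  show "x \<otimes> y \<in> Loc (I i \<union> I j)" using assms(3) y by (rule localized_mult)
qed

text \<open>Each bracket is a word in at most two intervals, evaluated there and fragmented again:
  \<open>g1 g2 [g3 e1] e2 e3\<close>, then \<open>g1 [g2 h1 h2] h3 e2 e3\<close>, then
  \<open>g1 k1 [k2 k3 h3 e2 e3]\<close>, then \<open>[g1 k1 l1] l2 l3\<close>. The last bracket lies
  in \<open>I 1\<close> alone and is simply multiplied. Four fragmentations and the products in
  between lead from level 20 down to level 8, while \<open>triple_independent\<close>, which
  finishes the proof, asks for 4.\<close>

lemma triple_mult:
  assumes \<gamma>: "\<gamma> \<in> C 20" and \<eta>: "\<eta> \<in> C 20"
  shows "frag_val \<gamma> \<star> frag_val \<eta>
    = frag_val (\<gamma> \<otimes> \<eta>)"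
proof -
  note down = C_down
  obtain g1 g2 g3 where gdef: "g1 = \<Xi> 1 \<gamma>" "g2 = \<Xi> 2 \<gamma>" "g3 = \<Xi> 3 \<gamma>" by blast
  obtain e1 e2 e3 where edef: "e1 = \<Xi> 1 \<eta>" "e2 = \<Xi> 2 \<eta>" "e3 = \<Xi> 3 \<eta>" by blast
  have g: "g1 \<in> CL 19 1" "g2 \<in> CL 19 2" "g3 \<in> CL 19 3"
    and g': "g1 \<otimes> g2 \<otimes> g3 = \<gamma>"
    using C_\<Xi>[of \<gamma> 19] \<gamma> by (auto simp: gdef)
  have e: "e1 \<in> CL 19 1" "e2 \<in> CL 19 2" "e3 \<in> CL 19 3"
    and e': "e1 \<otimes> e2 \<otimes> e3 = \<eta>"
    using C_\<Xi>[of \<eta> 19] \<eta> by (auto simp: edef)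
  define u where "u = g3 \<otimes> e1"
  have u: "u \<in> C 18" "u \<in> Loc (I 3 \<union> I 1)" "P (I 3) g3 \<star> P (I 1) e1 = P (I 3 \<union> I 1) u"
    using C_mult[of g3 18 e1] P_mult_Un[of g3 18 e1 3 1] g e by (auto simp: u_def)
  obtain h1 h2 h3 where hdef: "h1 = \<Xi> 1 u" "h2 = \<Xi> 2 u" "h3 = \<Xi> 3 u" by blast
  have h: "h1 \<in> CL 17 1" "h2 \<in> CL 17 2" "h3 \<in> CL 17 3"
    and h': "h1 \<otimes> h2 \<otimes> h3 = u"
    using C_\<Xi>[of u 17] u by (auto simp: hdef)
  have Pu: "P (I 3 \<union> I 1) u = triple h1 h2 h3"
    using P_Un_triple[of u 17 3 1] u by (simp add: hdef frag_val_def)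
  define v where "v = g2 \<otimes> h1 \<otimes> h2"
  have gh: "g2 \<otimes> h1 \<in> C 16" "g2 \<otimes> h1 \<in> Loc (I 2 \<union> I 1)"
    "P (I 2) g2 \<star> P (I 1) h1 = P (I 2 \<union> I 1) (g2 \<otimes> h1)"
    using C_mult[of g2 16 h1] P_mult_Un[of g2 16 h1 2 1] g h down[of g2 19 17] by auto
  have v: "v \<in> C 15" "v \<in> Loc (I 2 \<union> I 1)"
    "P (I 2) g2 \<star> P (I 1) h1 \<star> P (I 2) h2 = P (I 2 \<union> I 1) v"
    using C_mult[of "g2 \<otimes> h1" 15 h2] P_Un_mult[of "g2 \<otimes> h1" 15 h2 2 1 2] gh h down[of h2 17 16]
    by (auto simp: v_def)
  obtain k1 k2 k3 where kdef: "k1 = \<Xi> 1 v" "k2 = \<Xi> 2 v" "k3 = \<Xi> 3 v" by blast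
  have k: "k1 \<in> CL 14 1" "k2 \<in> CL 14 2" "k3 \<in> CL 14 3"
    and k': "k1 \<otimes> k2 \<otimes> k3 = v"
    using C_\<Xi>[of v 14] v by (auto simp: kdef)
  have Pv: "P (I 2 \<union> I 1) v = triple k1 k2 k3"
    using P_Un_triple[of v 14 2 1] v by (simp add: kdef frag_val_def)
  define w where "w = k2 \<otimes> k3 \<otimes> h3 \<otimes> e2 \<otimes> e3"
  have w1: "k2 \<otimes> k3 \<in> C 13" "k2 \<otimes> k3 \<in> Loc (I 2 \<union> I 3)"
    "P (I 2) k2 \<star> P (I 3) k3 = P (I 2 \<union> I 3) (k2 \<otimes> k3)"
    using C_mult[of k2 13 k3] P_mult_Un[of k2 13 k3 2 3] k by auto
  have w2: "k2 \<otimes> k3 \<otimes> h3 \<in> C 12" "k2 \<otimes> k3 \<otimes> h3 \<in> Loc (I 2 \<union> I 3)"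
    "P (I 2) k2 \<star> P (I 3) k3 \<star> P (I 3) h3 = P (I 2 \<union> I 3) (k2 \<otimes> k3 \<otimes> h3)"
    using C_mult[of "k2 \<otimes> k3" 12 h3] P_Un_mult[of "k2 \<otimes> k3" 12 h3 2 3 3] w1 h down[of h3 17 13] by auto
  have w3: "k2 \<otimes> k3 \<otimes> h3 \<otimes> e2 \<in> C 11" "k2 \<otimes> k3 \<otimes> h3 \<otimes> e2 \<in> Loc (I 2 \<union> I 3)"
    "P (I 2) k2 \<star> P (I 3) k3 \<star> P (I 3) h3 \<star> P (I 2) e2 = P (I 2 \<union> I 3) (k2 \<otimes> k3 \<otimes> h3 \<otimes> e2)"
    using C_mult[of "k2 \<otimes> k3 \<otimes> h3" 11 e2] P_Un_mult[of "k2 \<otimes> k3 \<otimes> h3" 11 e2 2 3 2] w2 e down[of e2 19 12] by auto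
  have w: "w \<in> C 10" "w \<in> Loc (I 2 \<union> I 3)"
    "P (I 2) k2 \<star> P (I 3) k3 \<star> P (I 3) h3 \<star> P (I 2) e2 \<star> P (I 3) e3 = P (I 2 \<union> I 3) w"
    using C_mult[of "k2 \<otimes> k3 \<otimes> h3 \<otimes> e2" 10 e3] P_Un_mult[of "k2 \<otimes> k3 \<otimes> h3 \<otimes> e2" 10 e3 2 3 3]
      w3 e down[of e3 19 11] by (auto simp: w_def)
  obtain l1 l2 l3 where ldef: "l1 = \<Xi> 1 w" "l2 = \<Xi> 2 w" "l3 = \<Xi> 3 w" by blast
  have l: "l1 \<in> CL 9 1" "l2 \<in> CL 9 2" "l3 \<in> CL 9 3"
    and l': "l1 \<otimes> l2 \<otimes> l3 = w"
    using C_\<Xi>[of w 9] w by (auto simp: ldef)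
  have Pw: "P (I 2 \<union> I 3) w = triple l1 l2 l3"
    using P_Un_triple[of w 9 2 3] w by (simp add: ldef frag_val_def)
  have gk: "g1 \<otimes> k1 \<in> C 13" "g1 \<otimes> k1 \<in> Loc (I 1)" "P (I 1) (g1 \<otimes> k1) = P (I 1) g1 \<star> P (I 1) k1"
    using C_mult[of g1 13 k1] C_P_mult[of "I 1" g1 13 k1] g k down[of g1 19 14] I_interval[of 1] localized_mult by auto
  have gkl: "g1 \<otimes> k1 \<otimes> l1 \<in> C 8" "g1 \<otimes> k1 \<otimes> l1 \<in> Loc (I 1)"
    "P (I 1) (g1 \<otimes> k1 \<otimes> l1) = P (I 1) g1 \<star> P (I 1) k1 \<star> P (I 1) l1"
    using C_mult[of "g1 \<otimes> k1" 8 l1] C_P_mult[of "I 1" "g1 \<otimes> k1" 8 l1] gk l down[of "g1 \<otimes> k1" 13 9] I_interval[of 1]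
      localized_mult by auto
  have car: "g1 \<in> carrier \<Gamma>" "g2 \<in> carrier \<Gamma>" "g3 \<in> carrier \<Gamma>" "e1 \<in> carrier \<Gamma>" "e2 \<in> carrier \<Gamma>" "e3 \<in> carrier \<Gamma>"
    "h1 \<in> carrier \<Gamma>" "h2 \<in> carrier \<Gamma>" "h3 \<in> carrier \<Gamma>" "k1 \<in> carrier \<Gamma>" "k2 \<in> carrier \<Gamma>" "k3 \<in> carrier \<Gamma>"
    "l1 \<in> carrier \<Gamma>" "l2 \<in> carrier \<Gamma>" "l3 \<in> carrier \<Gamma>"
    using g e h k l C_carrier by auto
  have "g1 \<otimes> k1 \<otimes> l1 \<otimes> l2 \<otimes> l3 = g1 \<otimes> k1 \<otimes> (l1 \<otimes> l2 \<otimes> l3)" using car by (simp add: m_assoc)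
  also have "\<dots> = g1 \<otimes> (k1 \<otimes> k2 \<otimes> k3) \<otimes> (h3 \<otimes> e2 \<otimes> e3)"
    unfolding l' w_def using car by (simp add: m_assoc)
  also have "\<dots> = g1 \<otimes> g2 \<otimes> (h1 \<otimes> h2 \<otimes> h3) \<otimes> (e2 \<otimes> e3)"
    unfolding k' v_def using car by (simp add: m_assoc)
  also have "\<dots> = g1 \<otimes> g2 \<otimes> g3 \<otimes> (e1 \<otimes> e2 \<otimes> e3)"
    unfolding h' u_def using car by (simp add: m_assoc)
  finally have prod: "g1 \<otimes> k1 \<otimes> l1 \<otimes> l2 \<otimes> l3 = \<gamma> \<otimes> \<eta>" unfolding g' e' .
  have "triple g1 g2 g3 \<star> triple e1 e2 e3
      = P (I 1) g1 \<star> (P (I 2) g2 \<star> ((P (I 3) g3 \<star> P (I 1) e1) \<star> (P (I 2) e2 \<star> P (I 3) e3)))"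
    unfolding triple_def by (simp only: mul_assoc)
  also have "\<dots> = P (I 1) g1 \<star> ((P (I 2) g2 \<star> P (I 1) h1 \<star> P (I 2) h2) \<star> (P (I 3) h3 \<star> (P (I 2) e2 \<star> P (I 3) e3)))"
    unfolding u(3) Pu triple_def by (simp only: mul_assoc)
  also have "\<dots> = P (I 1) g1 \<star> (P (I 1) k1 \<star> (P (I 2) k2 \<star> P (I 3) k3 \<star> P (I 3) h3 \<star> P (I 2) e2 \<star> P (I 3) e3))"
    unfolding v(3) Pv triple_def by (simp only: mul_assoc)
  also have "\<dots> = triple (g1 \<otimes> k1 \<otimes> l1) l2 l3"
    unfolding w(3) Pw triple_def gkl(3) by (simp only: mul_assoc)
  also have "\<dots> = frag_val (\<gamma> \<otimes> \<eta>)"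
  unfolding frag_val_def
  proof (rule triple_independent)
    have "\<gamma> \<otimes> \<eta> \<in> C 19" using C_mult[of \<gamma> 19 \<eta>] \<gamma> \<eta> by simp
    then have *: "\<gamma> \<otimes> \<eta> \<in> C (Suc 4)" by (rule down) simp
    show "\<Xi> 1 (\<gamma> \<otimes> \<eta>) \<in> CL 4 1" "\<Xi> 2 (\<gamma> \<otimes> \<eta>) \<in> CL 4 2"
      "\<Xi> 3 (\<gamma> \<otimes> \<eta>) \<in> CL 4 3"
      "g1 \<otimes> k1 \<otimes> l1 \<otimes> l2 \<otimes> l3 = \<Xi> 1 (\<gamma> \<otimes> \<eta>) \<otimes> \<Xi> 2 (\<gamma> \<otimes> \<eta>) \<otimes> \<Xi> 3 (\<gamma> \<otimes> \<eta>)"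
      using C_\<Xi>[OF *] prod by auto
    show "g1 \<otimes> k1 \<otimes> l1 \<in> CL 4 1" "l2 \<in> CL 4 2" "l3 \<in> CL 4 3"
      using gkl l down[of _ 8 4] down[of _ 9 4] by auto
  qed
  finally show ?thesis unfolding gdef edef frag_val_def .
qed

end

context local_precosheaf_hom
begin

text \<open>The clause \<open>g1 \<otimes> g2 \<in> W\<close> is recorded for the return from
  classes to operators: the phases \<open>c g1 g2\<close> and \<open>c (g1 \<otimes> g2) g3\<close>
  are controlled only for arguments and products in \<open>W\<close>.\<close>

theorem local_hom_from_fragments:
  assumes U: "nhd_of_one \<Gamma> U" "U \<subseteq> W"
  shows "\<exists>V. nhd_of_one \<Gamma> V \<and> V \<subseteq> U \<and>
    (\<forall>\<gamma>\<in>V. \<forall>g1\<in>V \<inter> Loc (I 1). \<forall>g2\<in>V \<inter> Loc (I 2). \<forall>g3\<in>V \<inter> Loc (I 3).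
      \<gamma> = g1 \<otimes> g2 \<otimes> g3 \<longrightarrow> frag_val \<gamma> = triple g1 g2 g3 \<and> g1 \<otimes> g2 \<in> W) \<and>
    (\<forall>\<gamma>\<in>V. \<forall>\<eta>\<in>V. frag_val \<gamma> \<star> frag_val \<eta>
      = frag_val (\<gamma> \<otimes> \<eta>))"
proof -
  obtain C where Ch: "C 0 = U" "\<And>n. shrinks (C n) (C (Suc n))" using chain_exists[OF U(1)] by blast
  interpret local_precosheaf_chain \<Gamma> mul P W N I \<Xi> C
    by unfold_locales (use Ch U in auto)
  have nhd: "nhd_of_one \<Gamma> (C 20)" using C_nhd[of 19] by simp
  have sub: "C 20 \<subseteq> U" using C_antimono[of 0 20] Ch(1) by simp
  have "frag_val \<gamma> = triple g1 g2 g3 \<and> g1 \<otimes> g2 \<in> W"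
    if "\<gamma> \<in> C 20" "g1 \<in> CL 20 1" "g2 \<in> CL 20 2"
      "g3 \<in> CL 20 3" "\<gamma> = g1 \<otimes> g2 \<otimes> g3" for \<gamma> g1 g2 g3
  proof
    show "frag_val \<gamma> = triple g1 g2 g3"
      unfolding frag_val_def using that C_\<Xi>[of \<gamma> 4] C_antimono[of 5 20] C_antimono[of 4 20]
      by (intro triple_independent) auto
    show "g1 \<otimes> g2 \<in> W" using C_mult[of g1 19 g2] C_W that by simp
  qed
  then show ?thesis using nhd sub triple_mult by (intro exI[of _ "C 20"]) blast
qed

end

section \<open>Arcs of the circle\<close>

lemma cis_eq_iff: "cis s = cis t \<longleftrightarrow> (\<exists>n::int. s = t + 2 * pi * of_int n)"
proof -
  have "cis s = cis t \<longleftrightarrow> exp (\<i> * of_real s) = exp (\<i> * of_real t)" by (simp add: cis_conv_exp)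
  also have "\<dots> \<longleftrightarrow> (\<exists>n::int. \<i> * complex_of_real s = \<i> * of_real t + complex_of_real (2 * of_int n * pi) * \<i>)"
    using exp_eq[of "\<i> * of_real s" "\<i> * of_real t"] by simp
  also have "\<dots> \<longleftrightarrow> (\<exists>n::int. s = t + 2 * pi * of_int n)"
    by (intro ex_cong1) (simp add: complex_eq_iff algebra_simps)
  finally show ?thesis .
qed

lemma two_pi_int_less_iff: "2 * pi * real_of_int m < 2 * pi * real_of_int n \<longleftrightarrow> m < n"
  by simp

text \<open>The window leaves room for one wrap-around only: the integer multiple of
  \<open>2 * pi\<close> is strictly between -1 and 2.\<close>

lemma cis_eq_near:
  assumes "cis s = cis t" "t - 2 * pi < s" "s < t + 4 * pi"
  shows "s = t \<or> s = t + 2 * pi"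
proof -
  obtain n :: int where n: "s = t + 2 * pi * of_int n" using assms(1) unfolding cis_eq_iff by blast
  have "2 * pi * real_of_int n < 2 * pi * real_of_int 2" "2 * pi * real_of_int (-1) < 2 * pi * real_of_int n"
    using assms n by simp_all
  then have "n = 0 \<or> n = 1" unfolding two_pi_int_less_iff by linarith
  then show ?thesis using n by auto
qed

lemma circle_angle:
  assumes "z \<in> circle"
  obtains \<theta> where "x \<le> \<theta>" "\<theta> < x + 2 * pi" "z = cis \<theta>"
proof -
  obtain t where t: "z = cis t" using assms by (metis complex_unimodular_polar cis.code mem_sphere_0)
  define q where "q = (t - x) / (2 * pi)"
  define \<theta> where "\<theta> = t - 2 * pi * of_int \<lfloor>q\<rfloor>"
  have tq: "t = x + 2 * pi * q" unfolding q_def by simp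
  have "2 * pi * of_int \<lfloor>q\<rfloor> \<le> 2 * pi * q" "2 * pi * q < 2 * pi * (of_int \<lfloor>q\<rfloor> + 1)"
    by (intro mult_left_mono mult_strict_left_mono; simp; linarith)+
  then have "x \<le> \<theta>" "\<theta> < x + 2 * pi" unfolding \<theta>_def tq by (simp_all add: distrib_left)
  moreover have "z = cis \<theta>"
    unfolding t \<theta>_def cis_eq_iff by (rule exI[of _ "\<lfloor>q\<rfloor>"]) simp
  ultimately show thesis using that by blast
qed

text \<open>Angles are normalized to one turn starting at \<open>c\<close>, while the arc may reach
  into the next turn, as the third interval does; the second disjunct catches that part.\<close>

lemma cis_mem_circle_arc:
  assumes "c \<le> \<theta>" "\<theta> < c + 2 * pi" "c \<le> x" "y \<le> c + 4 * pi"
  shows "cis \<theta> \<in> circle_arc x y \<longleftrightarrow> x < \<theta> \<and> \<theta> < y \<or> x < \<theta> + 2 * pi \<and> \<theta> + 2 * pi < y"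
proof
  assume "cis \<theta> \<in> circle_arc x y"
  then obtain s where s: "x < s" "s < y" "cis s = cis \<theta>" unfolding circle_arc_def by auto
  then have "s = \<theta> \<or> s = \<theta> + 2 * pi" using assms by (intro cis_eq_near) auto
  then show "x < \<theta> \<and> \<theta> < y \<or> x < \<theta> + 2 * pi \<and> \<theta> + 2 * pi < y" using s by auto
next
  have "cis (\<theta> + 2 * pi) = cis \<theta>" unfolding cis_eq_iff by (rule exI[of _ 1]) simp
  then show "x < \<theta> \<and> \<theta> < y \<or> x < \<theta> + 2 * pi \<and> \<theta> + 2 * pi < y \<Longrightarrow> cis \<theta> \<in> circle_arc x y"
    unfolding circle_arc_def by (metis greaterThanLessThan_iff imageI)
qed

lemma circle_arc_subset: "circle_arc x y \<subseteq> circle"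
  unfolding circle_arc_def by auto

text \<open>Openness comes from the complement, which is the image of a compact interval of angles.
  Non-density comes from the midpoint of the complementary arc.\<close>

lemma circle_arc_interval:
  assumes "x < y" "y < x + 2 * pi"
  shows "circle_arc x y \<in> circle_intervals"
proof -
  have cont: "continuous_on S cis" for S by (intro continuous_intros)
  have "circle_arc x y = circle - cis ` {y..x + 2 * pi}"
  proof (intro equalityI subsetI)
    fix z assume z: "z \<in> circle_arc x y"
    then obtain s where s: "x < s" "s < y" "z = cis s" unfolding circle_arc_def by auto
    have "cis t \<noteq> cis s" if "y \<le> t" "t \<le> x + 2 * pi" for t
      using cis_eq_near[of t s] s that by auto
    then have "z \<notin> cis ` {y..x + 2 * pi}" unfolding s(3) by fastforce
    then show "z \<in> circle - cis ` {y..x + 2 * pi}" using s by simp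
  next
    fix z assume z: "z \<in> circle - cis ` {y..x + 2 * pi}"
    then obtain \<theta> where \<theta>: "x \<le> \<theta>" "\<theta> < x + 2 * pi" "z = cis \<theta>" using circle_angle[of z x] by blast
    have "cis x = cis (x + 2 * pi)" unfolding cis_eq_iff by (rule exI[of _ "-1"]) simp
    then have "z \<noteq> cis x" using z assms by auto
    then have "x < \<theta>" using \<theta> by (metis less_eq_real_def)
    moreover have "\<theta> < y" using z \<theta> by (metis Diff_iff atLeastAtMost_iff imageI less_eq_real_def linorder_not_le)
    ultimately show "z \<in> circle_arc x y" using \<theta> unfolding circle_arc_def by auto
  qed
  moreover have "closed (cis ` {y..x + 2 * pi})"
    by (intro compact_imp_closed compact_continuous_image cont) simp
  ultimately have "openin (top_of_set circle) (circle_arc x y)"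
    by (metis Diff_eq open_Compl openin_open_Int)
  moreover have "connected (circle_arc x y)" unfolding circle_arc_def
    by (intro connected_continuous_image cont) simp
  moreover have "circle_arc x y \<noteq> {}" unfolding circle_arc_def using assms by simp
  moreover have "\<not> circle \<subseteq> closure (circle_arc x y)"
  proof -
    define m where "m = (y + x + 2 * pi) / 2"
    have "closure (circle_arc x y) \<subseteq> cis ` {x..y}"
      unfolding circle_arc_def
      by (intro closure_minimal image_mono compact_imp_closed compact_continuous_image cont) auto
    moreover have "cis m \<notin> cis ` {x..y}"
    proof
      assume "cis m \<in> cis ` {x..y}"
      then obtain s where s: "x \<le> s" "s \<le> y" "cis m = cis s" by auto
      have m: "m = (y + x) / 2 + pi" by (simp add: m_def field_simps)
      have "m = s \<or> m = s + 2 * pi"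
      proof (rule cis_eq_near[OF s(3)])
        show "s - 2 * pi < m" using s(1,2) m assms pi_gt_zero by (simp add: field_simps)
        show "m < s + 4 * pi" using s(1,2) m assms pi_gt_zero by (simp add: field_simps)
      qed
      then show False using s(1,2) m assms pi_gt_zero by (simp add: field_simps)
    qed
    ultimately show ?thesis by (metis mem_sphere_0 norm_cis subsetD)
  qed
  ultimately show ?thesis by (simp add: circle_intervals_def)
qed

lemma circle_set_eqI:
  assumes "A \<subseteq> circle" "B \<subseteq> circle"
    and "\<And>\<theta>. c \<le> \<theta> \<Longrightarrow> \<theta> < c + 2 * pi \<Longrightarrow> cis \<theta> \<in> A \<longleftrightarrow> cis \<theta> \<in> B"
  shows "A = B"
  using assms circle_angle[of _ c] by (metis subset_antisym subsetD subsetI)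

text \<open>Measured from \<open>a 1\<close>, the first two intervals do not wrap around and the
  third becomes the two ends of the window. All incidences are then linear inequalities between the
  six angles.\<close>

lemma cover_arc_interval_cover:
  assumes "cover_angles a b"
  shows "interval_cover (cover_arc a b)"
proof -
  define I where "I = cover_arc a b"
  have ord: "0 < a 1" "a 1 < b 3" "b 3 < a 2" "a 2 < b 1" "b 1 < a 3" "a 3 < b 2" "b 2 < 2 * pi"
    using assms unfolding cover_angles_def by auto
  have I: "I 1 = circle_arc (a 1) (b 1)" "I 2 = circle_arc (a 2) (b 2)" "I 3 = circle_arc (a 3) (b 3 + 2 * pi)"
    by (simp_all add: I_def cover_arc_def)
  have sub: "I 1 \<subseteq> circle" "I 2 \<subseteq> circle" "I 3 \<subseteq> circle" unfolding I by (rule circle_arc_subset)+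
  have mem: "cis \<theta> \<in> circle_arc x y \<longleftrightarrow> x < \<theta> \<and> \<theta> < y \<or> x < \<theta> + 2 * pi \<and> \<theta> + 2 * pi < y"
    if "a 1 \<le> \<theta>" "\<theta> < a 1 + 2 * pi" "a 1 \<le> x" "y \<le> a 1 + 4 * pi" for \<theta> x y
    using that by (rule cis_mem_circle_arc)
  have m1: "cis \<theta> \<in> I 1 \<longleftrightarrow> a 1 < \<theta> \<and> \<theta> < b 1" and m2: "cis \<theta> \<in> I 2 \<longleftrightarrow> a 2 < \<theta> \<and> \<theta> < b 2"
    and m3: "cis \<theta> \<in> I 3 \<longleftrightarrow> a 3 < \<theta> \<or> \<theta> < b 3"
    if "a 1 \<le> \<theta>" "\<theta> < a 1 + 2 * pi" for \<theta>
    unfolding I using that ord by (subst mem; linarith)+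
  have arc_eq: "A = circle_arc x y"
    if A: "A \<subseteq> circle" "a 1 \<le> x" "y \<le> a 1 + 4 * pi"
      "\<And>\<theta>. a 1 \<le> \<theta> \<Longrightarrow> \<theta> < a 1 + 2 * pi \<Longrightarrow>
        cis \<theta> \<in> A \<longleftrightarrow> x < \<theta> \<and> \<theta> < y \<or> x < \<theta> + 2 * pi \<and> \<theta> + 2 * pi < y" for A x y
  proof (rule circle_set_eqI[where c="a 1"])
    show "cis \<theta> \<in> A \<longleftrightarrow> cis \<theta> \<in> circle_arc x y" if \<theta>: "a 1 \<le> \<theta>" "\<theta> < a 1 + 2 * pi" for \<theta>
      using A(4)[OF \<theta>] mem[OF \<theta> A(2,3)] by simp
  qed (use A(1) circle_arc_subset in auto)
  have arcs: "I 1 \<inter> I 2 = circle_arc (a 2) (b 1)" "I 1 \<inter> I 3 = circle_arc (a 1) (b 3)"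
    "I 2 \<inter> I 3 = circle_arc (a 3) (b 2)" "I 1 \<union> I 2 = circle_arc (a 1) (b 2)"
    "I 2 \<union> I 3 = circle_arc (a 2) (b 3 + 2 * pi)" "I 1 \<union> I 3 = circle_arc (a 3) (b 1 + 2 * pi)"
    using sub ord by (intro arc_eq; (blast | linarith | (simp only: Int_iff Un_iff m1 m2 m3, linarith)))+
  have "I 1 \<inter> I 2 \<inter> I 3 = {}"
  proof (rule circle_set_eqI[where c="a 1"])
    show "cis \<theta> \<in> I 1 \<inter> I 2 \<inter> I 3 \<longleftrightarrow> cis \<theta> \<in> {}" if "a 1 \<le> \<theta>" "\<theta> < a 1 + 2 * pi" for \<theta>
      unfolding Int_iff m1[OF that] m2[OF that] m3[OF that] using ord by auto
  qed (use sub in auto)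
  moreover have "I 1 \<in> circle_intervals" "I 2 \<in> circle_intervals" "I 3 \<in> circle_intervals"
    unfolding I using ord by (intro circle_arc_interval; linarith)+
  moreover have "I 1 \<inter> I 2 \<in> circle_intervals" "I 1 \<inter> I 3 \<in> circle_intervals" "I 2 \<inter> I 3 \<in> circle_intervals"
    "I 1 \<union> I 2 \<in> circle_intervals" "I 2 \<union> I 3 \<in> circle_intervals" "I 1 \<union> I 3 \<in> circle_intervals"
    unfolding arcs using ord by (intro circle_arc_interval; linarith)+
  ultimately show ?thesis unfolding interval_cover_def I_def[symmetric]
    by (simp add: Int_commute Un_commute)
qed

section \<open>The multiplier representation\<close>

text \<open>An orbit of the diagonal circle action. A cocycle multiplying both components
  disappears, whereas a scalar on one component alone remains visible.\<close>

definition phase_class :: "('a::chilbert \<Rightarrow>\<^sub>L 'a) \<Rightarrow> ('b::chilbert \<Rightarrow>\<^sub>L 'b) \<Rightarrow> (('a \<Rightarrow>\<^sub>L 'a) \<times> ('b \<Rightarrow>\<^sub>L 'b)) set" where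
  "phase_class S T = {(op_scaleC z S, op_scaleC z T) | z. cmod z = 1}"

text \<open>The elementwise product is defined for arbitrary sets of pairs, so that it is
  associative without side conditions, as the locale demands.\<close>

definition pairs_comp :: "(('a::chilbert \<Rightarrow>\<^sub>L 'a) \<times> ('b::chilbert \<Rightarrow>\<^sub>L 'b)) set \<Rightarrow>
    (('a \<Rightarrow>\<^sub>L 'a) \<times> ('b \<Rightarrow>\<^sub>L 'b)) set \<Rightarrow> (('a \<Rightarrow>\<^sub>L 'a) \<times> ('b \<Rightarrow>\<^sub>L 'b)) set" where
  "pairs_comp X Y = (\<Union>x\<in>X. \<Union>y\<in>Y. {(fst x o\<^sub>L fst y, snd x o\<^sub>L snd y)})"

lemma blinfun_compose_assoc: "R o\<^sub>L S o\<^sub>L T = R o\<^sub>L (S o\<^sub>L T)"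
  by (rule blinfun_eqI) simp

lemma pairs_comp_assoc: "pairs_comp (pairs_comp X Y) Z = pairs_comp X (pairs_comp Y Z)"
  by (simp add: pairs_comp_def blinfun_compose_assoc)

lemma pairs_comp_phase_class:
  assumes "S \<in> clinear_ops" "T \<in> clinear_ops"
  shows "pairs_comp (phase_class S T) (phase_class S' T') = phase_class (S o\<^sub>L S') (T o\<^sub>L T')"
proof (intro equalityI subsetI)
  fix p assume "p \<in> pairs_comp (phase_class S T) (phase_class S' T')"
  then obtain z w where "cmod z = 1" "cmod w = 1"
    "p = (op_scaleC z S o\<^sub>L op_scaleC w S', op_scaleC z T o\<^sub>L op_scaleC w T')"
    unfolding pairs_comp_def phase_class_def by auto
  then have "p = (op_scaleC (z * w) (S o\<^sub>L S'), op_scaleC (z * w) (T o\<^sub>L T'))" "cmod (z * w) = 1"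
    using assms by (simp_all add: op_scaleC_comp_left op_scaleC_comp_right norm_mult)
  then show "p \<in> phase_class (S o\<^sub>L S') (T o\<^sub>L T')" unfolding phase_class_def by blast
next
  fix p assume "p \<in> phase_class (S o\<^sub>L S') (T o\<^sub>L T')"
  then obtain z where z: "cmod z = 1" "p = (op_scaleC z (S o\<^sub>L S'), op_scaleC z (T o\<^sub>L T'))"
    unfolding phase_class_def by auto
  have "(op_scaleC z S, op_scaleC z T) \<in> phase_class S T" unfolding phase_class_def using z by blast
  moreover have "(op_scaleC 1 S', op_scaleC 1 T') \<in> phase_class S' T'" unfolding phase_class_def using norm_one by blast
  ultimately show "p \<in> pairs_comp (phase_class S T) (phase_class S' T')"
    unfolding pairs_comp_def z(2) by (force simp: op_scaleC_comp_left)
qed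

lemma phase_class_scaleC: "cmod z = 1 \<Longrightarrow> phase_class (op_scaleC z S) (op_scaleC z T) = phase_class S T"
proof (intro equalityI subsetI)
  fix p assume z: "cmod z = 1" and "p \<in> phase_class (op_scaleC z S) (op_scaleC z T)"
  then obtain w where "cmod w = 1" "p = (op_scaleC (w * z) S, op_scaleC (w * z) T)"
    unfolding phase_class_def by auto
  moreover then have "cmod (w * z) = 1" using z by (simp add: norm_mult)
  ultimately show "p \<in> phase_class S T" unfolding phase_class_def by blast
next
  fix p assume z: "cmod z = 1" and "p \<in> phase_class S T"
  then obtain w where w: "cmod w = 1" "p = (op_scaleC w S, op_scaleC w T)"
    unfolding phase_class_def by auto
  have "z \<noteq> 0" using z by auto
  then have "p = (op_scaleC (w / z) (op_scaleC z S), op_scaleC (w / z) (op_scaleC z T))" "cmod (w / z) = 1"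
    using w z by (simp_all add: norm_divide)
  then show "p \<in> phase_class (op_scaleC z S) (op_scaleC z T)" unfolding phase_class_def by blast
qed

lemma op_scaleC_unitary_cancel:
  assumes T: "unitary_op (T :: 'a::chilbert \<Rightarrow>\<^sub>L 'b::chilbert)" and x: "(x :: 'a) \<noteq> 0"
    and eq: "op_scaleC z T = op_scaleC w T"
  shows "z = w"
proof -
  have "z *\<^sub>C T x = w *\<^sub>C T x" using eq by (metis op_scaleC_apply)
  then have "z * cinner (T x) (T x) = w * cinner (T x) (T x)"
    by (metis cinner_scaleC_right)
  moreover have "T x \<noteq> 0" using unitary_op_norm[OF T, of x] x by auto
  ultimately show ?thesis by (simp add: cinner_self)
qed

text \<open>The return from classes to operators: on a non-zero space a unitary determines its
  scalar factor, so the first components identify the common phase as \<open>c\<close>, and the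
  second components inherit it.\<close>

lemma phase_class_eqD:
  assumes eq: "phase_class S T = phase_class S' T'" and S: "S = op_scaleC c S'" and c: "cmod c = 1"
    and S': "unitary_op (S' :: 'a::chilbert \<Rightarrow>\<^sub>L 'a)" and x: "(x :: 'a) \<noteq> 0"
  shows "T = op_scaleC c T'"
proof -
  have "(op_scaleC 1 S, op_scaleC 1 T) \<in> phase_class S T" unfolding phase_class_def using norm_one by blast
  then have "(S, T) \<in> phase_class S' T'" using eq by simp
  then obtain z where z: "S = op_scaleC z S'" "T = op_scaleC z T'"
    unfolding phase_class_def by blast
  then have "z = c" using op_scaleC_unitary_cancel[OF S' x] S by simp
  then show ?thesis using z by simp
qed

lemma continuous_map_cinner:
  assumes "continuous_map X euclidean f" "continuous_map X euclidean (g :: 't \<Rightarrow> 'a::chilbert)"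
  shows "continuous_map X euclidean (\<lambda>t. cinner (f t) (g t))"
proof -
  have "bounded_bilinear (cinner :: 'a \<Rightarrow> 'a \<Rightarrow> complex)"
    by standard (auto simp: cinner_add_left cinner_add_right scaleR_scaleC cinner_scaleC_left cinner_scaleC_right
      scaleR_conv_of_real cmod_cinner_le intro!: exI[of _ 1])
  then show ?thesis using assms unfolding continuous_map_euclidean_iff_tendsto
    by (blast intro: bounded_bilinear.tendsto)
qed

theorem fragments_local_multiplier_rep:
  fixes \<A> :: "complex set \<Rightarrow> ('h::{chilbert,second_countable_topology} \<Rightarrow>\<^sub>L 'h) set"
    and \<rho> :: "complex set \<Rightarrow> ('h \<Rightarrow>\<^sub>L 'h) \<Rightarrow> ('k::{chilbert,second_countable_topology} \<Rightarrow>\<^sub>L 'k)"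
    and \<Gamma> :: "('x, 'm) supp_group_scheme" (structure)
  assumes net: "conformal_net \<A> U \<Omega>"
    and DHR: "DHR_representation \<A> \<rho>"
    and cover: "interval_cover I"
    and loc_grp: "localizable_group \<Gamma>"
    and vac: "localized_vacuum_rep \<A> \<Gamma> E \<psi> Z \<pi>t"
    and frag: "fragmentation \<Gamma> I N \<Xi>"
    and sec: "local_section \<Gamma> E \<psi> W s"
    and coc: "local_cocycle \<Gamma> W (\<pi>t \<circ> s) c"
    and small: "small_domain \<Gamma> N \<Xi> W U0"
  shows "\<exists>V. nhd_of_one \<Gamma> V \<and> V \<subseteq> U0 \<and>
      decomposition_independent \<Gamma> I \<rho> (\<pi>t \<circ> s) c \<Xi> V \<and>
      local_multiplier_rep \<Gamma> c V U0 (pi_rho \<Gamma> I \<rho> (\<pi>t \<circ> s) c \<Xi>)"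
proof -
  define \<pi> where "\<pi> = \<pi>t \<circ> s"
  have W: "nhd_of_one \<Gamma> W" and s_cont: "continuous_map (subtopology (topo \<Gamma>) W) (topo E) s"
    and s_sec: "\<And>w. w \<in> W \<Longrightarrow> s w \<in> carrier E" "\<And>w. w \<in> W \<Longrightarrow> \<psi> (s w) = w"
    using sec by (simp_all add: local_section_def)
  have \<pi>t_u: "\<And>x. x \<in> carrier E \<Longrightarrow> unitary_op (\<pi>t x)"
    and \<pi>t_cont: "continuous_map (topo E) strong_operator_topology \<pi>t"
    and \<pi>t_loc: "\<And>J x. J \<in> circle_intervals \<Longrightarrow> x \<in> carrier E \<Longrightarrow> \<psi> x \<in> localized \<Gamma> J \<Longrightarrow> \<pi>t x \<in> \<A> J"
    using vac by (simp_all add: localized_vacuum_rep_def)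
  have \<pi>_u: "unitary_op (\<pi> w)" if "w \<in> W" for w using \<pi>t_u s_sec(1)[OF that] by (simp add: \<pi>_def)
  have \<pi>_loc: "\<pi> w \<in> \<A> J" if "J \<in> circle_intervals" "w \<in> W" "w \<in> localized \<Gamma> J" for J w
    using \<pi>t_loc[OF that(1) s_sec(1)[OF that(2)]] that s_sec(2) by (simp add: \<pi>_def)
  have \<pi>_cont: "continuous_map (subtopology (topo \<Gamma>) W) strong_operator_topology \<pi>"
    unfolding \<pi>_def by (rule continuous_map_compose[OF s_cont \<pi>t_cont])
  have c1: "cmod (c x y) = 1" and \<pi>_mult: "\<pi> x o\<^sub>L \<pi> y = op_scaleC (c x y) (\<pi> (x \<otimes> y))"
    if "x \<in> W" "y \<in> W" "x \<otimes> y \<in> W" for x y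
    using coc that by (simp_all add: local_cocycle_def \<pi>_def)
  have vN: "von_neumann_algebra (\<A> J)" if "J \<in> circle_intervals" for J
    using net that unfolding conformal_net_def by (elim conjE) (rule bspec)
  have "norm \<Omega> = 1" using net unfolding conformal_net_def by (elim conjE)
  then have \<Omega>: "\<Omega> \<noteq> 0" by auto
  have nrm: "normal_representation (\<A> J) (\<rho> J)" if "J \<in> circle_intervals" for J
    using DHR that by (simp add: DHR_representation_def)
  have \<rho>_mono: "\<rho> K T = \<rho> J T" if "J \<in> circle_intervals" "K \<in> circle_intervals" "J \<subseteq> K" "T \<in> \<A> J" for J K T
    using DHR that unfolding DHR_representation_def by (elim conjE) blast
  have \<rho>_u: "unitary_op (\<rho> J (\<pi> w))" if "J \<in> circle_intervals" "w \<in> W" "w \<in> localized \<Gamma> J" for J w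
    by (rule normal_representation_unitary[OF vN nrm \<pi>_loc \<pi>_u]) (use that in auto)
  have U0: "nhd_of_one \<Gamma> U0" "U0 \<subseteq> N" "U0 \<subseteq> W"
    and U0_W: "\<And>w. w \<in> U0 \<Longrightarrow> \<Xi> 1 w \<in> W" "\<And>w. w \<in> U0 \<Longrightarrow> \<Xi> 2 w \<in> W" "\<And>w. w \<in> U0 \<Longrightarrow> \<Xi> 3 w \<in> W"
      "\<And>w. w \<in> U0 \<Longrightarrow> \<Xi> 1 w \<otimes> \<Xi> 2 w \<in> W"
    using small by (simp_all add: small_domain_def)
  have I: "I j \<in> circle_intervals" if "j \<in> {1,2,3}" for j
    using cover that unfolding interval_cover_def by (elim conjE) (rule bspec)
  \<comment> \<open>The vacuum operator is carried along with its image under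
    \<open>\<rho> J\<close>; both satisfy the multiplier identity with the same \<open>c\<close>,
    which the class forgets.\<close>
  define P where "P J w = phase_class (\<pi> w) (\<rho> J (\<pi> w))" for J w
  interpret localizable_group \<Gamma> by (rule loc_grp)
  interpret local_precosheaf_hom \<Gamma> pairs_comp P W N I \<Xi>
  proof
    show "pairs_comp (pairs_comp a b) d = pairs_comp a (pairs_comp b d)" for a b d :: "(('h \<Rightarrow>\<^sub>L 'h) \<times> ('k \<Rightarrow>\<^sub>L 'k)) set"
      by (rule pairs_comp_assoc)
    show "P J (x \<otimes> y) = pairs_comp (P J x) (P J y)"
      if J: "J \<in> circle_intervals" and x: "x \<in> W \<inter> Loc J" and y: "y \<in> W \<inter> Loc J"
        and xy: "x \<otimes> y \<in> W" for J x y
    proof -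
      have l: "\<pi> x \<in> \<A> J" "\<pi> y \<in> \<A> J" "\<pi> (x \<otimes> y) \<in> \<A> J"
        using x y xy localized_mult by (auto intro: \<pi>_loc[OF J])
      have "\<rho> J (\<pi> x) o\<^sub>L \<rho> J (\<pi> y) = \<rho> J (\<pi> x o\<^sub>L \<pi> y)"
        using nrm[OF J] l unfolding normal_representation_def by simp
      also have "\<dots> = op_scaleC (c x y) (\<rho> J (\<pi> (x \<otimes> y)))"
        using nrm[OF J] l x y xy \<pi>_mult unfolding normal_representation_def by simp
      finally have r: "\<rho> J (\<pi> x) o\<^sub>L \<rho> J (\<pi> y) = op_scaleC (c x y) (\<rho> J (\<pi> (x \<otimes> y)))" .
      have "pairs_comp (P J x) (P J y) = phase_class (\<pi> x o\<^sub>L \<pi> y) (\<rho> J (\<pi> x) o\<^sub>L \<rho> J (\<pi> y))"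
        unfolding P_def
        by (rule pairs_comp_phase_class; rule unitary_op_clinear) (use x J in \<open>auto intro: \<pi>_u \<rho>_u\<close>)
      also have "\<dots> = P J (x \<otimes> y)"
        using x y xy unfolding P_def r by (simp add: \<pi>_mult phase_class_scaleC c1)
      finally show ?thesis by simp
    qed
    show "P K x = P J x" if "J \<in> circle_intervals" "K \<in> circle_intervals" "J \<subseteq> K" "x \<in> W \<inter> Loc J" for J K x
      unfolding P_def using \<rho>_mono[OF that(1-3) \<pi>_loc[OF that(1)]] that(4) by simp
  qed (fact cover frag W)+
  let ?F = "frag_product \<Gamma> I \<rho> \<pi> c"
  \<comment> \<open>The total phase correction of a triple; \<open>R\<close> is the uncorrected
    operator product.\<close>
  define d where "d x y z = inverse (c x y) * inverse (c (x \<otimes> y) z)" for x y z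
  define R where "R x y z = \<rho> (I 1) (\<pi> x) o\<^sub>L \<rho> (I 2) (\<pi> y) o\<^sub>L \<rho> (I 3) (\<pi> z)" for x y z
  have fp: "?F x y z = op_scaleC (d x y z) (R x y z)" for x y z
    by (simp add: frag_product_def d_def R_def)
  \<comment> \<open>Multiplying both components by \<open>d\<close> leaves the class unchanged. It
    turns the vacuum product into \<open>\<pi> (x \<otimes> y \<otimes> z)\<close> and,
    simultaneously, \<open>R\<close> into \<open>frag_product\<close>.\<close>
  have three: "\<pi> x o\<^sub>L \<pi> y o\<^sub>L \<pi> z = op_scaleC (inverse (d x y z)) (\<pi> (x \<otimes> y \<otimes> z))" "cmod (d x y z) = 1"
      "unitary_op (R x y z)"
      "triple x y z = phase_class (\<pi> (x \<otimes> y \<otimes> z)) (?F x y z)"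
    if x: "x \<in> W \<inter> Loc (I 1)" and y: "y \<in> W \<inter> Loc (I 2)" and z: "z \<in> W \<inter> Loc (I 3)"
      and xy: "x \<otimes> y \<in> W" and xyz: "x \<otimes> y \<otimes> z \<in> W" for x y z
  proof -
    show 1: "\<pi> x o\<^sub>L \<pi> y o\<^sub>L \<pi> z = op_scaleC (inverse (d x y z)) (\<pi> (x \<otimes> y \<otimes> z))"
      using x y z xy xyz by (simp add: \<pi>_mult op_scaleC_comp_left d_def)
    show d1: "cmod (d x y z) = 1" using x y z xy xyz by (simp add: d_def norm_mult norm_inverse c1)
    have u: "unitary_op (\<rho> (I 1) (\<pi> x))" "unitary_op (\<rho> (I 2) (\<pi> y))" "unitary_op (\<rho> (I 3) (\<pi> z))"
      "unitary_op (\<pi> x)" "unitary_op (\<pi> y)" "unitary_op (\<pi> z)"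
      using x y z by (auto intro!: \<rho>_u \<pi>_u I)
    then show "unitary_op (R x y z)" unfolding R_def by (intro unitary_op_comp)
    have "triple x y z = phase_class (\<pi> x o\<^sub>L \<pi> y o\<^sub>L \<pi> z) (R x y z)"
      unfolding triple_def P_def R_def using u
      by (simp add: pairs_comp_phase_class unitary_op_clinear unitary_op_comp)
    also have "\<dots> = phase_class (op_scaleC (d x y z) (\<pi> x o\<^sub>L \<pi> y o\<^sub>L \<pi> z)) (op_scaleC (d x y z) (R x y z))"
      by (simp add: phase_class_scaleC d1)
    also have "\<dots> = phase_class (\<pi> (x \<otimes> y \<otimes> z)) (?F x y z)"
    proof -
      have "d x y z \<noteq> 0" using d1 by auto
      then show ?thesis unfolding 1 fp by simp
    qed
    finally show "triple x y z = phase_class (\<pi> (x \<otimes> y \<otimes> z)) (?F x y z)" .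
  qed
  have \<Xi>_loc: "\<Xi> j w \<in> Loc (I j)" if "j \<in> {1,2,3}" "w \<in> U0" for j w
    using bspec[OF bspec[OF fragmentationD(4)[OF frag] that(1)]] that(2) U0(2) by blast
  have \<Xi>_prod: "\<Xi> 1 w \<otimes> \<Xi> 2 w \<otimes> \<Xi> 3 w = w" if "w \<in> U0" for w
    using bspec[OF fragmentationD(5)[OF frag], of w] that U0(2) by auto
  have \<Xi>_W: "\<Xi> 1 w \<in> W \<inter> Loc (I 1)" "\<Xi> 2 w \<in> W \<inter> Loc (I 2)" "\<Xi> 3 w \<in> W \<inter> Loc (I 3)"
    "\<Xi> 1 w \<otimes> \<Xi> 2 w \<in> W" "\<Xi> 1 w \<otimes> \<Xi> 2 w \<otimes> \<Xi> 3 w \<in> W" if "w \<in> U0" for w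
    using U0_W[OF that] \<Xi>_loc[OF _ that] \<Xi>_prod[OF that] U0(3) that by auto
  note \<Xi>3 = three[OF \<Xi>_W]
  define \<pi>\<rho> where "\<pi>\<rho> = pi_rho \<Gamma> I \<rho> \<pi> c \<Xi>"
  have \<pi>\<rho>: "\<pi>\<rho> w = op_scaleC (d (\<Xi> 1 w) (\<Xi> 2 w) (\<Xi> 3 w)) (R (\<Xi> 1 w) (\<Xi> 2 w) (\<Xi> 3 w))" for w
    by (simp add: \<pi>\<rho>_def pi_rho_def fp)
  have \<pi>\<rho>_triple: "frag_val w = phase_class (\<pi> w) (\<pi>\<rho> w)" if "w \<in> U0" for w
    using \<Xi>3(4)[OF that that that that that] \<Xi>_prod[OF that] by (simp add: \<pi>\<rho>_def pi_rho_def frag_val_def)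
  have \<pi>\<rho>_u: "unitary_op (\<pi>\<rho> w)" if "w \<in> U0" for w
    unfolding \<pi>\<rho> using \<Xi>3(2,3)[OF that that that that that] by (rule unitary_op_scaleC)
  obtain V where V: "nhd_of_one \<Gamma> V" "V \<subseteq> U0"
    and ind: "\<And>w g1 g2 g3. \<lbrakk>w \<in> V; g1 \<in> V \<inter> Loc (I 1); g2 \<in> V \<inter> Loc (I 2); g3 \<in> V \<inter> Loc (I 3);
      w = g1 \<otimes> g2 \<otimes> g3\<rbrakk> \<Longrightarrow> frag_val w = triple g1 g2 g3 \<and> g1 \<otimes> g2 \<in> W"
    and mult: "\<And>w v. w \<in> V \<Longrightarrow> v \<in> V \<Longrightarrow>
      pairs_comp (frag_val w) (frag_val v) = frag_val (w \<otimes> v)"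
    using local_hom_from_fragments[OF U0(1,3)] by (elim exE conjE) (rule that, assumption+, blast+)
  have VW: "w \<in> W" if "w \<in> V" for w using that V(2) U0(3) by blast
  have "decomposition_independent \<Gamma> I \<rho> \<pi> c \<Xi> V"
    unfolding decomposition_independent_def
  proof (intro ballI impI)
    fix w g1 g2 g3
    assume w: "w \<in> V" and g: "g1 \<in> V \<inter> Loc (I 1)" "g2 \<in> V \<inter> Loc (I 2)" "g3 \<in> V \<inter> Loc (I 3)"
      and eq: "w = g1 \<otimes> g2 \<otimes> g3"
    have "w \<in> U0" using w V(2) by blast
    have "triple g1 g2 g3 = phase_class (\<pi> (g1 \<otimes> g2 \<otimes> g3)) (?F g1 g2 g3)"
      by (rule three(4)) (use ind[OF w g eq] g VW w eq in auto)
    then have "phase_class (\<pi> w) (\<pi>\<rho> w) = phase_class (\<pi> w) (?F g1 g2 g3)"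
      using ind[OF w g eq] \<pi>\<rho>_triple[OF \<open>w \<in> U0\<close>] eq by simp
    from phase_class_eqD[OF this, of 1 \<Omega>] show "pi_rho \<Gamma> I \<rho> \<pi> c \<Xi> w = ?F g1 g2 g3"
      using \<pi>_u[OF VW[OF w]] \<Omega> by (simp add: \<pi>\<rho>_def)
  qed
  moreover have "local_multiplier_rep \<Gamma> c V U0 \<pi>\<rho>"
    unfolding local_multiplier_rep_def
  proof (intro conjI ballI impI)
    show "unitary_op (\<pi>\<rho> w)" if "w \<in> V" for w using \<pi>\<rho>_u that V(2) by blast
    show "\<pi>\<rho> w o\<^sub>L \<pi>\<rho> v = op_scaleC (c w v) (\<pi>\<rho> (w \<otimes> v))"
      if w: "w \<in> V" and v: "v \<in> V" and wv: "w \<otimes> v \<in> U0" for w v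
    proof -
      have U: "w \<in> U0" "v \<in> U0" using w v V(2) by blast+
      have W': "w \<otimes> v \<in> W" using wv U0(3) by blast
      have "phase_class (\<pi> w o\<^sub>L \<pi> v) (\<pi>\<rho> w o\<^sub>L \<pi>\<rho> v) = pairs_comp (phase_class (\<pi> w) (\<pi>\<rho> w)) (phase_class (\<pi> v) (\<pi>\<rho> v))"
        using \<pi>_u[OF VW[OF w]] \<pi>\<rho>_u[OF U(1)] by (simp add: pairs_comp_phase_class unitary_op_clinear)
      also have "\<dots> = phase_class (\<pi> (w \<otimes> v)) (\<pi>\<rho> (w \<otimes> v))"
        using mult[OF w v] unfolding \<pi>\<rho>_triple[OF U(1)] \<pi>\<rho>_triple[OF U(2)] \<pi>\<rho>_triple[OF wv] .
      finally show ?thesis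
        by (rule phase_class_eqD[OF _ \<pi>_mult c1 \<pi>_u \<Omega>]) (use VW[OF w] VW[OF v] W' in auto)
    qed
    let ?X = "subtopology (topo \<Gamma>) V"
    have top: "topspace ?X \<subseteq> V" by auto
    have \<Xi>_cont: "continuous_map ?X (subtopology (topo \<Gamma>) W) (\<Xi> j)" if j: "j \<in> {1,2,3}" for j
    proof -
      have "continuous_map ?X (topo \<Gamma>) (\<Xi> j)"
        by (rule continuous_map_from_subtopology_mono[OF bspec[OF fragmentationD(2)[OF frag] j]])
          (use V(2) U0(2) in blast)
      moreover have "\<Xi> j w \<in> W" if "w \<in> V" for w using j U0_W that V(2) by blast
      ultimately show ?thesis using top by (auto simp: continuous_map_in_subtopology)
    qed
    have \<pi>\<Xi>: "continuous_map ?X strong_operator_topology (\<lambda>w. \<pi> (\<Xi> j w))" if "j \<in> {1,2,3}" for j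
      using continuous_map_compose[OF \<Xi>_cont[OF that] \<pi>_cont] by (simp add: comp_def)
    have loc: "\<Xi> j w \<in> W" "\<Xi> j w \<in> Loc (I j)" if "j \<in> {1,2,3}" "w \<in> topspace ?X" for j w
      using that top V(2) U0_W \<Xi>_loc by blast+
    have \<rho>\<Xi>: "continuous_map ?X strong_operator_topology (\<lambda>w. \<rho> (I j) (\<pi> (\<Xi> j w)))" if j: "j \<in> {1,2,3}" for j
      by (rule normal_representation_strong_continuity[OF vN nrm \<pi>\<Xi>])
        (use j I loc in \<open>auto intro!: \<pi>_loc \<pi>_u\<close>)
    have Rc: "continuous_map ?X strong_operator_topology (\<lambda>w. R (\<Xi> 1 w) (\<Xi> 2 w) (\<Xi> 3 w))"
      unfolding R_def
      by (intro continuous_map_strong_comp \<rho>\<Xi> unitary_op_comp \<rho>_u I loc) simp_all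
    have \<pi>c: "continuous_map ?X strong_operator_topology (\<lambda>w. \<pi> (\<Xi> 1 w) o\<^sub>L \<pi> (\<Xi> 2 w) o\<^sub>L \<pi> (\<Xi> 3 w))"
      by (intro continuous_map_strong_comp \<pi>\<Xi> unitary_op_comp \<pi>_u loc) simp_all
    have \<pi>V: "continuous_map ?X strong_operator_topology \<pi>"
      by (rule continuous_map_from_subtopology_mono[OF \<pi>_cont]) (use VW in blast)
    \<comment> \<open>Continuity of the phase is extracted from \<open>\<pi>\<close> itself, as a
      vacuum matrix coefficient. The triple product equals \<open>inverse d\<close> times
      \<open>\<pi> w\<close> and stands in the conjugate-linear slot, so the coefficient is exactly
      the unimodular \<open>d\<close>.\<close>
    have "continuous_map ?X euclidean (\<lambda>w. cinner ((\<pi> (\<Xi> 1 w) o\<^sub>L \<pi> (\<Xi> 2 w) o\<^sub>L \<pi> (\<Xi> 3 w)) \<Omega>) ((\<pi> w) \<Omega>))"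
      by (rule continuous_map_cinner) (use \<pi>c \<pi>V in \<open>simp_all only: continuous_on_strong_operator_topo_iff_coordinatewise\<close>)
    moreover have "cinner ((\<pi> (\<Xi> 1 w) o\<^sub>L \<pi> (\<Xi> 2 w) o\<^sub>L \<pi> (\<Xi> 3 w)) \<Omega>) ((\<pi> w) \<Omega>)
        = d (\<Xi> 1 w) (\<Xi> 2 w) (\<Xi> 3 w)" if "w \<in> topspace ?X" for w
    proof -
      have w: "w \<in> U0" "w \<in> W" using that top V(2) VW by blast+
      define z where "z = d (\<Xi> 1 w) (\<Xi> 2 w) (\<Xi> 3 w)"
      have z: "cmod z = 1" using \<Xi>3(2)[OF w(1) w(1) w(1) w(1) w(1)] by (simp add: z_def)
      have e: "\<pi> (\<Xi> 1 w) o\<^sub>L \<pi> (\<Xi> 2 w) o\<^sub>L \<pi> (\<Xi> 3 w) = op_scaleC (inverse z) (\<pi> w)"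
        using \<Xi>3(1)[OF w(1) w(1) w(1) w(1) w(1)] \<Xi>_prod[OF w(1)] by (simp add: z_def)
      have "cinner \<Omega> \<Omega> = 1" using \<open>norm \<Omega> = 1\<close> by (simp add: cinner_self)
      moreover have "cnj (inverse z) = z"
        using complex_norm_square[of z] z by (simp add: inverse_unique mult.commute)
      ultimately show ?thesis unfolding e z_def[symmetric]
        by (simp add: cinner_scaleC_left unitary_op_cinner[OF \<pi>_u[OF w(2)]])
    qed
    ultimately have "continuous_map ?X euclidean (\<lambda>w. d (\<Xi> 1 w) (\<Xi> 2 w) (\<Xi> 3 w))"
      by (rule continuous_map_eq)
    from continuous_map_strong_scaleC[OF Rc this]
    show "continuous_map ?X strong_operator_topology \<pi>\<rho>" unfolding \<pi>\<rho>[abs_def] .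
  qed
  ultimately show ?thesis using V unfolding \<pi>_def \<pi>\<rho>_def by blast
qed

section \<open>Differential calculus with uniform bounds\<close>

text \<open>Openness is essential: the derivatives are two-sided derivatives at points, and
  agreement on \<open>S\<close> controls them only if \<open>S\<close> surrounds each of its
  points.\<close>

lemma Ck_on_cong:
  assumes "open S" "\<And>x. x \<in> S \<Longrightarrow> f x = g x" "Ck_on k f S"
  shows "Ck_on k g S"
  using assms(2,3)
proof (induction k arbitrary: f g)
  case 0
  then show ?case using continuous_on_cong[of S S f g] by simp
next
  case (Suc k)
  have d: "(g has_derivative frechet_derivative f (at x)) (at x)" if "x \<in> S" for x
  proof -
    have "(f has_derivative frechet_derivative f (at x)) (at x)"
      using Suc.prems(2) that assms(1) by (simp add: differentiable_on_eq_differentiable_at frechet_derivative_works)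
    then show ?thesis using assms(1) that Suc.prems(1) by (rule has_derivative_transform_within_open)
  qed
  then have e: "frechet_derivative f (at x) v = frechet_derivative g (at x) v" if "x \<in> S" for x v
    using frechet_derivative_at that by metis
  have "Ck_on k (\<lambda>x. frechet_derivative g (at x) v) S" if "v \<in> Basis" for v
    by (rule Suc.IH[where f="\<lambda>x. frechet_derivative f (at x) v"]) (use e Suc.prems that in auto)
  moreover have "g differentiable_on S"
    using d assms(1) by (auto simp: differentiable_on_eq_differentiable_at differentiable_def)
  ultimately show ?case by simp
qed

lemma Ck_on_SucD: "Ck_on (Suc k) f S \<Longrightarrow> Ck_on k f S"
proof (induction k arbitrary: f)
  case 0
  then show ?case by (simp add: differentiable_imp_continuous_on)
next
  case (Suc k)
  then have "f differentiable_on S" "\<And>v. v \<in> Basis \<Longrightarrow> Ck_on (Suc k) (\<lambda>x. frechet_derivative f (at x) v) S" by simp_all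
  then show ?case using Suc.IH by (simp del: Ck_on.simps add: Ck_on.simps(2)[of k f])
qed

lemma Ck_on_continuous: "Ck_on k f S \<Longrightarrow> continuous_on S f"
  by (cases k) (auto simp: differentiable_imp_continuous_on)

lemma Ck_on_subset: "Ck_on k f S \<Longrightarrow> T \<subseteq> S \<Longrightarrow> Ck_on k f T"
  by (induction k arbitrary: f) (auto intro: continuous_on_subset differentiable_on_subset)

lemma Ck_on_local:
  assumes "open S" "\<And>x. x \<in> S \<Longrightarrow> \<exists>T. open T \<and> x \<in> T \<and> Ck_on k f T"
  shows "Ck_on k f S"
  using assms(2)
proof (induction k arbitrary: f)
  case 0
  have "isCont f x" if x: "x \<in> S" for x
  proof -
    obtain T where "open T" "x \<in> T" "continuous_on T f" using 0[OF x] by auto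
    then show ?thesis by (simp add: continuous_on_eq_continuous_at)
  qed
  then show ?case by (simp add: continuous_at_imp_continuous_on)
next
  case (Suc k)
  have "f differentiable at x" if x: "x \<in> S" for x
  proof -
    obtain T where "open T" "x \<in> T" "f differentiable_on T" using Suc.prems[OF x] by auto
    then show ?thesis by (simp add: differentiable_on_eq_differentiable_at)
  qed
  moreover have "Ck_on k (\<lambda>x. frechet_derivative f (at x) v) S" if v: "v \<in> Basis" for v
  proof (rule Suc.IH)
    fix x assume "x \<in> S"
    then obtain T where "open T" "x \<in> T" "Ck_on (Suc k) f T" using Suc.prems by blast
    then show "\<exists>T. open T \<and> x \<in> T \<and> Ck_on k (\<lambda>x. frechet_derivative f (at x) v) T" using v by auto
  qed
  ultimately show ?case using assms(1) by (simp add: differentiable_on_eq_differentiable_at)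
qed

lemma Ck_on_SucI:
  assumes S: "open S" and d: "\<And>x. x \<in> S \<Longrightarrow> (f has_derivative f' x) (at x)"
    and C: "\<And>v. v \<in> Basis \<Longrightarrow> Ck_on k (\<lambda>x. f' x v) S"
  shows "Ck_on (Suc k) f S"
proof -
  have "Ck_on k (\<lambda>x. frechet_derivative f (at x) v) S" if "v \<in> Basis" for v
    by (rule Ck_on_cong[OF S _ C[OF that]]) (use frechet_derivative_at[OF d] in metis)
  then show ?thesis using d S by (auto simp: differentiable_on_eq_differentiable_at differentiable_def)
qed

lemma Ck_on_SucD':
  assumes "open S" "Ck_on (Suc k) f S"
  shows "x \<in> S \<Longrightarrow> (f has_derivative frechet_derivative f (at x)) (at x)"
    "v \<in> Basis \<Longrightarrow> Ck_on k (\<lambda>x. frechet_derivative f (at x) v) S"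
  using assms by (auto simp: differentiable_on_eq_differentiable_at frechet_derivative_works)

lemma Ck_on_const: "open S \<Longrightarrow> Ck_on k (\<lambda>x. c) S"
proof (induction k arbitrary: c)
  case (Suc k)
  show ?case by (rule Ck_on_SucI[where f'="\<lambda>x v. 0"]) (use Suc in auto)
qed simp

lemma Ck_on_bounded_linear_comp:
  assumes L: "bounded_linear L" and S: "open S"
  shows "Ck_on k f S \<Longrightarrow> Ck_on k (\<lambda>x. L (f x)) S"
proof (induction k arbitrary: f)
  case 0
  then show ?case using bounded_linear.continuous_on[OF L] by simp
next
  case (Suc k)
  note d = Ck_on_SucD'[OF S Suc.prems]
  show ?case
    by (rule Ck_on_SucI[OF S bounded_linear.has_derivative[OF L d(1)]]) (use d Suc.IH in auto)
qed

lemma Ck_on_id: "open S \<Longrightarrow> Ck_on k (\<lambda>x. x) S"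
proof (cases k)
  case (Suc n)
  assume S: "open S"
  show ?thesis unfolding Suc
    by (rule Ck_on_SucI[OF S has_derivative_ident]) (rule Ck_on_const[OF S])
qed simp

lemma Ck_on_add:
  assumes S: "open S"
  shows "Ck_on k f S \<Longrightarrow> Ck_on k g S \<Longrightarrow> Ck_on k (\<lambda>x. f x + g x) S"
proof (induction k arbitrary: f g)
  case (Suc k)
  note d = Ck_on_SucD'[OF S Suc.prems(1)] Ck_on_SucD'[OF S Suc.prems(2)]
  show ?case
    by (rule Ck_on_SucI[OF S has_derivative_add[OF d(1) d(3)]]) (use d Suc.IH in auto)
qed (simp add: continuous_on_add)

lemma Ck_on_sum:
  assumes S: "open S" and "finite A"
  shows "(\<And>a. a \<in> A \<Longrightarrow> Ck_on k (f a) S) \<Longrightarrow> Ck_on k (\<lambda>x. \<Sum>a\<in>A. f a x) S"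
  using assms(2) by (induction A) (auto intro: Ck_on_const Ck_on_add S)

lemma Ck_on_scaleR:
  assumes S: "open S"
  shows "Ck_on k f S \<Longrightarrow> Ck_on k g S \<Longrightarrow> Ck_on k (\<lambda>x. f x *\<^sub>R g x) S"
proof (induction k arbitrary: f g)
  case (Suc k)
  note d = Ck_on_SucD'[OF S Suc.prems(1)] Ck_on_SucD'[OF S Suc.prems(2)]
  note c = Suc.prems[THEN Ck_on_SucD]
  show ?case
    by (rule Ck_on_SucI[OF S has_derivative_scaleR[OF d(1) d(3)]])
      (use c d in \<open>auto intro!: Ck_on_add S Suc.IH\<close>)
qed (simp add: continuous_on_scaleR)

lemma has_derivative_euclidean_expand:
  fixes g' :: "'b::euclidean_space \<Rightarrow> 'c::real_normed_vector"
  assumes "bounded_linear g'"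
  shows "g' y = (\<Sum>b\<in>Basis. (y \<bullet> b) *\<^sub>R g' b)"
proof -
  have "g' y = g' (\<Sum>b\<in>Basis. (y \<bullet> b) *\<^sub>R b)" by (simp add: euclidean_representation)
  also have "\<dots> = (\<Sum>b\<in>Basis. (y \<bullet> b) *\<^sub>R g' b)"
    by (simp add: linear_sum[OF bounded_linear.linear[OF assms]] linear_scale[OF bounded_linear.linear[OF assms]])
  finally show ?thesis .
qed

text \<open>Expanding the outer derivative along the basis turns the chain rule into sums and scalar
  products, the operations for which \<open>Ck_on\<close> and \<open>Ck_bound\<close> are already
  understood.\<close>

lemma has_derivative_compose_expand:
  fixes g :: "'b::euclidean_space \<Rightarrow> 'c::real_normed_vector"
  assumes f: "(f has_derivative f') (at x)" and g: "(g has_derivative g') (at (f x))"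
  shows "((\<lambda>x. g (f x)) has_derivative (\<lambda>v. \<Sum>b\<in>Basis. (f' v \<bullet> b) *\<^sub>R g' b)) (at x)"
  using has_derivative_compose[OF f g]
  by (subst has_derivative_euclidean_expand[OF has_derivative_bounded_linear[OF g], symmetric])

text \<open>Every term of the derivative is a coordinate of the derivative of \<open>f\<close> times
  a composite with a partial derivative of \<open>g\<close>. The induction therefore keeps
  \<open>f\<close> and varies \<open>g\<close>.\<close>

lemma Ck_on_compose:
  fixes f :: "'a::euclidean_space \<Rightarrow> 'b::euclidean_space" and g :: "'b \<Rightarrow> 'c::real_normed_vector"
  assumes S: "open S" and T: "open T" and fS: "f ` S \<subseteq> T"
  shows "Ck_on k f S \<Longrightarrow> Ck_on k g T \<Longrightarrow> Ck_on k (\<lambda>x. g (f x)) S"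
proof (induction k arbitrary: g)
  case 0
  then show ?case using continuous_on_compose2[of T g S f] fS by auto
next
  case (Suc k)
  note df = Ck_on_SucD'[OF S Suc.prems(1)] and dg = Ck_on_SucD'[OF T Suc.prems(2)]
  note c = Suc.prems(1)[THEN Ck_on_SucD]
  show ?case
  proof (rule Ck_on_SucI[OF S has_derivative_compose_expand[OF df(1) dg(1)]])
    show "f x \<in> T" if "x \<in> S" for x using that fS by blast
    show "Ck_on k (\<lambda>x. \<Sum>b\<in>Basis. (frechet_derivative f (at x) v \<bullet> b) *\<^sub>R frechet_derivative g (at (f x)) b) S"
      if "v \<in> Basis" for v
      using that c df(2) dg(2)
      by (intro Ck_on_sum S finite_Basis Ck_on_scaleR Suc.IH
          Ck_on_bounded_linear_comp[OF bounded_linear_inner_left S]) auto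
  qed
qed

section \<open>Smooth maps on open sets\<close>

lemma smooth_on_cong: "open S \<Longrightarrow> (\<And>x. x \<in> S \<Longrightarrow> f x = g x) \<Longrightarrow> smooth_on S f \<Longrightarrow> smooth_on S g"
  unfolding smooth_on_def using Ck_on_cong by blast

lemma smooth_on_subset: "smooth_on S f \<Longrightarrow> T \<subseteq> S \<Longrightarrow> smooth_on T f"
  unfolding smooth_on_def using Ck_on_subset by blast

lemma smooth_on_local:
  assumes "open S" "\<And>x. x \<in> S \<Longrightarrow> \<exists>T. open T \<and> x \<in> T \<and> smooth_on T f"
  shows "smooth_on S f"
  unfolding smooth_on_def
proof
  show "Ck_on k f S" for k
    by (rule Ck_on_local[OF assms(1)]) (use assms(2) in \<open>unfold smooth_on_def, blast\<close>)
qed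

lemma smooth_on_const: "open S \<Longrightarrow> smooth_on S (\<lambda>x. c)"
  and smooth_on_id: "open S \<Longrightarrow> smooth_on S (\<lambda>x. x)"
  and smooth_on_bounded_linear_comp: "bounded_linear L \<Longrightarrow> open S \<Longrightarrow> smooth_on S f \<Longrightarrow> smooth_on S (\<lambda>x. L (f x))"
  and smooth_on_add: "open S \<Longrightarrow> smooth_on S f \<Longrightarrow> smooth_on S g \<Longrightarrow> smooth_on S (\<lambda>x. f x + g x)"
  and smooth_on_scaleR: "open S \<Longrightarrow> smooth_on S h \<Longrightarrow> smooth_on S f \<Longrightarrow> smooth_on S (\<lambda>x. h x *\<^sub>R f x)"
  by (simp_all add: smooth_on_def Ck_on_const Ck_on_id Ck_on_bounded_linear_comp Ck_on_add Ck_on_scaleR)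

lemma smooth_on_diff: "open S \<Longrightarrow> smooth_on S f \<Longrightarrow> smooth_on S g \<Longrightarrow> smooth_on S (\<lambda>x. f x - g x)"
  using smooth_on_add[of S f "\<lambda>x. - g x"] smooth_on_bounded_linear_comp[OF bounded_linear_minus[OF bounded_linear_ident], of S g]
  by simp

lemma smooth_on_compose:
  fixes f :: "'a::euclidean_space \<Rightarrow> 'b::euclidean_space" and g :: "'b \<Rightarrow> 'c::real_normed_vector"
  shows "open S \<Longrightarrow> open T \<Longrightarrow> f ` S \<subseteq> T \<Longrightarrow> smooth_on S f \<Longrightarrow> smooth_on T g \<Longrightarrow> smooth_on S (\<lambda>x. g (f x))"
  unfolding smooth_on_def using Ck_on_compose by blast

lemma smooth_on_Pair:
  fixes f :: "'a::euclidean_space \<Rightarrow> 'b::real_normed_vector" and g :: "'a \<Rightarrow> 'c::real_normed_vector"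
  assumes "open S" "smooth_on S f" "smooth_on S g"
  shows "smooth_on S (\<lambda>x. (f x, g x))"
proof -
  have "bounded_linear (\<lambda>x::'b. (x, 0::'c))" "bounded_linear (\<lambda>y::'c. (0::'b, y))"
    by (intro bounded_linear_Pair bounded_linear_ident bounded_linear_zero)+
  then have "smooth_on S (\<lambda>x. (f x, 0) + (0, g x))"
    using assms by (intro smooth_on_add smooth_on_bounded_linear_comp[of "\<lambda>x. (x, 0)"]
        smooth_on_bounded_linear_comp[of "\<lambda>x. (0, x)"])
  then show ?thesis by simp
qed

lemma smooth_on_continuous: "smooth_on S f \<Longrightarrow> continuous_on S f"
  unfolding smooth_on_def using Ck_on_continuous by blast

lemma smooth_on_has_derivative:
  "open S \<Longrightarrow> smooth_on S f \<Longrightarrow> x \<in> S \<Longrightarrow> (f has_derivative frechet_derivative f (at x)) (at x)"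
  and smooth_on_frechet_derivative:
  "open S \<Longrightarrow> smooth_on S f \<Longrightarrow> v \<in> Basis \<Longrightarrow> smooth_on S (\<lambda>x. frechet_derivative f (at x) v)"
  unfolding smooth_on_def using Ck_on_SucD' by blast+

lemma smooth_on_has_vector_derivative:
  fixes f :: "real \<Rightarrow> 'a::real_normed_vector"
  assumes "open S" "smooth_on S f" "x \<in> S"
  shows "(f has_vector_derivative vector_derivative f (at x)) (at x)"
  using smooth_on_has_derivative[OF assms] vector_derivative_works differentiableI by blast

lemma smooth_on_vector_derivative:
  fixes f :: "real \<Rightarrow> 'a::real_normed_vector"
  assumes "open S" "smooth_on S f"
  shows "smooth_on S (\<lambda>t. vector_derivative f (at t))"
proof (rule smooth_on_cong[OF assms(1) _ smooth_on_frechet_derivative[OF assms]])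
  show "(1::real) \<in> Basis" by simp
  show "frechet_derivative f (at x) 1 = vector_derivative f (at x)" if "x \<in> S" for x
    using frechet_derivative_at[OF smooth_on_has_vector_derivative[OF assms that, unfolded has_vector_derivative_def]]
    by (metis scaleR_one)
qed

lemma Ck_on_SucI_vector:
  fixes f :: "real \<Rightarrow> 'a::real_normed_vector"
  assumes S: "open S" and "\<And>x. x \<in> S \<Longrightarrow> (f has_vector_derivative f' x) (at x)" "Ck_on k f' S"
  shows "Ck_on (Suc k) f S"
  by (rule Ck_on_SucI[OF S, where f'="\<lambda>x v. v *\<^sub>R f' x"])
    (use assms in \<open>auto simp: has_vector_derivative_def\<close>)


section \<open>Uniform bounds on the derivatives of curves\<close>

definition Ck_bound :: "nat \<Rightarrow> real \<Rightarrow> (real \<Rightarrow> 'a::real_normed_vector) \<Rightarrow> bool" where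
  "Ck_bound k M f \<longleftrightarrow> (\<forall>j\<le>k. \<forall>t. norm (nderiv j f t) \<le> M)"

lemma nderiv_0 [simp]: "nderiv 0 f = f"
  by (simp add: nderiv_def)

lemma nderiv_Suc: "nderiv (Suc j) f = nderiv j (\<lambda>t. vector_derivative f (at t))"
  by (simp add: nderiv_def funpow_Suc_right del: funpow.simps)

lemma Ck_bound_0: "Ck_bound 0 M f \<longleftrightarrow> (\<forall>t. norm (f t) \<le> M)"
  by (simp add: Ck_bound_def)

lemma Ck_bound_Suc:
  "Ck_bound (Suc k) M f \<longleftrightarrow> (\<forall>t. norm (f t) \<le> M) \<and> Ck_bound k M (\<lambda>t. vector_derivative f (at t))"
proof -
  have "(\<forall>j\<le>Suc k. P j) \<longleftrightarrow> P 0 \<and> (\<forall>j\<le>k. P (Suc j))" for P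
    by (metis Suc_le_mono le0 not0_implies_Suc)
  then show ?thesis unfolding Ck_bound_def by (simp add: nderiv_Suc)
qed

lemma Ck_bound_norm: "Ck_bound k M f \<Longrightarrow> norm (f t) \<le> M"
  unfolding Ck_bound_def by (metis le0 nderiv_0)

lemma Ck_bound_nonneg: "Ck_bound k M f \<Longrightarrow> 0 \<le> M"
  using Ck_bound_norm norm_ge_zero order_trans by blast

lemma Ck_bound_mono: "Ck_bound k M f \<Longrightarrow> M \<le> M' \<Longrightarrow> l \<le> k \<Longrightarrow> Ck_bound l M' f"
  unfolding Ck_bound_def by (meson order_trans)

lemma Ck_bound_SucD: "Ck_bound (Suc k) M f \<Longrightarrow> Ck_bound k M f"
  by (rule Ck_bound_mono) auto

lemma Ck_bound_derivative:
  fixes f :: "real \<Rightarrow> 'a::real_normed_vector"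
  assumes "\<And>t. (f has_vector_derivative f' t) (at t)" "Ck_bound k M f'" "\<And>t. norm (f t) \<le> M"
  shows "Ck_bound (Suc k) M f"
proof -
  have "(\<lambda>t. vector_derivative f (at t)) = f'" using assms(1) vector_derivative_at by blast
  then show ?thesis using assms by (simp add: Ck_bound_Suc)
qed

lemma smooth_vector_derivative:
  "smooth_on UNIV f \<Longrightarrow> (f has_vector_derivative vector_derivative f (at t)) (at t)"
  "smooth_on UNIV f \<Longrightarrow> smooth_on UNIV (\<lambda>t. vector_derivative f (at t))"
  using smooth_on_has_vector_derivative smooth_on_vector_derivative open_UNIV by blast+

lemma Ck_bound_const: "Ck_bound k (norm c) (\<lambda>t. c)"
proof (induction k arbitrary: c)
  case (Suc k)
  have "Ck_bound k (norm c) (\<lambda>t. 0 :: 'a)" by (rule Ck_bound_mono[OF Suc[of 0]]) auto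
  then show ?case by (intro Ck_bound_derivative[where f'="\<lambda>t. 0"]) auto
qed (simp add: Ck_bound_0)

lemma Ck_bound_add:
  "smooth_on UNIV f \<Longrightarrow> smooth_on UNIV g \<Longrightarrow> Ck_bound k A f \<Longrightarrow> Ck_bound k B g \<Longrightarrow> Ck_bound k (A + B) (\<lambda>t. f t + g t)"
proof (induction k arbitrary: f g)
  case 0
  then show ?case by (auto simp: Ck_bound_0 intro: norm_add_rule_thm)
next
  case (Suc k)
  note f = smooth_vector_derivative[OF Suc.prems(1)] and g = smooth_vector_derivative[OF Suc.prems(2)]
  show ?case
    by (rule Ck_bound_derivative[OF has_vector_derivative_add[OF f(1) g(1)]])
      (use Suc f g in \<open>auto simp: Ck_bound_Suc intro: norm_add_rule_thm\<close>)
qed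

lemma Ck_bound_bounded_linear_comp:
  assumes L: "bounded_linear L" and K: "\<And>x. norm (L x) \<le> K * norm x" and K0: "0 \<le> K"
  shows "smooth_on UNIV f \<Longrightarrow> Ck_bound k A f \<Longrightarrow> Ck_bound k (K * A) (\<lambda>t. L (f t))"
proof (induction k arbitrary: f)
  case 0
  then show ?case using K K0 by (auto simp: Ck_bound_0 intro: order_trans[OF _ mult_left_mono])
next
  case (Suc k)
  note f = smooth_vector_derivative[OF Suc.prems(1)]
  have "norm (L (f t)) \<le> K * A" for t
    using order_trans[OF K mult_left_mono[OF Ck_bound_norm[OF Suc.prems(2)] K0]] .
  moreover have "Ck_bound k (K * A) (\<lambda>t. L (vector_derivative f (at t)))"
    using Suc.IH[OF f(2)] Suc.prems(2) by (simp add: Ck_bound_Suc)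
  ultimately show ?case
    using Ck_bound_derivative[OF bounded_linear.has_vector_derivative[OF L f(1)]] by blast
qed

text \<open>By the Leibniz rule each differentiation doubles the number of terms, whence the factor
  \<open>2 ^ k\<close>.\<close>

lemma Ck_bound_scaleR:
  "smooth_on UNIV f \<Longrightarrow> smooth_on UNIV g \<Longrightarrow> Ck_bound k A f \<Longrightarrow> Ck_bound k B g \<Longrightarrow>
    Ck_bound k (2 ^ k * A * B) (\<lambda>t. f t *\<^sub>R g t)"
proof (induction k arbitrary: f g)
  case 0
  then show ?case by (auto simp: Ck_bound_0 intro!: mult_mono intro: order_trans[OF norm_ge_zero] order_trans[OF abs_ge_zero])
next
  case (Suc k)
  note f = smooth_vector_derivative[OF Suc.prems(1)] and g = smooth_vector_derivative[OF Suc.prems(2)]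
  have A: "0 \<le> A" and B: "0 \<le> B" using Suc.prems Ck_bound_nonneg by blast+
  have "Ck_bound k (2 ^ k * A * B + 2 ^ k * A * B)
      (\<lambda>t. f t *\<^sub>R vector_derivative g (at t) + vector_derivative f (at t) *\<^sub>R g t)"
    using Suc.prems f g
    by (intro Ck_bound_add Suc.IH smooth_on_scaleR) (auto simp: Ck_bound_Suc intro: Ck_bound_SucD)
  then have *: "Ck_bound k (2 ^ Suc k * A * B)
      (\<lambda>t. f t *\<^sub>R vector_derivative g (at t) + vector_derivative f (at t) *\<^sub>R g t)"
    by (simp add: algebra_simps)
  have "norm (f t *\<^sub>R g t) \<le> 2 ^ Suc k * A * B" for t
  proof -
    have "norm (f t *\<^sub>R g t) \<le> A * B"
      using Ck_bound_norm[OF Suc.prems(3), of t] Ck_bound_norm[OF Suc.prems(4), of t] A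
      by (simp add: mult_mono)
    also have "\<dots> \<le> 2 ^ Suc k * (A * B)"
      using mult_right_mono[of 1 "2 ^ Suc k" "A * B"] A B one_le_power[of "2::real" "Suc k"] by simp
    finally show ?thesis by (simp add: mult.assoc)
  qed
  with * show ?case
    by (intro Ck_bound_derivative[where f'="\<lambda>t. f t *\<^sub>R vector_derivative g (at t) + vector_derivative f (at t) *\<^sub>R g t"])
      (auto intro!: has_vector_derivative_scaleR[OF f(1)[unfolded has_real_derivative_iff_has_vector_derivative[symmetric]] g(1), simplified])
qed

lemma Ck_bound_sum:
  assumes "finite S" "\<And>b. b \<in> S \<Longrightarrow> smooth_on UNIV (f b)" "\<And>b. b \<in> S \<Longrightarrow> Ck_bound k A (f b)"
  shows "smooth_on UNIV (\<lambda>t. \<Sum>b\<in>S. f b t) \<and> Ck_bound k (real (card S) * A) (\<lambda>t. \<Sum>b\<in>S. f b t)"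
  using assms
proof (induction S)
  case empty
  then show ?case using Ck_bound_const[of k 0] by (simp add: smooth_on_const)
next
  case (insert b S)
  then show ?case using Ck_bound_add[of "f b" "\<lambda>t. \<Sum>b\<in>S. f b t" k A "real (card S) * A"]
    by (auto simp: algebra_simps intro!: smooth_on_add)
qed

text \<open>Continuity at the zero curve of \<open>w \<mapsto> F \<circ> w\<close> in the sense of
  \<open>k\<close> derivatives. The derivative of the composite is a sum of products of a coordinate
  of \<open>w'\<close>, which is small, with a partial derivative of \<open>F\<close> along
  \<open>w\<close>, which the induction hypothesis shows to be bounded. This one estimate later
  serves group multiplication, group inversion and the reciprocal.\<close>

lemma Ck_bound_compose_small:
  fixes F :: "'v::euclidean_space \<Rightarrow> 'w::real_normed_vector"
  assumes Q: "open Q" "0 \<in> Q"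
  shows "smooth_on Q F \<Longrightarrow> 0 < e \<Longrightarrow> \<exists>d>0. \<forall>w. smooth_on UNIV w \<and> Ck_bound k d w \<longrightarrow>
    (\<forall>t. w t \<in> Q) \<and> Ck_bound k e (\<lambda>t. F (w t) - F 0)"
proof (induction k arbitrary: F e)
  case 0
  have "isCont F 0" using smooth_on_continuous[OF 0(1)] Q by (simp add: continuous_on_eq_continuous_at)
  then obtain d where d: "d > 0" "\<And>x. norm x < d \<Longrightarrow> norm (F x - F 0) < e"
    using 0(2) unfolding continuous_at_eps_delta dist_norm by (metis diff_zero)
  obtain r where r: "r > 0" "ball 0 r \<subseteq> Q" using Q open_contains_ball by blast
  show ?case
  proof (intro exI[of _ "min d r / 2"] conjI allI impI)
    fix w :: "real \<Rightarrow> 'v" assume "smooth_on UNIV w \<and> Ck_bound 0 (min d r / 2) w"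
    then have w: "norm (w t) \<le> min d r / 2" for t by (simp add: Ck_bound_0)
    then have w': "norm (w t) < d" "norm (w t) < r" for t using w[of t] d r by linarith+
    then show "w t \<in> Q" for t using r by (auto simp: dist_norm)
    show "Ck_bound 0 e (\<lambda>t. F (w t) - F 0)" unfolding Ck_bound_0 using d(2)[OF w'(1)] by (auto intro: less_imp_le)
  qed (use d r in auto)
next
  case (Suc k)
  define D where "D b = (\<lambda>x. frechet_derivative F (at x) b)" for b
  have D: "smooth_on Q (D b)" if "b \<in> Basis" for b
    unfolding D_def by (rule smooth_on_frechet_derivative[OF Q(1) Suc.prems(1) that])
  \<comment> \<open>Bounds all partial derivatives of \<open>F\<close> along \<open>w\<close>: their
    values at 0, plus the deviation 1 granted by the induction hypothesis.\<close>
  define M where "M = 1 + (\<Sum>b\<in>Basis. norm (D b 0))"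
  have M1: "M \<ge> 1" unfolding M_def by (simp add: sum_nonneg)
  obtain d0 where d0: "d0 > 0" "\<And>w. smooth_on UNIV w \<Longrightarrow> Ck_bound k d0 w \<Longrightarrow>
      (\<forall>t. w t \<in> Q) \<and> Ck_bound k e (\<lambda>t. F (w t) - F 0)"
    using Suc.IH[OF Suc.prems] by blast
  have "\<forall>b\<in>Basis. \<exists>d>0. \<forall>w. smooth_on UNIV w \<and> Ck_bound k d w \<longrightarrow>
      (\<forall>t. w t \<in> Q) \<and> Ck_bound k 1 (\<lambda>t. D b (w t) - D b 0)"
    using Suc.IH[OF D] zero_less_one by blast
  then obtain db where db: "\<And>b. b \<in> Basis \<Longrightarrow> db b > 0"
    "\<And>b w. b \<in> Basis \<Longrightarrow> smooth_on UNIV w \<Longrightarrow> Ck_bound k (db b) w \<Longrightarrow> Ck_bound k 1 (\<lambda>t. D b (w t) - D b 0)"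
    by metis
  define d1 where "d1 = Min (db ` (Basis :: 'v set))"
  have d1: "d1 > 0" "\<And>b. b \<in> Basis \<Longrightarrow> d1 \<le> db b"
    unfolding d1_def using db(1) by (auto simp: Min_gr_iff)
  \<comment> \<open>The constant of the product estimate, summed over the basis, so that the
    derivative of the composite is bounded by \<open>K * d\<close>.\<close>
  define K where "K = real DIM('v) * (2 ^ k * M)"
  have K: "K > 0" unfolding K_def using M1 by simp
  define d where "d = min (min d0 d1) (e / K)"
  have "d \<le> e / K" unfolding d_def by simp
  then have "K * d \<le> e" using K by (simp add: pos_le_divide_eq mult.commute)
  moreover have "d > 0" unfolding d_def using d0(1) d1(1) K Suc.prems(2) by simp
  moreover have "d \<le> d0" "d \<le> d1" unfolding d_def by simp_all
  ultimately have d: "d > 0" "d \<le> d0" "d \<le> d1" "K * d \<le> e" by simp_all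
  show ?case
  proof (intro exI[of _ d] conjI allI impI d(1))
    fix w :: "real \<Rightarrow> 'v" assume "smooth_on UNIV w \<and> Ck_bound (Suc k) d w"
    then have w: "smooth_on UNIV w" "Ck_bound k d w" "Ck_bound k d (\<lambda>t. vector_derivative w (at t))"
      using Ck_bound_SucD[of k d w] Ck_bound_Suc[of k d w] by simp_all
    note w' = smooth_vector_derivative[OF w(1)]
    have "Ck_bound k d0 w" by (rule Ck_bound_mono[OF w(2) d(2)]) simp
    then have wQ: "w t \<in> Q" and F0: "Ck_bound k e (\<lambda>t. F (w t) - F 0)" for t using d0(2)[OF w(1)] by auto
    show "w t \<in> Q" for t by (rule wQ)
    have sD: "smooth_on UNIV (\<lambda>t. D b (w t))" if "b \<in> Basis" for b
      by (rule smooth_on_compose[OF open_UNIV Q(1) _ w(1) D[OF that]]) (use wQ in auto)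
    have DM: "Ck_bound k M (\<lambda>t. D b (w t))" if b: "b \<in> Basis" for b
    proof -
      have "Ck_bound k (db b) w" by (rule Ck_bound_mono[OF w(2)]) (use d(3) d1(2)[OF b] in auto)
      then have "Ck_bound k 1 (\<lambda>t. D b (w t) - D b 0)" by (rule db(2)[OF b w(1)])
      then have "Ck_bound k (1 + norm (D b 0)) (\<lambda>t. (D b (w t) - D b 0) + D b 0)"
        by (intro Ck_bound_add smooth_on_diff sD b smooth_on_const Ck_bound_const) auto
      moreover have "norm (D b 0) \<le> (\<Sum>b\<in>Basis. norm (D b 0))"
        by (rule member_le_sum[OF b]) auto
      ultimately show ?thesis unfolding M_def by (auto elim: Ck_bound_mono)
    qed
    have der: "((\<lambda>t. F (w t) - F 0) has_vector_derivative
        (\<Sum>b\<in>Basis. (vector_derivative w (at t) \<bullet> b) *\<^sub>R D b (w t))) (at t)" for t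
    proof -
      have "(F has_derivative frechet_derivative F (at (w t))) (at (w t))"
        by (rule smooth_on_has_derivative[OF Q(1) Suc.prems(1) wQ])
      from has_derivative_compose_expand[OF w'(1)[unfolded has_vector_derivative_def] this]
      have "((\<lambda>t. F (w t)) has_vector_derivative
        (\<Sum>b\<in>Basis. (vector_derivative w (at t) \<bullet> b) *\<^sub>R D b (w t))) (at t)"
        unfolding has_vector_derivative_def D_def by (simp add: scaleR_sum_right mult.assoc)
      then show ?thesis by (auto intro!: derivative_eq_intros)
    qed
    have "Ck_bound k (2 ^ k * d * M) (\<lambda>t. (vector_derivative w (at t) \<bullet> b) *\<^sub>R D b (w t))"
      and "smooth_on UNIV (\<lambda>t. (vector_derivative w (at t) \<bullet> b) *\<^sub>R D b (w t))" if b: "b \<in> Basis" for b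
    proof -
      have "Ck_bound k (1 * d) (\<lambda>t. vector_derivative w (at t) \<bullet> b)"
        by (rule Ck_bound_bounded_linear_comp[OF bounded_linear_inner_left _ _ w'(2) w(3)])
          (use Basis_le_norm[OF b] in auto)
      then show "Ck_bound k (2 ^ k * d * M) (\<lambda>t. (vector_derivative w (at t) \<bullet> b) *\<^sub>R D b (w t))"
        using w' b by (auto intro!: Ck_bound_scaleR sD DM smooth_on_bounded_linear_comp[OF bounded_linear_inner_left])
      show "smooth_on UNIV (\<lambda>t. (vector_derivative w (at t) \<bullet> b) *\<^sub>R D b (w t))"
        using w' b by (auto intro!: smooth_on_scaleR sD smooth_on_bounded_linear_comp[OF bounded_linear_inner_left])
    qed
    then have "Ck_bound k (real DIM('v) * (2 ^ k * d * M))
        (\<lambda>t. \<Sum>b\<in>Basis. (vector_derivative w (at t) \<bullet> b) *\<^sub>R D b (w t))"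
      by (rule Ck_bound_sum[OF finite_Basis, THEN conjunct2, rotated])
    moreover have "real DIM('v) * (2 ^ k * d * M) = K * d" unfolding K_def by simp
    ultimately have "Ck_bound k e (\<lambda>t. \<Sum>b\<in>Basis. (vector_derivative w (at t) \<bullet> b) *\<^sub>R D b (w t))"
      using d(4) by (auto elim: Ck_bound_mono)
    from Ck_bound_derivative[OF der this Ck_bound_norm[OF F0]]
    show "Ck_bound (Suc k) e (\<lambda>t. F (w t) - F 0)" .
  qed
qed


lemma Ck_bound_mult:
  fixes f g :: "real \<Rightarrow> real"
  shows "smooth_on UNIV f \<Longrightarrow> smooth_on UNIV g \<Longrightarrow> Ck_bound k A f \<Longrightarrow> Ck_bound k B g \<Longrightarrow>
    Ck_bound k (2 ^ k * A * B) (\<lambda>t. f t * g t)"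
  using Ck_bound_scaleR[of f g k A B] by simp

lemma smooth_on_real_derivative:
  fixes f :: "real \<Rightarrow> real"
  assumes "open S" "smooth_on S f"
  shows "x \<in> S \<Longrightarrow> (f has_real_derivative deriv f x) (at x)" "smooth_on S (deriv f)"
proof -
  have d: "(f has_real_derivative vector_derivative f (at x)) (at x)" if "x \<in> S" for x
    using smooth_on_has_vector_derivative[OF assms that] by (simp add: has_real_derivative_iff_has_vector_derivative)
  then have e: "vector_derivative f (at x) = deriv f x" if "x \<in> S" for x
    using DERIV_imp_deriv[OF d[OF that]] by simp
  show "(f has_real_derivative deriv f x) (at x)" if "x \<in> S" using d[OF that] e[OF that] by simp
  show "smooth_on S (deriv f)"
    by (rule smooth_on_cong[OF assms(1) e smooth_on_vector_derivative[OF assms]])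
qed

lemma Ck_on_SucI_real:
  fixes f :: "real \<Rightarrow> real"
  assumes "open S" "\<And>x. x \<in> S \<Longrightarrow> (f has_real_derivative f' x) (at x)" "Ck_on k f' S"
  shows "Ck_on (Suc k) f S"
  using Ck_on_SucI_vector[OF assms(1) _ assms(3)] assms(2)
  by (simp add: has_real_derivative_iff_has_vector_derivative)

text \<open>The inner map will be a diffeomorphism of the line, which is unbounded, so bounds are
  imposed on its derivative only, one order lower; the clause \<open>k = Suc l\<close> demands
  nothing at order 0. The constant depends on \<open>k\<close> alone.\<close>

lemma Ck_bound_compose:
  "\<exists>C\<ge>0. \<forall>(u::real\<Rightarrow>real) g A. smooth_on UNIV u \<and> smooth_on UNIV g \<and>
    (\<forall>l. k = Suc l \<longrightarrow> Ck_bound l 2 (deriv g)) \<and> Ck_bound k A u \<longrightarrow> Ck_bound k (C * A) (\<lambda>t. u (g t))"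
proof (induction k)
  case 0
  then show ?case by (intro exI[of _ 1]) (simp add: Ck_bound_0)
next
  case (Suc k)
  then obtain C where C0: "C \<ge> 0" and C1: "\<forall>(u::real\<Rightarrow>real) g A. smooth_on UNIV u \<and> smooth_on UNIV g \<and>
      (\<forall>l. k = Suc l \<longrightarrow> Ck_bound l 2 (deriv g)) \<and> Ck_bound k A u \<longrightarrow> Ck_bound k (C * A) (\<lambda>t. u (g t))" by blast
  have C: "Ck_bound k (C * A) (\<lambda>t. u (g t))" if "smooth_on UNIV u" "smooth_on UNIV g"
      "Ck_bound k 2 (deriv g)" "Ck_bound k A u" for u g :: "real \<Rightarrow> real" and A
    using C1[rule_format, of u g A] that Ck_bound_SucD by blast
  \<comment> \<open>The 1 serves the values of the composite, the other entry the product estimate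
    for its derivative.\<close>
  define C' where "C' = max 1 (2 ^ k * (2 * C))"
  show ?case
  proof (intro exI[of _ C'] conjI allI impI)
    show "0 \<le> C'" by (simp add: C'_def)
    fix u g :: "real \<Rightarrow> real" and A
    assume H: "smooth_on UNIV u \<and> smooth_on UNIV g \<and>
      (\<forall>l. Suc k = Suc l \<longrightarrow> Ck_bound l 2 (deriv g)) \<and> Ck_bound (Suc k) A u"
    then have u: "smooth_on UNIV u" and g: "smooth_on UNIV g" and g2: "Ck_bound k 2 (deriv g)"
      and uA: "Ck_bound (Suc k) A u" by blast+
    have A0: "0 \<le> A" using uA by (rule Ck_bound_nonneg)
    note u' = smooth_on_real_derivative[OF open_UNIV u] and g' = smooth_on_real_derivative[OF open_UNIV g]
    have "(\<lambda>t. vector_derivative u (at t)) = deriv u"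
      using u'(1) by (intro ext vector_derivative_at) (simp add: has_real_derivative_iff_has_vector_derivative)
    then have u'A: "Ck_bound k A (deriv u)" using uA by (simp add: Ck_bound_Suc)
    have "smooth_on UNIV (\<lambda>t. deriv u (g t))"
      by (rule smooth_on_compose[OF open_UNIV open_UNIV _ g u'(2)]) simp
    then have "Ck_bound k (2 ^ k * 2 * (C * A)) (\<lambda>t. deriv g t * deriv u (g t))"
      by (intro Ck_bound_mult g'(2) g2 C u'(2) g u'A)
    then have b: "Ck_bound k (C' * A) (\<lambda>t. deriv g t * deriv u (g t))"
    proof (rule Ck_bound_mono)
      have "2 ^ k * (2 * C) * A \<le> C' * A" by (rule mult_right_mono) (simp_all add: C'_def A0)
      then show "2 ^ k * 2 * (C * A) \<le> C' * A" by (simp add: mult.assoc)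
    qed simp
    have n: "norm (u (g t)) \<le> C' * A" for t
    proof -
      have "norm (u (g t)) \<le> 1 * A" using Ck_bound_norm[OF uA] by simp
      also have "\<dots> \<le> C' * A" by (rule mult_right_mono) (simp_all add: C'_def A0)
      finally show ?thesis .
    qed
    have "((\<lambda>t. u (g t)) has_real_derivative deriv u (g t) * deriv g t) (at t)" for t
      using DERIV_chain2[OF u'(1) g'(1)] by simp
    then have "((\<lambda>t. u (g t)) has_vector_derivative deriv g t * deriv u (g t)) (at t)" for t
      by (simp add: has_real_derivative_iff_has_vector_derivative mult.commute)
    from Ck_bound_derivative[OF this b n] show "Ck_bound (Suc k) (C' * A) (\<lambda>t. u (g t))" .
  qed
qed

lemma smooth_on_inverse: "smooth_on {0<..} (\<lambda>x::real. inverse x)"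
proof -
  \<comment> \<open>Multiples of all positive powers are treated together, because this family is
    closed under differentiation.\<close>
  have "Ck_on k (\<lambda>x::real. c * inverse x ^ Suc n) {0<..}" for k n c
  proof (induction k arbitrary: n c)
    case 0
    show ?case by (auto intro!: continuous_intros)
  next
    case (Suc k)
    show ?case
    proof (rule Ck_on_SucI_real[OF open_greaterThan])
      show "((\<lambda>x. c * inverse x ^ Suc n) has_real_derivative (- c * real (Suc n)) * inverse x ^ Suc (Suc n)) (at x)"
        if "x \<in> {0<..}" for x :: real
      proof -
        have "(inverse has_real_derivative - (inverse x ^ Suc (Suc 0))) (at x)"
          using that by (intro DERIV_inverse) simp
        from DERIV_cmult[OF DERIV_power[OF this, of "Suc n"], of c]
        show ?thesis by (rule DERIV_cong) (simp add: mult_ac)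
      qed
      show "Ck_on k (\<lambda>x. (- c * real (Suc n)) * inverse x ^ Suc (Suc n)) {0<..}" by (rule Suc)
    qed
  qed
  from this[of _ 1 0] show ?thesis by (simp add: smooth_on_def)
qed


section \<open>Cut-offs along disjoint open sets and neighbourhoods of the unit\<close>

lemma nderiv_cong_open:
  assumes T: "open T"
  shows "(\<And>s. s \<in> T \<Longrightarrow> f s = g s) \<Longrightarrow> t \<in> T \<Longrightarrow> nderiv j f t = nderiv j g t"
proof (induction j arbitrary: f g t)
  case (Suc j)
  have "vector_derivative f (at s) = vector_derivative g (at s)" if "s \<in> T" for s
    by (rule vector_derivative_cong_eq) (use Suc.prems(1) T that in \<open>auto simp: eventually_nhds\<close>)
  from Suc.IH[OF this Suc.prems(2)] show ?case by (simp add: nderiv_Suc)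
qed simp

lemma nderiv_zero: "nderiv j (\<lambda>t. 0) t = 0"
  using Ck_bound_const[of j 0] unfolding Ck_bound_def by (auto dest: spec[of _ j])

lemma nderiv_diff:
  "smooth_on UNIV f \<Longrightarrow> smooth_on UNIV g \<Longrightarrow> nderiv j (\<lambda>t. f t - g t) t = nderiv j f t - nderiv j g t"
proof (induction j arbitrary: f g)
  case (Suc j)
  note f = smooth_vector_derivative[OF Suc.prems(1)] and g = smooth_vector_derivative[OF Suc.prems(2)]
  have "(\<lambda>t. vector_derivative (\<lambda>t. f t - g t) (at t)) = (\<lambda>t. vector_derivative f (at t) - vector_derivative g (at t))"
    using vector_derivative_at[OF has_vector_derivative_diff[OF f(1) g(1)]] by (rule ext)
  then show ?case using Suc.IH[OF f(2) g(2)] by (simp add: nderiv_Suc)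
qed simp

text \<open>Meant for functions cut off to one part of a split support. Since the cut takes place
  where the function vanishes identically, the bound passes over with the same constant.\<close>

lemma Ck_bound_if_zero:
  assumes loc: "\<And>t. \<exists>T. open T \<and> t \<in> T \<and> ((\<forall>s\<in>T. f s = g s) \<or> (\<forall>s\<in>T. f s = 0))" and g: "Ck_bound k M g"
  shows "Ck_bound k M f"
  unfolding Ck_bound_def
proof (intro allI impI)
  fix j t assume j: "j \<le> k"
  obtain T where T: "open T" "t \<in> T" "(\<forall>s\<in>T. f s = g s) \<or> (\<forall>s\<in>T. f s = 0)" using loc by blast
  from T(3) have "nderiv j f t = nderiv j g t \<or> nderiv j f t = nderiv j (\<lambda>t. 0) t"
    using nderiv_cong_open[OF T(1) _ T(2), of f g j] nderiv_cong_open[OF T(1) _ T(2), of f "\<lambda>t. 0" j] by blast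
  then show "norm (nderiv j f t) \<le> M"
    using g j Ck_bound_nonneg[OF g] unfolding Ck_bound_def nderiv_zero by auto
qed

text \<open>The sets \<open>B k e x\<close> are not known to be open, so the interior of
  \<open>V\<close> is constructed as the set of points \<open>x\<close> with \<open>Q x V\<close>;
  the triangle condition shows that it is open. Near the unit, the strict relation
  \<open>near\<close> is then replaced by the non-strict \<open>small\<close>.\<close>

lemma nhd_of_one_near_topology:
  fixes \<Gamma> :: "('a, 'm) top_group_scheme" (structure)
  assumes topo: "topo \<Gamma> = near_topology (carrier \<Gamma>) near" and one: "\<one> \<in> carrier \<Gamma>"
    and mono: "\<And>k k' e e' x y. near k' e' x y \<Longrightarrow> k \<le> k' \<Longrightarrow> e' \<le> e \<Longrightarrow> near k e x y"
    and refl: "\<And>k e x. x \<in> carrier \<Gamma> \<Longrightarrow> 0 < e \<Longrightarrow> near k e x x"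
    and triangle: "\<And>k e x. x \<in> carrier \<Gamma> \<Longrightarrow> 0 < e \<Longrightarrow> \<exists>k' e'. 0 < e' \<and>
      (\<forall>y\<in>carrier \<Gamma>. \<forall>z\<in>carrier \<Gamma>. near k' e' x y \<longrightarrow> near k' e' y z \<longrightarrow> near k e x z)"
    and small: "\<And>k e x. x \<in> carrier \<Gamma> \<Longrightarrow> near k e \<one> x \<Longrightarrow> small k e x"
      "\<And>k e d x. x \<in> carrier \<Gamma> \<Longrightarrow> small k d x \<Longrightarrow> d < e \<Longrightarrow> near k e \<one> x"
  shows "nhd_of_one \<Gamma> V \<longleftrightarrow> V \<subseteq> carrier \<Gamma> \<and> (\<exists>k. \<exists>e>0. \<forall>x\<in>carrier \<Gamma>. small k e x \<longrightarrow> x \<in> V)"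
proof -
  define B where "B k e x = {y \<in> carrier \<Gamma>. near k e x y}" for k e x
  define Q where "Q x S \<longleftrightarrow> (\<exists>k. \<exists>e>0. B k e x \<subseteq> S)" for x S
  have op: "openin (topo \<Gamma>) S \<longleftrightarrow> S \<subseteq> carrier \<Gamma> \<and> (\<forall>x\<in>S. Q x S)" for S
  proof -
    have "B k e x \<subseteq> S \<longleftrightarrow> (\<forall>y\<in>carrier \<Gamma>. near k e x y \<longrightarrow> y \<in> S)" for k e x unfolding B_def by blast
    then show ?thesis unfolding topo Q_def by (subst openin_near_topology) (erule (2) mono, simp)
  qed
  have Q_mono: "Q x S \<Longrightarrow> S \<subseteq> T \<Longrightarrow> Q x T" for x S T unfolding Q_def by blast
  have Q_mem: "x \<in> S" if "x \<in> carrier \<Gamma>" "Q x S" for x S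
    using that refl unfolding Q_def B_def by auto
  have Q_Q: "Q x {y \<in> carrier \<Gamma>. Q y S}" if x: "x \<in> carrier \<Gamma>" and "Q x S" for x S
  proof -
    obtain k e where k: "0 < e" "B k e x \<subseteq> S" using \<open>Q x S\<close> unfolding Q_def by blast
    obtain k' e' where k': "0 < e'"
      "\<forall>y\<in>carrier \<Gamma>. \<forall>z\<in>carrier \<Gamma>. near k' e' x y \<longrightarrow> near k' e' y z \<longrightarrow> near k e x z"
      using triangle[OF x k(1), of k] by (elim exE conjE) (rule that)
    then have "B k' e' y \<subseteq> B k e x" if "y \<in> B k' e' x" for y using that unfolding B_def by auto
    then have "Q y S" if "y \<in> B k' e' x" for y
      using that k(2) k'(1) unfolding Q_def by (intro exI[of _ k'] exI[of _ e']) blast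
    then have "B k' e' x \<subseteq> {y \<in> carrier \<Gamma>. Q y S}" by (auto simp: B_def)
    then show ?thesis using k'(1) unfolding Q_def by blast
  qed
  have "nhd_of_one \<Gamma> V \<longleftrightarrow> V \<subseteq> carrier \<Gamma> \<and> Q \<one> V"
  proof
    assume "nhd_of_one \<Gamma> V"
    then obtain S where "V \<subseteq> carrier \<Gamma>" "\<forall>x\<in>S. Q x S" "\<one> \<in> S" "S \<subseteq> V"
      unfolding nhd_of_one_def op by (elim conjE exE) (rule that)
    then show "V \<subseteq> carrier \<Gamma> \<and> Q \<one> V" using Q_mono by blast
  next
    assume V: "V \<subseteq> carrier \<Gamma> \<and> Q \<one> V"
    have "openin (topo \<Gamma>) {x \<in> carrier \<Gamma>. Q x V}" unfolding op using Q_Q by auto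
    then show "nhd_of_one \<Gamma> V" unfolding nhd_of_one_def using V one Q_mem
      by (intro conjI exI[of _ "{x \<in> carrier \<Gamma>. Q x V}"]) auto
  qed
  also have "Q \<one> V \<longleftrightarrow> (\<exists>k. \<exists>e>0. \<forall>x\<in>carrier \<Gamma>. small k e x \<longrightarrow> x \<in> V)"
  proof
    assume "Q \<one> V"
    then obtain k e where "0 < e" "B k e \<one> \<subseteq> V" unfolding Q_def by blast
    \<comment> \<open>Halving \<open>e\<close> passes from the strict estimate to the non-strict
      one.\<close>
    then have "\<forall>x\<in>carrier \<Gamma>. small k (e / 2) x \<longrightarrow> x \<in> V" "0 < e / 2"
      using small(2)[of _ k "e / 2" e] unfolding B_def by auto
    then show "\<exists>k. \<exists>e>0. \<forall>x\<in>carrier \<Gamma>. small k e x \<longrightarrow> x \<in> V" by blast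
  next
    assume "\<exists>k. \<exists>e>0. \<forall>x\<in>carrier \<Gamma>. small k e x \<longrightarrow> x \<in> V"
    then obtain k e where "0 < e" "\<forall>x\<in>carrier \<Gamma>. small k e x \<longrightarrow> x \<in> V" by blast
    then show "Q \<one> V" unfolding Q_def B_def using small(1) by (intro exI[of _ k] exI[of _ e]) auto
  qed
  finally show ?thesis .
qed

text \<open>A point over \<open>A\<close> has a neighbourhood over \<open>A\<close>, a point over
  \<open>B\<close> one over \<open>B\<close> and thus away from \<open>A\<close>, and any other
  point one that avoids the closed set \<open>K\<close>.\<close>

lemma circle_split_nhds:
  assumes "openin (top_of_set circle) A" "openin (top_of_set circle) B" "A \<inter> B = {}" "closed K" "K \<subseteq> A \<union> B"
  shows "\<exists>T. open T \<and> t \<in> T \<and> ((\<forall>s\<in>T. cis s \<in> A) \<or> (\<forall>s\<in>T. cis s \<notin> A \<or> cis s \<notin> K))"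
proof -
  have op: "open {s. cis s \<in> A}" if A: "openin (top_of_set circle) A" for A
  proof -
    obtain A' where "open A'" "A = circle \<inter> A'" using A unfolding openin_open by blast
    then have "{s. cis s \<in> A} = cis -` A'" by auto
    moreover have "open (cis -` A')" by (rule open_vimage[OF \<open>open A'\<close>]) (intro continuous_intros)
    ultimately show ?thesis by simp
  qed
  have K: "open {s. cis s \<notin> K}"
  proof -
    have "open (cis -` (- K))" by (rule open_vimage) (use assms(4) in \<open>auto intro: continuous_intros\<close>)
    moreover have "cis -` (- K) = {s. cis s \<notin> K}" by auto
    ultimately show ?thesis by simp
  qed
  consider "cis t \<in> A" | "cis t \<in> B" | "cis t \<notin> K" using assms(5) by blast
  then show ?thesis
  proof cases
    case 1
    then show ?thesis using op[OF assms(1)] by (intro exI[of _ "{s. cis s \<in> A}"]) auto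
  next
    case 2
    then show ?thesis using op[OF assms(2)] assms(3) by (intro exI[of _ "{s. cis s \<in> B}"]) auto
  next
    case 3
    then show ?thesis using K by (intro exI[of _ "{s. cis s \<notin> K}"]) auto
  qed
qed

text \<open>Here \<open>d\<close> is the neutral value, the identity map for diffeomorphisms and the
  unit for loops. The support of \<open>y\<close> stays in \<open>A\<close>: it lies in
  \<open>A \<union> B\<close>, and it cannot reach the open set \<open>B\<close>, which is disjoint
  from the points where \<open>y\<close> differs from \<open>d\<close>.\<close>

lemma circle_cutoff:
  assumes A: "openin (top_of_set circle) A" and B: "openin (top_of_set circle) B" and AB: "A \<inter> B = {}"
    and K: "closure (cis ` {t. x t \<noteq> d t}) \<subseteq> A \<union> B" and y: "y = (\<lambda>t. if cis t \<in> A then x t else d t)"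
  shows "\<exists>T. open T \<and> t \<in> T \<and> ((\<forall>s\<in>T. y s = x s) \<or> (\<forall>s\<in>T. y s = d s))"
    and "closure (cis ` {t. y t \<noteq> d t}) \<subseteq> A" and "cis t \<notin> A \<Longrightarrow> cis t \<notin> B \<Longrightarrow> x t = d t"
proof -
  let ?K = "closure (cis ` {t. x t \<noteq> d t})" and ?S = "cis ` {t. y t \<noteq> d t}"
  have inK: "cis t \<in> ?K" if "x t \<noteq> d t" for t
    by (rule subsetD[OF closure_subset]) (use that in blast)
  show "cis t \<notin> A \<Longrightarrow> cis t \<notin> B \<Longrightarrow> x t = d t" using inK[of t] K by blast
  obtain T where T: "open T" "t \<in> T" "(\<forall>s\<in>T. cis s \<in> A) \<or> (\<forall>s\<in>T. cis s \<notin> A \<or> cis s \<notin> ?K)"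
    using circle_split_nhds[OF A B AB closed_closure K, of t] by blast
  then have "(\<forall>s\<in>T. y s = x s) \<or> (\<forall>s\<in>T. y s = d s)" unfolding y using inK by auto
  then show "\<exists>T. open T \<and> t \<in> T \<and> ((\<forall>s\<in>T. y s = x s) \<or> (\<forall>s\<in>T. y s = d s))" using T by blast
  obtain B' where B': "open B'" "B = circle \<inter> B'" using B unfolding openin_open by blast
  have S: "?S \<subseteq> ?K" "?S \<subseteq> A" "?S \<subseteq> circle" unfolding y using inK by (auto split: if_splits)
  then have "?S \<inter> B' = {}" using AB B' by fast
  then have "closure ?S \<subseteq> ?K - B'"
    using S B' by (intro closure_minimal closed_Diff) auto
  moreover have "?K \<subseteq> circle" by (intro closure_minimal) auto
  ultimately show "closure ?S \<subseteq> A" using K B' by blast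
qed

text \<open>The factors of a split element satisfy the same bound \<open>small k e\<close>, so one
  set of small elements works for all \<open>A\<close> and \<open>B\<close> at once.\<close>

lemma localizable_groupI:
  fixes \<Gamma> :: "('x, 'm) supp_group_scheme" (structure)
  assumes grp: "group \<Gamma>"
    and nhd: "\<And>V. nhd_of_one \<Gamma> V \<longleftrightarrow> V \<subseteq> carrier \<Gamma> \<and> (\<exists>k. \<exists>e>0. \<forall>x\<in>carrier \<Gamma>. small k e x \<longrightarrow> x \<in> V)"
    and mult: "\<And>(k::nat) e::real. 0 < e \<Longrightarrow> \<exists>l. \<exists>d>0. \<forall>x\<in>carrier \<Gamma>. \<forall>y\<in>carrier \<Gamma>.
      small l d x \<longrightarrow> small l d y \<longrightarrow> small k e (x \<otimes> y)"
    and inv: "\<And>k e. 0 < e \<Longrightarrow> \<exists>l. \<exists>d>0. \<forall>x\<in>carrier \<Gamma>. small l d x \<longrightarrow> small k e (inv x)"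
    and supp: "\<And>x y. x \<in> carrier \<Gamma> \<Longrightarrow> y \<in> carrier \<Gamma> \<Longrightarrow> supp \<Gamma> (x \<otimes> y) \<subseteq> supp \<Gamma> x \<union> supp \<Gamma> y"
      "\<And>x. x \<in> carrier \<Gamma> \<Longrightarrow> supp \<Gamma> (inv x) \<subseteq> supp \<Gamma> x"
    and split: "\<And>A B x k e. \<lbrakk>openin (top_of_set circle) A; openin (top_of_set circle) B; A \<inter> B = {};
      x \<in> carrier \<Gamma>; supp \<Gamma> x \<subseteq> A \<union> B; small k e x\<rbrakk> \<Longrightarrow>
      \<exists>y z. y \<in> localized \<Gamma> A \<and> small k e y \<and> z \<in> localized \<Gamma> B \<and> small k e z \<and> x = y \<otimes> z"
  shows "localizable_group \<Gamma>"
proof -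
  interpret group \<Gamma> by (rule grp)
  show ?thesis
  proof
    fix V assume "nhd_of_one \<Gamma> V"
    then obtain k e where e: "e > 0" and "\<forall>x\<in>carrier \<Gamma>. small k e x \<longrightarrow> x \<in> V"
      unfolding nhd by (elim exE conjE) (rule that)
    then have kV: "x \<in> V" if "x \<in> carrier \<Gamma>" "small k e x" for x using that by simp
    define D where "D l d = {x \<in> carrier \<Gamma>. small l d x}" for l d
    have D: "nhd_of_one \<Gamma> (D l d)" if "d > 0" for l d
      unfolding nhd D_def by (intro conjI exI[of _ l] exI[of _ d]) (use that in auto)
    obtain l d where d: "d > 0" "\<forall>x\<in>carrier \<Gamma>. \<forall>y\<in>carrier \<Gamma>. small l d x \<longrightarrow> small l d y \<longrightarrow> small k e (x \<otimes> y)"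
      using mult[OF e, of k] by (elim exE conjE) (rule that)
    then have "\<forall>x\<in>D l d. \<forall>y\<in>D l d. x \<otimes> y \<in> V" by (simp add: D_def kV)
    then show "\<exists>V'. nhd_of_one \<Gamma> V' \<and> (\<forall>x\<in>V'. \<forall>y\<in>V'. x \<otimes> y \<in> V)" using D[OF d(1)] by blast
    obtain l d where d: "d > 0" "\<forall>x\<in>carrier \<Gamma>. small l d x \<longrightarrow> small k e (inv x)"
      using inv[OF e, of k] by (elim exE conjE) (rule that)
    then have "\<forall>x\<in>D l d. inv x \<in> V" by (simp add: D_def kV)
    then show "\<exists>V'. nhd_of_one \<Gamma> V' \<and> (\<forall>x\<in>V'. inv x \<in> V)" using D[OF d(1)] by blast
    have "\<exists>y\<in>V \<inter> localized \<Gamma> A. \<exists>z\<in>V \<inter> localized \<Gamma> B. x = y \<otimes> z"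
      if H: "openin (top_of_set circle) A \<and> openin (top_of_set circle) B \<and> A \<inter> B = {} \<and>
        x \<in> D k e \<and> supp \<Gamma> x \<subseteq> A \<union> B" for A B x
    proof -
      obtain y z where yz: "y \<in> localized \<Gamma> A" "small k e y" "z \<in> localized \<Gamma> B" "small k e z" "x = y \<otimes> z"
        using split[of A B x k e] H unfolding D_def by (elim exE conjE) (auto intro: that)
      then have "y \<in> V" "z \<in> V" using kV by (simp_all add: localized_def)
      then show ?thesis using yz by blast
    qed
    then show "\<exists>V'. nhd_of_one \<Gamma> V' \<and>
        (\<forall>A B x. openin (top_of_set circle) A \<and> openin (top_of_set circle) B \<and> A \<inter> B = {} \<and>
          x \<in> V' \<and> supp \<Gamma> x \<subseteq> A \<union> B \<longrightarrow> (\<exists>y\<in>V \<inter> localized \<Gamma> A. \<exists>z\<in>V \<inter> localized \<Gamma> B. x = y \<otimes> z))"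
      using D[OF e] by (intro exI[of _ "D k e"] conjI allI impI)
  qed (use supp in simp_all)
qed

section \<open>Diffeomorphisms\<close>

abbreviation Diff :: "(real \<Rightarrow> real) set" where "Diff \<equiv> carrier Diff_cover"

lemma Diff_cover_simps [simp]:
  "mult Diff_cover = (\<circ>)" "one Diff_cover = id"
  "supp Diff_cover = (\<lambda>f. closure (cis ` {t. f t \<noteq> t}))"
  "topo Diff_cover = near_topology (Diff)
     (\<lambda>k e f g. \<forall>j\<le>k. \<forall>t. \<bar>nderiv j g t - nderiv j f t\<bar> < e)"
  by (simp_all add: Diff_cover_def Let_def)

lemma carrier_Diff_cover:
  "f \<in> Diff \<longleftrightarrow> smooth_on UNIV f \<and> (\<forall>t. f (t + 2 * pi) = f t + 2 * pi) \<and> (\<forall>t. deriv f t > 0)"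
  by (simp add: Diff_cover_def Let_def)

lemma Diff_coverD:
  assumes "f \<in> Diff"
  shows "smooth_on UNIV f" "f (t + 2 * pi) = f t + 2 * pi" "deriv f t > 0"
    "(f has_real_derivative deriv f t) (at t)" "isCont f t"
proof -
  show s: "smooth_on UNIV f" "f (t + 2 * pi) = f t + 2 * pi" "deriv f t > 0"
    using assms unfolding carrier_Diff_cover by blast+
  show d: "(f has_real_derivative deriv f t) (at t)"
    by (rule smooth_on_real_derivative(1)[OF open_UNIV s(1)]) simp
  show "isCont f t" using d by (rule DERIV_isCont)
qed

lemma Diff_coverI:
  assumes "smooth_on UNIV f" "\<And>t. f (t + 2 * pi) = f t + 2 * pi"
    "\<And>t. \<exists>d>0. (f has_real_derivative d) (at t)"
  shows "f \<in> Diff"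
  unfolding carrier_Diff_cover
proof (intro conjI allI assms(1,2))
  fix t
  obtain d where "d > 0" "(f has_real_derivative d) (at t)" using assms(3) by blast
  then show "deriv f t > 0" by (simp add: DERIV_imp_deriv)
qed

lemma Diff_cover_strict_mono:
  assumes "f \<in> Diff"
  shows "strict_mono f"
proof (rule strict_monoI)
  fix s t :: real assume "s < t"
  then show "f s < f t"
    by (rule DERIV_pos_imp_increasing) (intro exI conjI, rule Diff_coverD(4)[OF assms], rule Diff_coverD(3)[OF assms])
qed

lemma Diff_cover_shift:
  assumes "f \<in> Diff"
  shows "f (t + 2 * pi * real n) = f t + 2 * pi * real n"
proof (induction n)
  case (Suc n)
  have "f (t + 2 * pi * real (Suc n)) = f ((t + 2 * pi * real n) + 2 * pi)" by (simp add: algebra_simps)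
  also have "\<dots> = f t + 2 * pi * real (Suc n)" unfolding Diff_coverD(2)[OF assms] Suc by (simp add: algebra_simps)
  finally show ?case .
qed simp

text \<open>The shift relation pushes the values at \<open>2 * pi * n\<close> and
  \<open>- 2 * pi * n\<close> beyond any given number; the intermediate value theorem does the
  rest.\<close>

lemma Diff_cover_surj:
  assumes "f \<in> Diff"
  shows "surj f"
proof -
  have "\<exists>x. f x = y" for y
  proof -
    obtain n :: nat where n: "\<bar>y - f 0\<bar> < real n" using reals_Archimedean2 by blast
    also have "real n \<le> 2 * pi * real n" using mult_right_mono[of 1 "2 * pi" "real n"] pi_gt3 by simp
    finally have n: "\<bar>y - f 0\<bar> < 2 * pi * real n" .
    have "f (2 * pi * real n) = f 0 + 2 * pi * real n" using Diff_cover_shift[OF assms, of 0 n] by simp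
    moreover have "f (- 2 * pi * real n) = f 0 - 2 * pi * real n"
      using Diff_cover_shift[OF assms, of "- 2 * pi * real n" n] by simp
    ultimately have "f (- 2 * pi * real n) \<le> y" "y \<le> f (2 * pi * real n)" using n by auto
    then have "\<exists>x\<ge>- 2 * pi * real n. x \<le> 2 * pi * real n \<and> f x = y"
      using Diff_coverD(5)[OF assms] by (intro IVT) auto
    then show ?thesis by blast
  qed
  then show ?thesis by (metis surjI)
qed

lemma Diff_cover_comp:
  assumes "f \<in> Diff" "g \<in> Diff"
  shows "f \<circ> g \<in> Diff"
proof (rule Diff_coverI)
  show "smooth_on UNIV (f \<circ> g)" unfolding comp_def
    by (rule smooth_on_compose[OF open_UNIV open_UNIV _ Diff_coverD(1)[OF assms(2)] Diff_coverD(1)[OF assms(1)]]) simp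
  show "(f \<circ> g) (t + 2 * pi) = (f \<circ> g) t + 2 * pi" for t
    by (simp add: Diff_coverD(2)[OF assms(2)] Diff_coverD(2)[OF assms(1)])
  show "\<exists>d>0. ((f \<circ> g) has_real_derivative d) (at t)" for t
    using DERIV_chain2[OF Diff_coverD(4)[OF assms(1)] Diff_coverD(4)[OF assms(2)]]
      Diff_coverD(3)[OF assms(1)] Diff_coverD(3)[OF assms(2)]
    by (intro exI[of _ "deriv f (g t) * deriv g t"]) (simp add: comp_def)
qed

text \<open>Smoothness is bootstrapped from \<open>h' = 1 / (f' \<circ> h)\<close>: if
  \<open>h\<close> has \<open>k\<close> continuous derivatives, so has the right-hand side, and
  \<open>h\<close> gains one.\<close>

lemma Diff_cover_inv:
  assumes "f \<in> Diff"
  obtains h where "h \<in> Diff" "\<And>t. f (h t) = t" "\<And>t. h (f t) = t"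
    "\<And>t. (h has_real_derivative inverse (deriv f (h t))) (at t)"
proof -
  define h where "h = inv_into UNIV f"
  have inj: "inj f" using Diff_cover_strict_mono[OF assms] by (rule strict_mono_imp_inj_on)
  have fh: "f (h t) = t" and hf: "h (f t) = t" for t
    unfolding h_def using inj Diff_cover_surj[OF assms] by (simp_all add: surj_f_inv_f)
  have cont: "isCont h t" for t
    using isCont_inverse_function[where f=f and g=h and x="h t" and d=1] hf Diff_coverD(5)[OF assms]
    by (simp add: fh)
  have der: "(h has_real_derivative inverse (deriv f (h t))) (at t)" for t
    by (rule DERIV_inverse_function[where f=f and a="t - 1" and b="t + 1"])
      (use Diff_coverD(3,4)[OF assms, of "h t"] cont fh in auto)
  have "Ck_on k h UNIV" for k
  proof (induction k)
    case 0
    show ?case using cont by (simp add: continuous_at_imp_continuous_on)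
  next
    case (Suc k)
    have "Ck_on k (deriv f) UNIV"
      using smooth_on_real_derivative(2)[OF open_UNIV Diff_coverD(1)[OF assms]] by (simp add: smooth_on_def)
    then have "Ck_on k (\<lambda>t. deriv f (h t)) UNIV"
      by (intro Ck_on_compose[OF open_UNIV open_UNIV _ Suc]) simp_all
    then have "Ck_on k (\<lambda>t. inverse (deriv f (h t))) UNIV"
      using smooth_on_inverse Diff_coverD(3)[OF assms]
      by (intro Ck_on_compose[OF open_UNIV open_greaterThan[of 0], where g=inverse]) (auto simp: smooth_on_def)
    then show ?case by (rule Ck_on_SucI_real[OF open_UNIV der])
  qed
  then have "smooth_on UNIV h" by (simp add: smooth_on_def)
  moreover have "h (t + 2 * pi) = h t + 2 * pi" for t
    using Diff_coverD(2)[OF assms, of "h t"] fh hf by metis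
  moreover have "\<exists>d>0. (h has_real_derivative d) (at t)" for t
    using der[of t] Diff_coverD(3)[OF assms, of "h t"] by (intro exI[of _ "inverse (deriv f (h t))"]) simp
  ultimately have "h \<in> Diff" by (rule Diff_coverI)
  then show thesis using that fh hf der by blast
qed

lemma id_Diff_cover: "id \<in> Diff"
  by (rule Diff_coverI) (auto simp: id_def intro: smooth_on_id intro!: exI[of _ 1])

lemma group_Diff_cover: "group Diff_cover"
proof (rule groupI)
  show "\<exists>h\<in>Diff. h \<otimes>\<^bsub>Diff_cover\<^esub> f = \<one>\<^bsub>Diff_cover\<^esub>" if "f \<in> Diff" for f
    using Diff_cover_inv[OF that] by (metis Diff_cover_simps(1,2) comp_apply eq_id_iff)
qed (auto intro: Diff_cover_comp id_Diff_cover simp: comp_assoc)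

lemma Diff_cover_inv_eq:
  assumes "f \<in> Diff" "h \<in> Diff" "\<And>t. h (f t) = t"
  shows "inv\<^bsub>Diff_cover\<^esub> f = h"
  using assms by (intro group.inv_equality[OF group_Diff_cover]) auto

lemma Diff_cover_nhd:
  "nhd_of_one Diff_cover V \<longleftrightarrow> V \<subseteq> Diff \<and>
    (\<exists>k. \<exists>e>0. \<forall>f\<in>Diff. Ck_bound k e (\<lambda>t. f t - t) \<longrightarrow> f \<in> V)"
proof -
  define near where "near k e f g \<longleftrightarrow> (\<forall>j\<le>k. \<forall>t. \<bar>nderiv j g t - nderiv j f t\<bar> < e)"
    for k e and f g :: "real \<Rightarrow> real"
  have near_one: "near k e \<one>\<^bsub>Diff_cover\<^esub> f \<longleftrightarrow> (\<forall>j\<le>k. \<forall>t. norm (nderiv j (\<lambda>t. f t - t) t) < e)"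
    if "f \<in> Diff" for k e f
    unfolding near_def using nderiv_diff[OF Diff_coverD(1)[OF that] smooth_on_id[OF open_UNIV]]
    by (simp add: id_def)
  show ?thesis
  proof (rule nhd_of_one_near_topology)
    show "topo Diff_cover = near_topology (Diff) near" unfolding near_def by simp
    show "near k e x y" if near: "near k' e' x y" and "k \<le> k'" "e' \<le> e" for k k' e e' x y
      unfolding near_def
    proof (intro allI impI)
      fix j t assume "j \<le> k"
      then have "\<bar>nderiv j y t - nderiv j x t\<bar> < e'" using near that(2) unfolding near_def by simp
      then show "\<bar>nderiv j y t - nderiv j x t\<bar> < e" using that(3) by simp
    qed
    show "\<exists>k' e'. 0 < e' \<and> (\<forall>y\<in>Diff. \<forall>z\<in>Diff.
        near k' e' x y \<longrightarrow> near k' e' y z \<longrightarrow> near k e x z)" if "0 < e" for k e x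
    proof (intro exI[of _ k] exI[of _ "e / 2"] conjI ballI impI)
      fix y z assume y: "near k (e / 2) x y" and z: "near k (e / 2) y z"
      show "near k e x z" unfolding near_def
      proof (intro allI impI)
        fix j t assume "j \<le> k"
        then have "\<bar>nderiv j y t - nderiv j x t\<bar> < e / 2" "\<bar>nderiv j z t - nderiv j y t\<bar> < e / 2"
          using y z unfolding near_def by blast+
        then show "\<bar>nderiv j z t - nderiv j x t\<bar> < e" by linarith
      qed
    qed (use that in simp)
    show "Ck_bound k e (\<lambda>t. x t - t)" if "x \<in> Diff" "near k e \<one>\<^bsub>Diff_cover\<^esub> x" for k e x
      using that(2) unfolding near_one[OF that(1)] Ck_bound_def by (simp add: less_imp_le)
    show "near k e \<one>\<^bsub>Diff_cover\<^esub> x"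
      if "x \<in> Diff" "Ck_bound k d (\<lambda>t. x t - t)" "d < e" for k e d x
      using that(2,3) unfolding near_one[OF that(1)] Ck_bound_def by (auto intro: le_less_trans)
  qed (simp_all add: near_def id_Diff_cover)
qed

section \<open>Estimates for composition and inversion of diffeomorphisms\<close>

lemma Diff_cover_displacement:
  assumes "f \<in> Diff"
  shows "smooth_on UNIV (\<lambda>t. f t - t)" "deriv (\<lambda>t. f t - t) t = deriv f t - 1"
    "((\<lambda>t. f t - t) has_vector_derivative deriv f t - 1) (at t)"
proof -
  show "smooth_on UNIV (\<lambda>t. f t - t)"
    by (intro smooth_on_diff open_UNIV Diff_coverD(1)[OF assms] smooth_on_id)
  have "((\<lambda>t. f t - t) has_real_derivative deriv f t - 1) (at t)"
    by (intro DERIV_diff Diff_coverD(4)[OF assms] DERIV_ident)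
  then show "deriv (\<lambda>t. f t - t) t = deriv f t - 1" "((\<lambda>t. f t - t) has_vector_derivative deriv f t - 1) (at t)"
    by (simp_all add: DERIV_imp_deriv has_real_derivative_iff_has_vector_derivative)
qed

lemma Diff_cover_Ck_bound_deriv:
  assumes "f \<in> Diff" "Ck_bound (Suc k) d (\<lambda>t. f t - t)"
  shows "Ck_bound k d (\<lambda>t. deriv f t - 1)" "d \<le> 1 \<Longrightarrow> Ck_bound k 2 (deriv f)"
proof -
  have "(\<lambda>t. vector_derivative (\<lambda>t. f t - t) (at t)) = (\<lambda>t. deriv f t - 1)"
    using vector_derivative_at[OF Diff_cover_displacement(3)[OF assms(1)]] by (rule ext)
  then show 1: "Ck_bound k d (\<lambda>t. deriv f t - 1)" using assms(2) by (simp add: Ck_bound_Suc)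
  assume "d \<le> 1"
  have "smooth_on UNIV (\<lambda>t. deriv f t - 1)"
    by (intro smooth_on_diff open_UNIV smooth_on_const smooth_on_real_derivative(2) Diff_coverD(1) assms)
  then have "Ck_bound k (d + norm (1::real)) (\<lambda>t. (deriv f t - 1) + 1)"
    by (intro Ck_bound_add 1 Ck_bound_const smooth_on_const open_UNIV)
  then show "Ck_bound k 2 (deriv f)" using \<open>d \<le> 1\<close> by (auto elim: Ck_bound_mono)
qed

text \<open>The displacement of \<open>f \<circ> g\<close> is the displacement of \<open>f\<close>
  evaluated along \<open>g\<close> plus that of \<open>g\<close>, and
  \<open>Ck_bound_compose\<close> controls the first summand.\<close>

lemma Diff_cover_mult_small:
  assumes "0 < e"
  shows "\<exists>l. \<exists>d>0. \<forall>f\<in>Diff. \<forall>g\<in>Diff. Ck_bound l d (\<lambda>t. f t - t) \<longrightarrow>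
    Ck_bound l d (\<lambda>t. g t - t) \<longrightarrow> Ck_bound k e (\<lambda>t. f (g t) - t)"
proof -
  obtain C where C0: "C \<ge> 0" and C: "\<forall>(u::real\<Rightarrow>real) g A. smooth_on UNIV u \<and> smooth_on UNIV g \<and>
    (\<forall>l. k = Suc l \<longrightarrow> Ck_bound l 2 (deriv g)) \<and> Ck_bound k A u \<longrightarrow> Ck_bound k (C * A) (\<lambda>t. u (g t))"
    using Ck_bound_compose[of k] by blast
  \<comment> \<open>The bound 1 keeps the derivative of \<open>g\<close> within the 2 required by
    \<open>Ck_bound_compose\<close>; the other entry gives \<open>C * d + d \<le> e\<close>.\<close>
  define d where "d = min 1 (e / (C + 1))"
  have "d \<le> e / (C + 1)" unfolding d_def by simp
  then have d: "d * (C + 1) \<le> e" using C0 by (simp add: pos_le_divide_eq)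
  have d': "d > 0" "d \<le> 1" unfolding d_def using assms C0 by auto
  show ?thesis
  proof (intro exI[of _ "Suc k"] exI[of _ d] conjI ballI impI d'(1))
    fix f g assume f: "f \<in> Diff" and g: "g \<in> Diff"
      and b: "Ck_bound (Suc k) d (\<lambda>t. f t - t)" "Ck_bound (Suc k) d (\<lambda>t. g t - t)"
    have "Ck_bound l 2 (deriv g)" if "k = Suc l" for l
      using Ck_bound_SucD[of l] Diff_cover_Ck_bound_deriv(2)[OF g b(2) d'(2)] that by simp
    then have 1: "Ck_bound k (C * d) (\<lambda>t. f (g t) - g t)"
      using C[rule_format, of "\<lambda>t. f t - t" g d] Diff_cover_displacement(1)[OF f] Diff_coverD(1)[OF g]
        Ck_bound_SucD[OF b(1)] by blast
    have "smooth_on UNIV (\<lambda>t. f (g t) - g t)"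
      using Diff_coverD(1)[OF Diff_cover_comp[OF f g]] Diff_coverD(1)[OF g]
      by (intro smooth_on_diff) (simp_all add: comp_def)
    then have "Ck_bound k (C * d + d) (\<lambda>t. (f (g t) - g t) + (g t - t))"
      by (intro Ck_bound_add 1 Ck_bound_SucD[OF b(2)] Diff_cover_displacement(1)[OF g])
    then show "Ck_bound k e (\<lambda>t. f (g t) - t)"
      using d by (auto elim: Ck_bound_mono simp: algebra_simps)
  qed
qed

text \<open>With \<open>u = f' - 1\<close>, the derivative of the inverse is
  \<open>1 / (1 + u \<circ> h)\<close>. The induction hypothesis for \<open>e = 1\<close> bounds
  \<open>h'\<close> well enough for \<open>u \<circ> h\<close> to inherit the smallness of
  \<open>u\<close>, and the reciprocal is continuous near 1. At order 0 the displacement of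
  \<open>h\<close> at \<open>t\<close> is minus that of \<open>f\<close> at
  \<open>h t\<close>.\<close>

lemma Diff_cover_inv_small:
  "0 < e \<Longrightarrow> \<exists>l. \<exists>d>0. \<forall>f\<in>Diff. \<forall>h\<in>Diff. (\<forall>t. f (h t) = t) \<longrightarrow>
    Ck_bound l d (\<lambda>t. f t - t) \<longrightarrow> Ck_bound k e (\<lambda>t. h t - t)"
proof (induction k arbitrary: e)
  case 0
  have "Ck_bound 0 e (\<lambda>t. h t - t)" if "\<forall>t. f (h t) = t" "Ck_bound 0 e (\<lambda>t. f t - t)" for h f :: "real \<Rightarrow> real"
    unfolding Ck_bound_0
  proof
    fix t show "norm (h t - t) \<le> e"
      using Ck_bound_norm[OF that(2), of "h t"] that(1) by (simp add: norm_minus_commute)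
  qed
  then show ?case using 0 by (intro exI[of _ 0] exI[of _ e]) simp
next
  case (Suc k)
  obtain l d0 where d0: "d0 > 0" "\<forall>f\<in>Diff. \<forall>h\<in>Diff. (\<forall>t. f (h t) = t) \<longrightarrow>
    Ck_bound l d0 (\<lambda>t. f t - t) \<longrightarrow> Ck_bound k 1 (\<lambda>t. h t - t)" using Suc.IH[OF zero_less_one] by blast
  have smF: "smooth_on {-1<..} (\<lambda>x::real. inverse (1 + x))"
  proof (rule smooth_on_compose[OF open_greaterThan open_greaterThan _ _ smooth_on_inverse])
    show "smooth_on {-1<..} (\<lambda>x::real. 1 + x)" by (intro smooth_on_add smooth_on_const smooth_on_id open_greaterThan)
  qed auto
  have "\<exists>d>0. \<forall>w. smooth_on UNIV w \<and> Ck_bound k d w \<longrightarrow>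
    (\<forall>t. w t \<in> {-1<..}) \<and> Ck_bound k e (\<lambda>t. inverse (1 + w t) - inverse (1 + (0::real)))"
    by (rule Ck_bound_compose_small[OF open_greaterThan _ smF Suc.prems]) simp
  then obtain d1 where d1_pos: "d1 > 0" and d1_all: "\<forall>w. smooth_on UNIV w \<and> Ck_bound k d1 w \<longrightarrow>
    (\<forall>t. w t \<in> {-1<..}) \<and> Ck_bound k e (\<lambda>t. inverse (1 + w t) - inverse (1 + (0::real)))"
    by (elim exE conjE) (rule that)
  have d1: "Ck_bound k e (\<lambda>t. inverse (1 + w t) - 1)" if "smooth_on UNIV w" "Ck_bound k d1 w" for w :: "real \<Rightarrow> real"
    using d1_all[rule_format, of w] that by simp
  obtain C where C0: "C \<ge> 0" and C: "\<forall>(u::real\<Rightarrow>real) g A. smooth_on UNIV u \<and> smooth_on UNIV g \<and>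
    (\<forall>l. k = Suc l \<longrightarrow> Ck_bound l 2 (deriv g)) \<and> Ck_bound k A u \<longrightarrow> Ck_bound k (C * A) (\<lambda>t. u (g t))"
    using Ck_bound_compose[of k] by blast
  \<comment> \<open>Here \<open>d0\<close> feeds the induction hypothesis, \<open>e\<close> settles
    order 0, and the last entry ensures \<open>C * d \<le> d1\<close>.\<close>
  define d where "d = min (min d0 e) (d1 / (C + 1))"
  have "d \<le> d1 / (C + 1)" unfolding d_def by simp
  then have "d * (C + 1) \<le> d1" using C0 by (simp add: pos_le_divide_eq)
  moreover have d: "d > 0" "d \<le> d0" "d \<le> e" unfolding d_def using d0(1) d1_pos C0 Suc.prems by auto
  ultimately have dC: "C * d \<le> d1" by (simp add: algebra_simps)
  show ?case
  proof (intro exI[of _ "max l (Suc k)"] exI[of _ d] conjI ballI impI d(1))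
    fix f h assume f: "f \<in> Diff" and h: "h \<in> Diff" and inv: "\<forall>t. f (h t) = t"
      and b: "Ck_bound (max l (Suc k)) d (\<lambda>t. f t - t)"
    have "Ck_bound l d0 (\<lambda>t. f t - t)" by (rule Ck_bound_mono[OF b]) (use d in auto)
    then have h1: "Ck_bound k 1 (\<lambda>t. h t - t)" using d0(2) f h inv by blast
    have bS: "Ck_bound (Suc k) d (\<lambda>t. f t - t)" by (rule Ck_bound_mono[OF b]) auto
    define u where "u t = deriv f t - 1" for t
    have u: "Ck_bound k d u" "smooth_on UNIV u"
      unfolding u_def using Diff_cover_Ck_bound_deriv(1)[OF f bS]
      by (assumption, intro smooth_on_diff open_UNIV smooth_on_const
          smooth_on_real_derivative(2)[OF open_UNIV Diff_coverD(1)[OF f]])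
    have "Ck_bound j 2 (deriv h)" if "k = Suc j" for j
      using Diff_cover_Ck_bound_deriv(2)[OF h] h1 that by blast
    then have "Ck_bound k (C * d) (\<lambda>t. u (h t))"
      using C[rule_format, of u h d] u Diff_coverD(1)[OF h] by blast
    then have "Ck_bound k d1 (\<lambda>t. u (h t))" using dC by (auto elim: Ck_bound_mono)
    moreover have "smooth_on UNIV (\<lambda>t. u (h t))"
      by (rule smooth_on_compose[OF open_UNIV open_UNIV _ Diff_coverD(1)[OF h] u(2)]) simp
    ultimately have "Ck_bound k e (\<lambda>t. inverse (1 + u (h t)) - 1)" by (rule d1[rotated])
    moreover have "inverse (1 + u (h t)) = deriv h t" for t
    proof -
      have "((\<lambda>t. f (h t)) has_real_derivative deriv f (h t) * deriv h t) (at t)"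
        by (rule DERIV_chain2[OF Diff_coverD(4)[OF f] Diff_coverD(4)[OF h]])
      then have "((\<lambda>t. t) has_real_derivative deriv f (h t) * deriv h t) (at t)" using inv by simp
      then have "deriv f (h t) * deriv h t = 1" using DERIV_ident DERIV_unique by blast
      then show ?thesis unfolding u_def by (simp add: inverse_unique)
    qed
    ultimately have der: "Ck_bound k e (\<lambda>t. deriv h t - 1)" by simp
    have "norm (h t - t) \<le> e" for t
      using Ck_bound_norm[OF bS, of "h t"] inv d(3) by (simp add: norm_minus_commute)
    from Ck_bound_derivative[OF Diff_cover_displacement(3)[OF h] der this]
    show "Ck_bound (Suc k) e (\<lambda>t. h t - t)" .
  qed
qed

section \<open>Splitting diffeomorphisms with support in two disjoint open sets\<close>

lemma Diff_cover_split:
  assumes A: "openin (top_of_set circle) A" and B: "openin (top_of_set circle) B" and AB: "A \<inter> B = {}"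
    and x: "x \<in> Diff" and sup: "supp Diff_cover x \<subseteq> A \<union> B" and b: "Ck_bound k e (\<lambda>t. x t - t)"
    and y_def: "y = (\<lambda>t. if cis t \<in> A then x t else t)"
  shows "y \<in> localized Diff_cover A" "Ck_bound k e (\<lambda>t. y t - t)"
proof -
  have K: "closure (cis ` {t. x t \<noteq> t}) \<subseteq> A \<union> B" using sup by simp
  note cut = circle_cutoff[OF A B AB K y_def]
  have "y \<in> Diff"
  proof (rule Diff_coverI)
    show "smooth_on UNIV y"
    proof (rule smooth_on_local[OF open_UNIV])
      fix t :: real
      obtain T where T: "open T" "t \<in> T" "(\<forall>s\<in>T. y s = x s) \<or> (\<forall>s\<in>T. y s = s)" using cut(1) by blast
      have "smooth_on T x" by (rule smooth_on_subset[OF Diff_coverD(1)[OF x]]) simp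
      then have "smooth_on T y"
        using T(3) smooth_on_cong[OF T(1), of x y] smooth_on_cong[OF T(1), of "\<lambda>s. s" y] smooth_on_id[OF T(1)] by auto
      then show "\<exists>T. open T \<and> t \<in> T \<and> smooth_on T y" using T by blast
    qed
    have "cis (t + 2 * pi) = cis t" for t by (simp add: cis_eq_iff exI[of _ 1])
    then show "y (t + 2 * pi) = y t + 2 * pi" for t unfolding y_def by (simp add: Diff_coverD(2)[OF x])
    show "\<exists>d>0. (y has_real_derivative d) (at t)" for t
    proof -
      obtain T where T: "open T" "t \<in> T" "(\<forall>s\<in>T. y s = x s) \<or> (\<forall>s\<in>T. y s = s)" using cut(1) by blast
      from T(3) show ?thesis
      proof
        assume e: "\<forall>s\<in>T. y s = x s"
        have "(y has_real_derivative deriv x t) (at t)"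
          by (rule has_field_derivative_transform_within_open[OF Diff_coverD(4)[OF x] T(1,2)]) (use e in simp)
        then show ?thesis using Diff_coverD(3)[OF x] by blast
      next
        assume e: "\<forall>s\<in>T. y s = s"
        have "(y has_real_derivative 1) (at t)"
          by (rule has_field_derivative_transform_within_open[OF DERIV_ident T(1,2)]) (use e in simp)
        then show ?thesis using zero_less_one by blast
      qed
    qed
  qed
  then show "y \<in> localized Diff_cover A" using cut(2) by (simp add: localized_def)
  show "Ck_bound k e (\<lambda>t. y t - t)"
  proof (rule Ck_bound_if_zero[OF _ b])
    fix t
    obtain T where "open T" "t \<in> T" "(\<forall>s\<in>T. y s = x s) \<or> (\<forall>s\<in>T. y s = s)" using cut(1) by blast
    then show "\<exists>T. open T \<and> t \<in> T \<and> ((\<forall>s\<in>T. y s - s = x s - s) \<or> (\<forall>s\<in>T. y s - s = 0))"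
      by (intro exI[of _ T]) auto
  qed
qed

text \<open>Between \<open>t\<close> and \<open>x t\<close> there is no fixed point of \<open>x\<close>, so that the arc from \<open>cis t\<close> to \<open>cis (x t)\<close>
  stays in the support.\<close>

lemma Diff_cover_preserves_part:
  assumes A: "openin (top_of_set circle) A" and B: "openin (top_of_set circle) B" and AB: "A \<inter> B = {}"
    and x: "x \<in> Diff" and sup: "supp Diff_cover x \<subseteq> A \<union> B" and t: "cis t \<in> B" "x t \<noteq> t"
  shows "cis (x t) \<notin> A"
proof
  assume xt: "cis (x t) \<in> A"
  let ?S = "closed_segment t (x t)"
  have mono: "strict_mono x" by (rule Diff_cover_strict_mono[OF x])
  have "x s \<noteq> s" if "s \<in> ?S" for s
  proof
    assume s: "x s = s"
    show False
    proof (cases "t < x t")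
      case True
      then have "t \<le> s" "s \<le> x t" using that by (auto simp: closed_segment_eq_real_ivl)
      then have "t < s" using s t(2) by (metis order_le_less)
      then have "x t < s" using mono s by (metis strict_monoD)
      then show False using \<open>s \<le> x t\<close> by simp
    next
      case False
      then have "x t < t" using t(2) by simp
      then have "x t \<le> s" "s \<le> t" using that by (auto simp: closed_segment_eq_real_ivl)
      then have "s < t" using s t(2) by (metis order_le_less)
      then have "s < x t" using mono s by (metis strict_monoD)
      then show False using \<open>x t \<le> s\<close> by simp
    qed
  qed
  then have "cis ` ?S \<subseteq> cis ` {t. x t \<noteq> t}" by blast
  also have "\<dots> \<subseteq> closure (cis ` {t. x t \<noteq> t})" by (rule closure_subset)
  also have "\<dots> \<subseteq> A \<union> B" using sup by simp
  finally have sub: "cis ` ?S \<subseteq> A \<union> B" .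
  have "connected (cis ` ?S)" by (intro connected_continuous_image connected_segment continuous_intros)
  moreover obtain A' B' where "open A'" "A = circle \<inter> A'" "open B'" "B = circle \<inter> B'"
    using A B unfolding openin_open by blast
  moreover have "cis ` ?S \<subseteq> circle" by auto
  moreover have "cis t \<in> cis ` ?S" "cis (x t) \<in> cis ` ?S" by auto
  ultimately show False using connectedD[of "cis ` ?S" A' B'] sub AB xt t(1) by blast
qed

lemma localizable_group_Diff_cover: "localizable_group Diff_cover"
proof (rule localizable_groupI[OF group_Diff_cover Diff_cover_nhd])
  fix k and e :: real assume e: "0 < e"
  show "\<exists>l. \<exists>d>0. \<forall>x\<in>Diff. \<forall>y\<in>Diff. Ck_bound l d (\<lambda>t. x t - t) \<longrightarrow>
      Ck_bound l d (\<lambda>t. y t - t) \<longrightarrow> Ck_bound k e (\<lambda>t. (x \<otimes>\<^bsub>Diff_cover\<^esub> y) t - t)"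
    using Diff_cover_mult_small[OF e] by simp
  obtain l d where d: "d > 0" "\<forall>f\<in>Diff. \<forall>h\<in>Diff. (\<forall>t. f (h t) = t) \<longrightarrow>
      Ck_bound l d (\<lambda>t. f t - t) \<longrightarrow> Ck_bound k e (\<lambda>t. h t - t)"
    using Diff_cover_inv_small[OF e, of k] by (elim exE conjE) (rule that)
  have "Ck_bound k e (\<lambda>t. (inv\<^bsub>Diff_cover\<^esub> x) t - t)"
    if x: "x \<in> Diff" "Ck_bound l d (\<lambda>t. x t - t)" for x
  proof -
    obtain h where h: "h \<in> Diff" "\<And>t. x (h t) = t" "\<And>t. h (x t) = t"
      by (rule Diff_cover_inv[OF x(1)]) (rule that, simp_all)
    then show ?thesis using d(2) x by (simp add: Diff_cover_inv_eq[OF x(1) h(1,3)])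
  qed
  then show "\<exists>l. \<exists>d>0. \<forall>x\<in>Diff. Ck_bound l d (\<lambda>t. x t - t) \<longrightarrow>
      Ck_bound k e (\<lambda>t. (inv\<^bsub>Diff_cover\<^esub> x) t - t)"
    using d(1) by blast
next
  fix x y
  have "cis ` {t. (x \<circ> y) t \<noteq> t} \<subseteq> cis ` {t. x t \<noteq> t} \<union> cis ` {t. y t \<noteq> t}"
  proof
    fix w assume "w \<in> cis ` {t. (x \<circ> y) t \<noteq> t}"
    then obtain t where "w = cis t" "x (y t) \<noteq> t" by auto
    then show "w \<in> cis ` {t. x t \<noteq> t} \<union> cis ` {t. y t \<noteq> t}" by (cases "y t = t") auto
  qed
  from closure_mono[OF this]
  show "supp Diff_cover (x \<otimes>\<^bsub>Diff_cover\<^esub> y) \<subseteq> supp Diff_cover x \<union> supp Diff_cover y"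
    by simp
next
  fix x assume x: "x \<in> Diff"
  obtain h where h: "h \<in> Diff" "\<And>t. x (h t) = t" "\<And>t. h (x t) = t"
    by (rule Diff_cover_inv[OF x]) (rule that, simp_all)
  have "h t = t \<longleftrightarrow> x t = t" for t using h(2)[of t] h(3)[of t] by auto
  then show "supp Diff_cover (inv\<^bsub>Diff_cover\<^esub> x) \<subseteq> supp Diff_cover x"
    using Diff_cover_inv_eq[OF x h(1,3)] by simp
next
  fix A B x k e
  assume A: "openin (top_of_set circle) A" and B: "openin (top_of_set circle) B" and AB: "A \<inter> B = {}"
    and x: "x \<in> Diff" and sup: "supp Diff_cover x \<subseteq> A \<union> B" and b: "Ck_bound k e (\<lambda>t. x t - t)"
  have BA: "B \<inter> A = {}" and sup': "supp Diff_cover x \<subseteq> B \<union> A" using AB sup by blast+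
  define y where "y = (\<lambda>t. if cis t \<in> A then x t else t)"
  define z where "z = (\<lambda>t. if cis t \<in> B then x t else t)"
  \<comment> \<open>If \<open>z\<close> moves \<open>t\<close>, it sends it to a point outside
    \<open>A\<close>, where \<open>y\<close> is the identity; otherwise \<open>y\<close> acts on
    \<open>t\<close> itself.\<close>
  have "y (z t) = x t" for t
  proof (cases "cis t \<in> B \<and> x t \<noteq> t")
    case True
    then show ?thesis using Diff_cover_preserves_part[OF A B AB x sup, of t] by (simp add: y_def z_def)
  next
    case False
    then show ?thesis using circle_cutoff(3)[OF A B AB _ y_def, of t] sup by (auto simp: y_def z_def)
  qed
  then have "x = y \<otimes>\<^bsub>Diff_cover\<^esub> z" by (auto simp: fun_eq_iff)
  then show "\<exists>y z. y \<in> localized Diff_cover A \<and> Ck_bound k e (\<lambda>t. y t - t) \<and>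
      z \<in> localized Diff_cover B \<and> Ck_bound k e (\<lambda>t. z t - t) \<and> x = y \<otimes>\<^bsub>Diff_cover\<^esub> z"
    using Diff_cover_split[OF A B AB x sup b y_def] Diff_cover_split[OF B A BA x sup' b z_def] by blast
qed

section \<open>Loop groups\<close>

lemma smooth_intoD:
  assumes "smooth_into G S f"
  shows "x \<in> S \<Longrightarrow> f x \<in> carrier G" "(D, \<phi>) \<in> charts G \<Longrightarrow> open {x \<in> S. f x \<in> D}"
    "(D, \<phi>) \<in> charts G \<Longrightarrow> smooth_on {x \<in> S. f x \<in> D} (\<lambda>x. \<phi> (f x))"
  using assms unfolding smooth_into_def comp_def by auto

lemma smooth_intoI:
  assumes "\<And>x. x \<in> S \<Longrightarrow> f x \<in> carrier G"
    and "\<And>D \<phi>. (D, \<phi>) \<in> charts G \<Longrightarrow> open {x \<in> S. f x \<in> D}"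
    and "\<And>D \<phi>. (D, \<phi>) \<in> charts G \<Longrightarrow> smooth_on {x \<in> S. f x \<in> D} (\<lambda>x. \<phi> (f x))"
  shows "smooth_into G S f"
  using assms unfolding smooth_into_def comp_def by auto

lemma smooth_into_cong:
  assumes f: "smooth_into G S f" and T: "open T" "T \<subseteq> S" "\<And>x. x \<in> T \<Longrightarrow> f x = g x"
  shows "smooth_into G T g"
proof (rule smooth_intoI)
  show "g x \<in> carrier G" if "x \<in> T" for x
    using smooth_intoD(1)[OF f, of x] T(2) T(3)[OF that] that by auto
  fix D \<phi> assume D: "(D, \<phi>) \<in> charts G"
  have e: "{x \<in> T. g x \<in> D} = T \<inter> {x \<in> S. f x \<in> D}" using T(2,3) by auto
  show o: "open {x \<in> T. g x \<in> D}" unfolding e using T(1) smooth_intoD(2)[OF f D] by blast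
  show "smooth_on {x \<in> T. g x \<in> D} (\<lambda>x. \<phi> (g x))"
  proof (rule smooth_on_cong[OF o])
    show "smooth_on {x \<in> T. g x \<in> D} (\<lambda>x. \<phi> (f x))"
      by (rule smooth_on_subset[OF smooth_intoD(3)[OF f D]]) (use e in blast)
  qed (use T(3) in simp)
qed

lemma smooth_into_local:
  assumes "\<And>t. \<exists>T. open T \<and> t \<in> T \<and> smooth_into G T f"
  shows "smooth_into G UNIV f"
proof (rule smooth_intoI)
  show "f x \<in> carrier G" for x using assms[of x] smooth_intoD(1) by blast
  fix D \<phi> assume D: "(D, \<phi>) \<in> charts G"
  have loc: "\<exists>T. open T \<and> x \<in> T \<and> T \<subseteq> {x \<in> UNIV. f x \<in> D} \<and> smooth_on T (\<lambda>x. \<phi> (f x))" if "f x \<in> D" for x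
  proof -
    obtain T where T: "open T" "x \<in> T" "smooth_into G T f" using assms by blast
    show ?thesis
      using smooth_intoD(2,3)[OF T(3) D] T(2) that by (intro exI[of _ "{x \<in> T. f x \<in> D}"]) auto
  qed
  show o: "open {x \<in> UNIV. f x \<in> D}"
  proof (subst open_subopen, rule ballI)
    fix x assume "x \<in> {x \<in> UNIV. f x \<in> D}"
    then obtain T where "open T" "x \<in> T" "T \<subseteq> {x \<in> UNIV. f x \<in> D}" using loc by blast
    then show "\<exists>T. open T \<and> x \<in> T \<and> T \<subseteq> {x \<in> UNIV. f x \<in> D}" by (intro exI[of _ T] conjI)
  qed
  show "smooth_on {x \<in> UNIV. f x \<in> D} (\<lambda>x. \<phi> (f x))"
    by (rule smooth_on_local[OF o]) (use loc in blast)
qed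

lemma smooth_into_compose:
  assumes m: "smooth_into G S m" and T: "open T" and w: "smooth_on T w" "w ` T \<subseteq> S"
  shows "smooth_into G T (\<lambda>t. m (w t))"
proof (rule smooth_intoI)
  show "m (w t) \<in> carrier G" if "t \<in> T" for t using smooth_intoD(1)[OF m] w(2) that by blast
  fix D \<phi> assume D: "(D, \<phi>) \<in> charts G"
  have e: "{t \<in> T. m (w t) \<in> D} = T \<inter> w -` {x \<in> S. m x \<in> D}" using w(2) by auto
  show o: "open {t \<in> T. m (w t) \<in> D}"
    unfolding e by (rule continuous_open_preimage[OF smooth_on_continuous[OF w(1)] T smooth_intoD(2)[OF m D]])
  show "smooth_on {t \<in> T. m (w t) \<in> D} (\<lambda>t. \<phi> (m (w t)))"
    by (rule smooth_on_compose[OF o smooth_intoD(2)[OF m D] _ _ smooth_intoD(3)[OF m D]])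
      (use w in \<open>auto intro: smooth_on_subset\<close>)
qed

locale lie_group_loops =
  fixes G :: "('g, 'e::euclidean_space, 'm) lie_grp_scheme" (structure)
  assumes lie_group: "lie_group G"
begin

sublocale group G
  using lie_group by (simp add: lie_group_def)

lemma charts_cover: "g \<in> carrier G \<Longrightarrow> \<exists>D \<phi>. (D, \<phi>) \<in> charts G \<and> g \<in> D"
  using lie_group unfolding lie_group_def by blast

lemma chartD:
  assumes "(D, \<phi>) \<in> charts G"
  shows "D \<subseteq> carrier G" "open (\<phi> ` D)" "inj_on \<phi> D" "smooth_into G (\<phi> ` D) (inv_into D \<phi>)"
    "smooth_into G (\<phi> ` D) (\<lambda>x. inv (inv_into D \<phi> x))"
proof -
  have ts: "topspace (topo G) = carrier G"
    using lie_group unfolding lie_group_def by (elim conjE)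
  have c: "\<forall>(D, \<phi>)\<in>charts G. openin (topo G) D \<and> open (\<phi> ` D) \<and>
        homeomorphic_map (subtopology (topo G) D) (top_of_set (\<phi> ` D)) \<phi> \<and>
        smooth_into G (\<phi> ` D) (inv_into D \<phi>) \<and>
        smooth_into G (\<phi> ` D) (\<lambda>x. inv\<^bsub>G\<^esub> (inv_into D \<phi> x))"
    using lie_group unfolding lie_group_def by (elim conjE)
  have c': "openin (topo G) D \<and> open (\<phi> ` D) \<and>
        homeomorphic_map (subtopology (topo G) D) (top_of_set (\<phi> ` D)) \<phi> \<and>
        smooth_into G (\<phi> ` D) (inv_into D \<phi>) \<and>
        smooth_into G (\<phi> ` D) (\<lambda>x. inv\<^bsub>G\<^esub> (inv_into D \<phi> x))"
    using bspec[OF c assms] by (simp only: prod.case)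
  then show D: "D \<subseteq> carrier G" using openin_subset[of "topo G" D] ts by simp
  show "open (\<phi> ` D)" "smooth_into G (\<phi> ` D) (inv_into D \<phi>)" "smooth_into G (\<phi> ` D) (\<lambda>x. inv (inv_into D \<phi> x))"
    using c' by simp_all
  have "inj_on \<phi> (topspace (subtopology (topo G) D))"
    using c' homeomorphic_imp_injective_map[of "subtopology (topo G) D" "top_of_set (\<phi> ` D)" \<phi>] by simp
  then show "inj_on \<phi> D" using D ts by (simp add: Int_absorb1)
qed

lemma chart_mult:
  assumes "(D, \<phi>) \<in> charts G" "(E, \<psi>) \<in> charts G"
  shows "smooth_into G (\<phi> ` D \<times> \<psi> ` E) (\<lambda>(x, y). inv_into D \<phi> x \<otimes> inv_into E \<psi> y)"
proof -
  have c: "\<forall>(D, \<phi>)\<in>charts G. \<forall>(E, \<psi>)\<in>charts G.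
        smooth_into G (\<phi> ` D \<times> \<psi> ` E) (\<lambda>(x, y). inv_into D \<phi> x \<otimes>\<^bsub>G\<^esub> inv_into E \<psi> y)"
    using lie_group unfolding lie_group_def by (elim conjE)
  show ?thesis using bspec[OF bspec[OF c assms(1), unfolded split_conv] assms(2)] by simp
qed

lemma smooth_into_const: "g \<in> carrier G \<Longrightarrow> smooth_into G (UNIV :: 'p::euclidean_space set) (\<lambda>t. g)"
  by (rule smooth_intoI) (auto intro: smooth_on_const)

lemma smooth_into_mult:
  fixes u v :: "real \<Rightarrow> 'g"
  assumes u: "smooth_into G UNIV u" and v: "smooth_into G UNIV v"
  shows "smooth_into G UNIV (\<lambda>t. u t \<otimes> v t)"
proof (rule smooth_into_local)
  fix t :: real
  obtain D \<phi> where D: "(D, \<phi>) \<in> charts G" "u t \<in> D" using charts_cover smooth_intoD(1)[OF u UNIV_I] by blast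
  obtain E \<psi> where E: "(E, \<psi>) \<in> charts G" "v t \<in> E" using charts_cover smooth_intoD(1)[OF v UNIV_I] by blast
  define T where "T = {t \<in> UNIV. u t \<in> D} \<inter> {t \<in> UNIV. v t \<in> E}"
  have T: "open T" unfolding T_def by (intro open_Int smooth_intoD(2)[OF u D(1)] smooth_intoD(2)[OF v E(1)])
  have "smooth_on T (\<lambda>t. (\<phi> (u t), \<psi> (v t)))"
    by (intro smooth_on_Pair T smooth_on_subset[OF smooth_intoD(3)[OF u D(1)]] smooth_on_subset[OF smooth_intoD(3)[OF v E(1)]])
      (auto simp: T_def)
  then have "smooth_into G T (\<lambda>t. case (\<phi> (u t), \<psi> (v t)) of (x, y) \<Rightarrow> inv_into D \<phi> x \<otimes> inv_into E \<psi> y)"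
    by (rule smooth_into_compose[OF chart_mult[OF D(1) E(1)] T]) (auto simp: T_def)
  then have "smooth_into G T (\<lambda>t. u t \<otimes> v t)"
    by (rule smooth_into_cong[OF _ T order_refl]) (simp add: T_def chartD(3)[OF D(1)] chartD(3)[OF E(1)])
  then show "\<exists>T. open T \<and> t \<in> T \<and> smooth_into G T (\<lambda>t. u t \<otimes> v t)"
    using T D(2) E(2) by (intro exI[of _ T]) (simp add: T_def)
qed

lemma smooth_into_inv:
  fixes u :: "real \<Rightarrow> 'g"
  assumes u: "smooth_into G UNIV u"
  shows "smooth_into G UNIV (\<lambda>t. inv (u t))"
proof (rule smooth_into_local)
  fix t :: real
  obtain D \<phi> where D: "(D, \<phi>) \<in> charts G" "u t \<in> D" using charts_cover smooth_intoD(1)[OF u UNIV_I] by blast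
  define T where "T = {t \<in> UNIV. u t \<in> D}"
  have T: "open T" unfolding T_def by (rule smooth_intoD(2)[OF u D(1)])
  have "smooth_on T (\<lambda>t. \<phi> (u t))" unfolding T_def by (rule smooth_intoD(3)[OF u D(1)])
  then have "smooth_into G T (\<lambda>t. inv (inv_into D \<phi> (\<phi> (u t))))"
    by (rule smooth_into_compose[OF chartD(5)[OF D(1)] T]) (auto simp: T_def)
  then have "smooth_into G T (\<lambda>t. inv (u t))"
    by (rule smooth_into_cong[OF _ T order_refl]) (simp add: T_def chartD(3)[OF D(1)])
  then show "\<exists>T. open T \<and> t \<in> T \<and> smooth_into G T (\<lambda>t. inv (u t))"
    using T D(2) by (intro exI[of _ T]) (simp add: T_def)
qed

abbreviation LG :: "(real \<Rightarrow> 'g) set" where "LG \<equiv> carrier (loop_group G)"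

lemma loop_group_simps [simp]:
  "mult (loop_group G) u v = (\<lambda>t. u t \<otimes> v t)" "one (loop_group G) = (\<lambda>t. \<one>)"
  "supp (loop_group G) u = closure (cis ` {t. u t \<noteq> \<one>})"
  "topo (loop_group G) = near_topology (LG) (loop_near G)"
  by (simp_all add: loop_group_def Let_def)

lemma carrier_loop_group:
  "u \<in> LG \<longleftrightarrow> smooth_into G UNIV u \<and> (\<forall>t. u (t + 2 * pi) = u t)"
  by (simp add: loop_group_def Let_def)

lemma loop_closed: "u \<in> LG \<Longrightarrow> u t \<in> carrier G"
  using smooth_intoD(1)[of G UNIV u t] by (simp add: carrier_loop_group)

lemma loop_mult: "u \<in> LG \<Longrightarrow> v \<in> LG \<Longrightarrow> (\<lambda>t. u t \<otimes> v t) \<in> LG"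
  by (simp add: carrier_loop_group smooth_into_mult)

lemma loop_inv: "u \<in> LG \<Longrightarrow> (\<lambda>t. inv (u t)) \<in> LG"
  by (simp add: carrier_loop_group smooth_into_inv)

lemma loop_one: "(\<lambda>t. \<one>) \<in> LG"
  by (simp add: carrier_loop_group smooth_into_const)

lemma group_loop_group: "group (loop_group G)"
proof (rule groupI)
  show "\<exists>v\<in>LG. v \<otimes>\<^bsub>loop_group G\<^esub> u = \<one>\<^bsub>loop_group G\<^esub>" if "u \<in> LG" for u
    by (rule bexI[OF _ loop_inv[OF that]]) (simp add: loop_closed[OF that])
qed (simp_all add: loop_mult loop_one loop_closed m_assoc)

lemma loop_inv_eq: "u \<in> LG \<Longrightarrow> inv\<^bsub>loop_group G\<^esub> u = (\<lambda>t. inv (u t))"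
  by (rule group.inv_equality[OF group_loop_group]) (simp_all add: loop_inv loop_closed)

section \<open>Neighbourhoods of the constant loop\<close>

definition D1 :: "'g set" where "D1 = fst (chart_at_one G)"
definition \<phi>1 :: "'g \<Rightarrow> 'e" where "\<phi>1 = snd (chart_at_one G)"

lemma chart_at_one: "(D1, \<phi>1) \<in> charts G" "\<one> \<in> D1"
proof -
  have "\<exists>c. c \<in> charts G \<and> \<one> \<in> fst c" using charts_cover[OF one_closed] by force
  then have "chart_at_one G \<in> charts G \<and> \<one> \<in> fst (chart_at_one G)"
    unfolding chart_at_one_def by (rule someI_ex)
  then show "(D1, \<phi>1) \<in> charts G" "\<one> \<in> D1" by (simp_all add: D1_def \<phi>1_def)
qed

lemma log1_eq: "log1 G g = \<phi>1 g - \<phi>1 \<one>"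
  by (simp add: log1_def \<phi>1_def)

text \<open>The non-strict form of \<open>loop_near\<close> at the constant loop. It plays the part
  that \<open>Ck_bound k e (\<lambda>t. f t - t)\<close> plays for diffeomorphisms.\<close>

definition small :: "nat \<Rightarrow> real \<Rightarrow> (real \<Rightarrow> 'g) \<Rightarrow> bool" where
  "small k e u \<longleftrightarrow> (\<forall>t. u t \<in> D1) \<and> Ck_bound k e (\<lambda>t. log1 G (u t))"

lemma smooth_on_log1:
  assumes "u \<in> LG" "\<And>t. u t \<in> D1"
  shows "smooth_on UNIV (\<lambda>t. log1 G (u t))"
proof -
  have "smooth_on {t \<in> UNIV. u t \<in> D1} (\<lambda>t. \<phi>1 (u t))"
    using assms(1) by (intro smooth_intoD(3)[OF _ chart_at_one(1)]) (simp add: carrier_loop_group)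
  then show ?thesis unfolding log1_eq using assms(2)
    by (intro smooth_on_diff smooth_on_const open_UNIV) simp_all
qed

text \<open>This is \<open>Ck_bound_compose_small\<close> read in the chart at the unit. The shift
  by \<open>c\<close> recentres the coordinates, so that the constant loop corresponds to
  \<open>w = 0\<close>; \<open>m\<close> will be multiplication or inversion written in the
  chart.\<close>

lemma small_smooth_into:
  fixes m :: "'v::euclidean_space \<Rightarrow> 'g"
  assumes m: "smooth_into G S m" and c: "c \<in> S" "m c = \<one>" and e: "0 < e"
  shows "\<exists>d>0. \<forall>w. smooth_on UNIV w \<and> Ck_bound k d w \<longrightarrow> small k e (\<lambda>t. m (w t + c))"
proof -
  define P where "P = {p \<in> S. m p \<in> D1}"
  have P: "open P" "smooth_on P (\<lambda>p. \<phi>1 (m p))"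
    unfolding P_def by (rule smooth_intoD(2,3)[OF m chart_at_one(1)])+
  define Q where "Q = (\<lambda>p. p + c) -` P"
  have "c \<in> P" unfolding P_def using c chart_at_one(2) by simp
  then have Q: "open Q" "0 \<in> Q"
    unfolding Q_def by (auto intro!: open_vimage P(1) continuous_intros)
  have F: "smooth_on Q (\<lambda>p. \<phi>1 (m (p + c)))"
  proof (rule smooth_on_compose[OF Q(1) P(1) _ _ P(2)])
    show "smooth_on Q (\<lambda>p. p + c)" by (intro smooth_on_add Q(1) smooth_on_id smooth_on_const)
  qed (auto simp: Q_def)
  obtain d where d: "d > 0" and small: "\<forall>w. smooth_on UNIV w \<and> Ck_bound k d w \<longrightarrow>
    (\<forall>t. w t \<in> Q) \<and> Ck_bound k e (\<lambda>t. \<phi>1 (m (w t + c)) - \<phi>1 (m (0 + c)))"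
    using Ck_bound_compose_small[OF Q F e, of k] by (elim exE conjE) (rule that)
  then have "small k e (\<lambda>t. m (w t + c))" if "smooth_on UNIV w" "Ck_bound k d w" for w
    using small[rule_format, of w] that c by (simp add: small_def log1_eq Q_def P_def)
  then show ?thesis using d by blast
qed

lemma small_mult:
  assumes "0 < e"
  shows "\<exists>d>0. \<forall>u\<in>LG. \<forall>v\<in>LG.
    small k d u \<longrightarrow> small k d v \<longrightarrow> small k e (\<lambda>t. u t \<otimes> v t)"
proof -
  define m where "m = (\<lambda>(x, y). inv_into D1 \<phi>1 x \<otimes> inv_into D1 \<phi>1 y)"
  have m: "smooth_into G (\<phi>1 ` D1 \<times> \<phi>1 ` D1) m"
    unfolding m_def by (rule chart_mult[OF chart_at_one(1) chart_at_one(1)])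
  have mval: "m (\<phi>1 g, \<phi>1 h) = g \<otimes> h" if "g \<in> D1" "h \<in> D1" for g h
    using that by (simp add: m_def chartD(3)[OF chart_at_one(1)])
  obtain d where d: "d > 0" and small: "\<forall>w. smooth_on UNIV w \<and> Ck_bound k d w \<longrightarrow>
      small k e (\<lambda>t. m (w t + (\<phi>1 \<one>, \<phi>1 \<one>)))"
    using small_smooth_into[OF m, of "(\<phi>1 \<one>, \<phi>1 \<one>)" e k] chart_at_one(2) assms
    by (simp add: mval) (elim exE conjE, rule that)
  show ?thesis
  \<comment> \<open>The pair of logarithms is the sum of its two components embedded in the product
    space, each of which receives half of \<open>d\<close>.\<close>
  proof (intro exI[of _ "d / 2"] conjI ballI impI)
    fix u v assume u: "u \<in> LG" and v: "v \<in> LG"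
      and s: "small k (d / 2) u" "small k (d / 2) v"
    have D: "u t \<in> D1" "v t \<in> D1" for t using s by (simp_all add: small_def)
    have sm: "smooth_on UNIV (\<lambda>t. log1 G (u t))" "smooth_on UNIV (\<lambda>t. log1 G (v t))"
      using smooth_on_log1 u v D by blast+
    have bl: "bounded_linear (\<lambda>x::'e. (x, 0::'e))" "bounded_linear (\<lambda>y::'e. (0::'e, y))"
      by (intro bounded_linear_Pair bounded_linear_ident bounded_linear_zero)+
    have "Ck_bound k (1 * (d / 2) + 1 * (d / 2)) (\<lambda>t. (log1 G (u t), 0) + (0, log1 G (v t)))"
    proof (rule Ck_bound_add)
      show "Ck_bound k (1 * (d / 2)) (\<lambda>t. (log1 G (u t), 0::'e))"
        by (rule Ck_bound_bounded_linear_comp[OF bl(1) _ _ sm(1)]) (use s in \<open>simp_all add: small_def norm_Pair\<close>)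
      show "Ck_bound k (1 * (d / 2)) (\<lambda>t. (0::'e, log1 G (v t)))"
        by (rule Ck_bound_bounded_linear_comp[OF bl(2) _ _ sm(2)]) (use s in \<open>simp_all add: small_def norm_Pair\<close>)
    qed (intro smooth_on_Pair sm open_UNIV smooth_on_const)+
    moreover have "smooth_on UNIV (\<lambda>t. (log1 G (u t), log1 G (v t)))" by (intro smooth_on_Pair sm open_UNIV)
    ultimately have "small k e (\<lambda>t. m ((log1 G (u t), log1 G (v t)) + (\<phi>1 \<one>, \<phi>1 \<one>)))"
      using small[rule_format, of "\<lambda>t. (log1 G (u t), log1 G (v t))"] by simp
    then show "small k e (\<lambda>t. u t \<otimes> v t)" by (simp add: log1_eq mval D)
  qed (use d in simp)
qed

lemma small_inv:
  assumes "0 < e"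
  shows "\<exists>d>0. \<forall>u\<in>LG. small k d u \<longrightarrow> small k e (\<lambda>t. inv (u t))"
proof -
  have mval: "inv (inv_into D1 \<phi>1 (\<phi>1 g)) = inv g" if "g \<in> D1" for g
    using that by (simp add: chartD(3)[OF chart_at_one(1)])
  obtain d where d: "d > 0" and small: "\<forall>w. smooth_on UNIV w \<and> Ck_bound k d w \<longrightarrow>
      small k e (\<lambda>t. inv (inv_into D1 \<phi>1 (w t + \<phi>1 \<one>)))"
    using small_smooth_into[OF chartD(5)[OF chart_at_one(1)], of "\<phi>1 \<one>" e k] chart_at_one(2) assms
    by (simp add: mval) (elim exE conjE, rule that)
  show ?thesis
  proof (intro exI[of _ d] conjI ballI impI d)
    fix u assume u: "u \<in> LG" and s: "small k d u"
    have D: "u t \<in> D1" for t using s by (simp add: small_def)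
    have "small k e (\<lambda>t. inv (inv_into D1 \<phi>1 (log1 G (u t) + \<phi>1 \<one>)))"
      using small[rule_format, of "\<lambda>t. log1 G (u t)"] smooth_on_log1[OF u D] s by (simp add: small_def)
    then show "small k e (\<lambda>t. inv (u t))" by (simp add: log1_eq mval D)
  qed
qed

lemma loop_near_small: "loop_near G k e u v \<Longrightarrow> small k e (\<lambda>t. inv (u t) \<otimes> v t)"
  by (simp add: loop_near_def small_def Ck_bound_def D1_def less_imp_le)

lemma small_loop_near: "small k d (\<lambda>t. inv (u t) \<otimes> v t) \<Longrightarrow> d < e \<Longrightarrow> loop_near G k e u v"
  by (auto simp: loop_near_def small_def Ck_bound_def D1_def intro: le_less_trans)

text \<open>As \<open>loop_near\<close> is left invariant, its triangle condition reduces to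
  \<open>small_mult\<close> through the telescoping product of
  \<open>inv (x t) \<otimes> y t\<close> and \<open>inv (y t) \<otimes> z t\<close>. The bound
  \<open>e / 2\<close> restores the strict inequality.\<close>

lemma loop_nhd:
  "nhd_of_one (loop_group G) V \<longleftrightarrow> V \<subseteq> LG \<and>
    (\<exists>k. \<exists>e>0. \<forall>u\<in>LG. small k e u \<longrightarrow> u \<in> V)"
proof -
  have one: "(\<lambda>t. inv \<one> \<otimes> u t) = u" if "u \<in> LG" for u
    using loop_closed[OF that] by simp
  show ?thesis
  proof (rule nhd_of_one_near_topology[where near="loop_near G"])
    show "loop_near G k e x y" if near: "loop_near G k' e' x y" and "k \<le> k'" "e' \<le> e" for k k' e e' x y
      using that unfolding loop_near_def by (meson order_less_le_trans order_trans)
    show "loop_near G k e x x" if "x \<in> LG" "0 < e" for k e x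
    proof (rule small_loop_near[OF _ that(2)])
      have "(\<lambda>t. inv (x t) \<otimes> x t) = (\<lambda>t. \<one>)" using loop_closed[OF that(1)] by simp
      then show "small k 0 (\<lambda>t. inv (x t) \<otimes> x t)"
        using Ck_bound_const[of k "0::'e"] chart_at_one(2) by (simp add: small_def log1_eq)
    qed
    show "\<exists>k' e'. 0 < e' \<and> (\<forall>y\<in>LG. \<forall>z\<in>LG.
        loop_near G k' e' x y \<longrightarrow> loop_near G k' e' y z \<longrightarrow> loop_near G k e x z)"
      if x: "x \<in> LG" and e: "0 < e" for k e x
    proof -
      obtain d where d: "d > 0" "\<forall>u\<in>LG. \<forall>v\<in>LG.
          small k d u \<longrightarrow> small k d v \<longrightarrow> small k (e / 2) (\<lambda>t. u t \<otimes> v t)"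
        using small_mult[of "e / 2" k] e by (elim exE conjE meta_impE) (simp, rule that)
      show ?thesis
      proof (intro exI[of _ k] exI[of _ d] conjI ballI impI d(1))
        fix y z assume y: "y \<in> LG" and z: "z \<in> LG"
          and n: "loop_near G k d x y" "loop_near G k d y z"
        have "small k (e / 2) (\<lambda>t. (inv (x t) \<otimes> y t) \<otimes> (inv (y t) \<otimes> z t))"
          using d(2)[rule_format, OF loop_mult[OF loop_inv[OF x] y] loop_mult[OF loop_inv[OF y] z]]
            loop_near_small[OF n(1)] loop_near_small[OF n(2)] by blast
        moreover have "(inv (x t) \<otimes> y t) \<otimes> (inv (y t) \<otimes> z t) = inv (x t) \<otimes> z t" for t
        proof -
          have "y t \<otimes> (inv (y t) \<otimes> z t) = z t"
            using loop_closed[OF y, of t] loop_closed[OF z, of t] by (simp add: m_assoc[symmetric])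
          then show ?thesis
            using loop_closed[OF x, of t] loop_closed[OF y, of t] loop_closed[OF z, of t] by (simp add: m_assoc)
        qed
        ultimately have "small k (e / 2) (\<lambda>t. inv (x t) \<otimes> z t)" by simp
        then show "loop_near G k e x z" by (rule small_loop_near) (use e in simp)
      qed
    qed
    show "small k e x" if "x \<in> LG" "loop_near G k e \<one>\<^bsub>loop_group G\<^esub> x" for k e x
      using loop_near_small[OF that(2)] one[OF that(1)] by simp
    show "loop_near G k e \<one>\<^bsub>loop_group G\<^esub> x"
      if "x \<in> LG" "small k d x" "d < e" for k e d x
      using small_loop_near[of k d "\<lambda>t. \<one>" x e] that one[OF that(1)] by simp
  qed (simp_all add: loop_one)
qed

text \<open>Near each point \<open>y\<close> is either \<open>x\<close> or constantly the unit, so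
  smoothness is local and no bound deteriorates.\<close>

lemma loop_split:
  assumes A: "openin (top_of_set circle) A" and B: "openin (top_of_set circle) B" and AB: "A \<inter> B = {}"
    and x: "x \<in> LG" and sup: "supp (loop_group G) x \<subseteq> A \<union> B" and b: "small k e x"
    and y_def: "y = (\<lambda>t. if cis t \<in> A then x t else \<one>)"
  shows "y \<in> localized (loop_group G) A" "small k e y"
proof -
  have K: "closure (cis ` {t. x t \<noteq> \<one>}) \<subseteq> A \<union> B" using sup by simp
  note cut = circle_cutoff[OF A B AB K y_def]
  have "smooth_into G UNIV y"
  proof (rule smooth_into_local)
    fix t :: real
    obtain T where T: "open T" "t \<in> T" "(\<forall>s\<in>T. y s = x s) \<or> (\<forall>s\<in>T. y s = \<one>)" using cut(1) by blast
    have "smooth_into G T y"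
      using T(3)
    proof
      assume "\<forall>s\<in>T. y s = x s"
      then show ?thesis
        using x by (intro smooth_into_cong[of G UNIV x T y] T(1)) (simp_all add: carrier_loop_group)
    next
      assume "\<forall>s\<in>T. y s = \<one>"
      then show ?thesis
        by (intro smooth_into_cong[OF smooth_into_const[OF one_closed] T(1)]) simp_all
    qed
    then show "\<exists>T. open T \<and> t \<in> T \<and> smooth_into G T y" using T by blast
  qed
  moreover have "y (t + 2 * pi) = y t" for t
  proof -
    have "cis (t + 2 * pi) = cis t" by (simp add: cis_eq_iff exI[of _ 1])
    then show ?thesis unfolding y_def using x by (simp add: carrier_loop_group)
  qed
  ultimately have "y \<in> LG" by (simp add: carrier_loop_group)
  then show "y \<in> localized (loop_group G) A" using cut(2) by (simp add: localized_def)
  have "Ck_bound k e (\<lambda>t. log1 G (y t))"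
  proof (rule Ck_bound_if_zero)
    show "Ck_bound k e (\<lambda>t. log1 G (x t))" using b by (simp add: small_def)
    fix t
    obtain T where T: "open T" "t \<in> T" "(\<forall>s\<in>T. y s = x s) \<or> (\<forall>s\<in>T. y s = \<one>)" using cut(1) by blast
    have "(\<forall>s\<in>T. log1 G (y s) = log1 G (x s)) \<or> (\<forall>s\<in>T. log1 G (y s) = 0)"
      using T(3) by (auto simp: log1_eq)
    then show "\<exists>T. open T \<and> t \<in> T \<and> ((\<forall>s\<in>T. log1 G (y s) = log1 G (x s)) \<or> (\<forall>s\<in>T. log1 G (y s) = 0))"
      using T(1,2) by blast
  qed
  then show "small k e y" using b chart_at_one(2) by (simp add: small_def y_def)
qed

lemma localizable_group_loop_group: "localizable_group (loop_group G)"
proof (rule localizable_groupI[OF group_loop_group loop_nhd])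
  fix k and e :: real assume e: "0 < e"
  show "\<exists>l. \<exists>d>0. \<forall>x\<in>LG. \<forall>y\<in>LG.
      small l d x \<longrightarrow> small l d y \<longrightarrow> small k e (x \<otimes>\<^bsub>loop_group G\<^esub> y)"
    using small_mult[OF e, of k] by (intro exI[of _ k]) simp
  show "\<exists>l. \<exists>d>0. \<forall>x\<in>LG. small l d x \<longrightarrow> small k e (inv\<^bsub>loop_group G\<^esub> x)"
    using small_inv[OF e, of k] by (intro exI[of _ k]) (simp add: loop_inv_eq)
next
  fix x y
  have "cis ` {t. x t \<otimes> y t \<noteq> \<one>} \<subseteq> cis ` {t. x t \<noteq> \<one>} \<union> cis ` {t. y t \<noteq> \<one>}"
    by (auto simp: image_iff) (metis one_closed r_one)
  from closure_mono[OF this]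
  show "supp (loop_group G) (x \<otimes>\<^bsub>loop_group G\<^esub> y) \<subseteq> supp (loop_group G) x \<union> supp (loop_group G) y"
    by simp
next
  fix x assume x: "x \<in> LG"
  show "supp (loop_group G) (inv\<^bsub>loop_group G\<^esub> x) \<subseteq> supp (loop_group G) x"
    using loop_closed[OF x] by (simp add: loop_inv_eq[OF x] inv_eq_1_iff)
next
  fix A B x k e
  assume A: "openin (top_of_set circle) A" and B: "openin (top_of_set circle) B" and AB: "A \<inter> B = {}"
    and x: "x \<in> LG" and sup: "supp (loop_group G) x \<subseteq> A \<union> B" and s: "small k e x"
  have BA: "B \<inter> A = {}" and sup': "supp (loop_group G) x \<subseteq> B \<union> A" using AB sup by blast+
  define y where "y = (\<lambda>t. if cis t \<in> A then x t else \<one>)"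
  define z where "z = (\<lambda>t. if cis t \<in> B then x t else \<one>)"
  \<comment> \<open>The product is pointwise and \<open>A\<close>, \<open>B\<close> are disjoint, so
    at each \<open>t\<close> at least one factor is the unit.\<close>
  have "y t \<otimes> z t = x t" for t
    using circle_cutoff(3)[OF A B AB _ y_def, of t] sup AB loop_closed[OF x, of t]
    by (auto simp: y_def z_def)
  then have "x = y \<otimes>\<^bsub>loop_group G\<^esub> z" by simp
  then show "\<exists>y z. y \<in> localized (loop_group G) A \<and> small k e y \<and>
      z \<in> localized (loop_group G) B \<and> small k e z \<and> x = y \<otimes>\<^bsub>loop_group G\<^esub> z"
    using loop_split[OF A B AB x sup s y_def] loop_split[OF B A BA x sup' s z_def] by blast
qed

end

theorem theorem4p2:
  fixes \<A> :: "complex set \<Rightarrow> ('h::{chilbert,second_countable_topology} \<Rightarrow>\<^sub>L 'h) set"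
    and U :: "(real \<Rightarrow> real) set \<Rightarrow> ('h \<Rightarrow>\<^sub>L 'h)"
    and \<Omega> :: 'h
    and \<rho> :: "complex set \<Rightarrow> ('h \<Rightarrow>\<^sub>L 'h) \<Rightarrow> ('k::{chilbert,second_countable_topology} \<Rightarrow>\<^sub>L 'k)"
    and a b :: "nat \<Rightarrow> real"
  assumes net: "conformal_net \<A> U \<Omega>"
    and DHR: "DHR_representation \<A> \<rho>"
    and cover: "cover_angles a b"
  shows "(\<forall>(G :: ('g, 'e::euclidean_space) lie_grp) B \<pi>t N \<Xi> W s c U0.
            compact_simple_sc_group G \<and> basic_form G B \<and>
            localized_vacuum_rep \<A> (loop_group G) (loop_group_ext G B) loop_proj
              (loop_centre G B) \<pi>t \<and>
            loop_covariant U (loop_group_ext G B) \<pi>t \<and>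
            fragmentation (loop_group G) (cover_arc a b) N \<Xi> \<and>
            local_section (loop_group G) (loop_group_ext G B) loop_proj W s \<and>
            local_cocycle (loop_group G) W (\<pi>t \<circ> s) c \<and>
            small_domain (loop_group G) N \<Xi> W U0 \<longrightarrow>
            (\<exists>V. nhd_of_one (loop_group G) V \<and> V \<subseteq> U0 \<and>
              decomposition_independent (loop_group G) (cover_arc a b) \<rho> (\<pi>t \<circ> s) c \<Xi> V \<and>
              local_multiplier_rep (loop_group G) c V U0
                (pi_rho (loop_group G) (cover_arc a b) \<rho> (\<pi>t \<circ> s) c \<Xi>)))
       \<and> (\<forall>\<pi>t N \<Xi> W s c U0.
            localized_vacuum_rep \<A> Diff_cover Vir snd Vir_centre \<pi>t \<and>
            Vir_lift_of U \<pi>t \<and>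
            diffeo_fragmentation a b N \<Xi> \<and>
            local_section Diff_cover Vir snd W s \<and>
            local_cocycle Diff_cover W (\<pi>t \<circ> s) c \<and>
            small_domain Diff_cover N \<Xi> W U0 \<longrightarrow>
            (\<exists>V. nhd_of_one Diff_cover V \<and> V \<subseteq> U0 \<and>
              decomposition_independent Diff_cover (cover_arc a b) \<rho> (\<pi>t \<circ> s) c \<Xi> V \<and>
              local_multiplier_rep Diff_cover c V U0
                (pi_rho Diff_cover (cover_arc a b) \<rho> (\<pi>t \<circ> s) c \<Xi>)))"
proof -
  have loop: "localizable_group (loop_group G)" if "compact_simple_sc_group G" for G :: "('g, 'e) lie_grp"
    by (rule lie_group_loops.localizable_group_loop_group, unfold_locales)
      (use that in \<open>simp add: compact_simple_sc_group_def\<close>)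
  \<comment> \<open>The net, its representation and the arcs are shared by both cases; each case
    then supplies its own localizable group.\<close>
  note main = fragments_local_multiplier_rep[OF net DHR cover_arc_interval_cover[OF cover]]
  show ?thesis unfolding diffeo_fragmentation_def
    by (intro conjI allI impI; elim conjE)
      (rule main[OF loop], assumption+, rule main[OF localizable_group_Diff_cover], assumption+)
qed

end
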